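(* The redundancy rank of a connected abelian Lie group $A$ is equal to $2\dim A-\dim T$, where $T$ is the maximal torus of $A$.
   Context: A subset $S$ of a topological group $G$ generates $G$ if the subgroup $\langle S\rangle$ abstractly generated by $S$ is dense in $G$. A generating subset $S$ of $G$ is irredundant if, for every $s\in S$, the set $S\setminus\{s\}$ no longer generates $G$. The redundancy rank of $G$ is the maximal size (possibly $\infty$) of an irredundant finite generating subset of $G$; equivalently, it is the minimal $m\in\{0,1,2,\dots\}\cup\{\infty\}$ such that every finite generating subset $S$ of $G$ with $|S|>m$ has a proper subset that still generates $G$. The maximal torus of a connected abelian Lie group is its maximal compact subgroup. *)

theory Defs
  imports "HOL-Analysis.Analysis" "HOL-Algebra.Generated_Groups"
begin

text \<open>
  \<open>\<real>\<^sup>n\<close> is \<^term>\<open>Euclidean_space n\<close>, the space of functions \<open>nat \<Rightarrow> real\<close> vanishing from index \<open>n\<close> on.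
  Unlike \<open>real ^ 'n\<close> it allows \<open>n = 0\<close>, and \<open>n\<close> can be an ordinary variable.
\<close>

section \<open>Smooth maps between open subsets of Euclidean spaces\<close>

definition partial_deriv :: "nat \<Rightarrow> ((nat \<Rightarrow> real) \<Rightarrow> real) \<Rightarrow> (nat \<Rightarrow> real) \<Rightarrow> real" where
  "partial_deriv i f x = deriv (\<lambda>t. f (x(i := t))) (x i)"

text \<open>
  \<open>C_on k n U f\<close>: on the open subset \<open>U\<close> of \<open>\<real>\<^sup>n\<close>, all partial derivatives of \<open>f\<close> of order at most
  \<open>k\<close> exist and are continuous. Values of \<open>f\<close> outside \<open>U\<close> are irrelevant.
\<close>

primrec C_on :: "nat \<Rightarrow> nat \<Rightarrow> (nat \<Rightarrow> real) set \<Rightarrow> ((nat \<Rightarrow> real) \<Rightarrow> real) \<Rightarrow> bool" where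
  "C_on 0 n U f \<longleftrightarrow> continuous_map (subtopology (Euclidean_space n) U) euclideanreal f"
| "C_on (Suc k) n U f \<longleftrightarrow>
     continuous_map (subtopology (Euclidean_space n) U) euclideanreal f \<and>
     (\<forall>i<n. (\<forall>x\<in>U. (\<lambda>t. f (x(i := t))) field_differentiable at (x i)) \<and>
            C_on k n U (partial_deriv i f))"

definition smooth_real_map_on ::
    "nat \<Rightarrow> nat \<Rightarrow> (nat \<Rightarrow> real) set \<Rightarrow> ((nat \<Rightarrow> real) \<Rightarrow> nat \<Rightarrow> real) \<Rightarrow> bool" where
  "smooth_real_map_on n m U F \<longleftrightarrow> (\<forall>j<m. \<forall>k. C_on k n U (\<lambda>x. F x j))"


section \<open>Smooth manifolds\<close>

text \<open>A chart is a pair of an open domain and a coordinate map, which is unconstrained off the domain.\<close>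

type_synonym 'a chart = "'a set \<times> ('a \<Rightarrow> nat \<Rightarrow> real)"

definition is_chart :: "'a topology \<Rightarrow> nat \<Rightarrow> 'a chart \<Rightarrow> bool" where
  "is_chart X n = (\<lambda>(U, \<phi>).
     openin X U \<and> openin (Euclidean_space n) (\<phi> ` U) \<and>
     homeomorphic_map (subtopology X U) (subtopology (Euclidean_space n) (\<phi> ` U)) \<phi>)"

definition smooth_compatible :: "nat \<Rightarrow> 'a chart \<Rightarrow> 'a chart \<Rightarrow> bool" where
  "smooth_compatible n = (\<lambda>(U, \<phi>) (V, \<psi>).
     smooth_real_map_on n n (\<phi> ` (U \<inter> V)) (\<psi> \<circ> inv_into U \<phi>))"

locale smooth_manifold =
  fixes X :: "'a topology" and n :: nat and atlas :: "'a chart set"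
  assumes Hausdorff: "Hausdorff_space X"
    and second_countable: "second_countable X"
    and charts: "\<And>c. c \<in> atlas \<Longrightarrow> is_chart X n c"
    and cover: "topspace X = (\<Union>(U, \<phi>)\<in>atlas. U)"
    and compatible: "\<And>c d. \<lbrakk>c \<in> atlas; d \<in> atlas\<rbrakk> \<Longrightarrow> smooth_compatible n c d"

definition smooth_map ::
    "'a topology \<Rightarrow> nat \<Rightarrow> 'a chart set \<Rightarrow> 'b topology \<Rightarrow> nat \<Rightarrow> 'b chart set \<Rightarrow> ('a \<Rightarrow> 'b) \<Rightarrow> bool" where
  "smooth_map X n \<A> Y m \<B> f \<longleftrightarrow>
     continuous_map X Y f \<and>
     (\<forall>(U, \<phi>)\<in>\<A>. \<forall>(V, \<psi>)\<in>\<B>.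
        smooth_real_map_on n m (\<phi> ` (U \<inter> f -` V)) (\<psi> \<circ> f \<circ> inv_into U \<phi>))"

text \<open>Product charts, using the identification \<open>\<real>\<^sup>n \<times> \<real>\<^sup>m = \<real>\<^sup>n\<^sup>+\<^sup>m\<close> by concatenation of coordinates.\<close>

definition coord_append :: "nat \<Rightarrow> (nat \<Rightarrow> real) \<Rightarrow> (nat \<Rightarrow> real) \<Rightarrow> nat \<Rightarrow> real" where
  "coord_append n x y = (\<lambda>i. if i < n then x i else y (i - n))"

definition prod_atlas :: "nat \<Rightarrow> 'a chart set \<Rightarrow> 'b chart set \<Rightarrow> ('a \<times> 'b) chart set" where
  "prod_atlas n \<A> \<B> =
     {(U \<times> V, \<lambda>(x, y). coord_append n (\<phi> x) (\<psi> y)) | U \<phi> V \<psi>. (U, \<phi>) \<in> \<A> \<and> (V, \<psi>) \<in> \<B>}"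


section \<open>Topological groups and Lie groups\<close>

locale topological_group = group G for G (structure) +
  fixes X :: "'a topology"
  assumes topspace_eq: "topspace X = carrier G"
    and continuous_mult: "continuous_map (prod_topology X X) X (\<lambda>(x, y). x \<otimes> y)"
    and continuous_inv: "continuous_map X X (\<lambda>x. inv x)"

text \<open>A real Lie group of dimension \<open>n\<close>.\<close>

locale lie_group = topological_group G X + smooth_manifold X n atlas
  for G (structure) and X :: "'a topology" and n atlas +
  assumes smooth_mult:
      "smooth_map (prod_topology X X) (n + n) (prod_atlas n atlas atlas) X n atlas (\<lambda>(x, y). x \<otimes> y)"
    and smooth_inv: "smooth_map X n atlas X n atlas (\<lambda>x. inv x)"

text \<open>
  The dimension of a topological group that admits the structure of a Lie group. It does not depend
  on the atlas, by invariance of dimension. A compact subgroup of a Lie group is closed, hence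
  is a Lie group in the subspace topology.
\<close>

definition lie_dim :: "('a, 'b) monoid_scheme \<Rightarrow> 'a topology \<Rightarrow> nat" where
  "lie_dim G X = (THE d. \<exists>atlas. lie_group G X d atlas)"

definition maximal_compact_subgroup :: "('a, 'b) monoid_scheme \<Rightarrow> 'a topology \<Rightarrow> 'a set \<Rightarrow> bool" where
  "maximal_compact_subgroup G X K \<longleftrightarrow>
     subgroup K G \<and> compactin X K \<and>
     (\<forall>L. subgroup L G \<and> compactin X L \<and> K \<subseteq> L \<longrightarrow> L = K)"

text \<open>For a connected abelian Lie group, where there is exactly one maximal compact subgroup.\<close>

definition maximal_torus :: "('a, 'b) monoid_scheme \<Rightarrow> 'a topology \<Rightarrow> 'a set" where
  "maximal_torus G X = (THE K. maximal_compact_subgroup G X K)"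


section \<open>Redundancy rank\<close>

definition top_generates :: "('a, 'b) monoid_scheme \<Rightarrow> 'a topology \<Rightarrow> 'a set \<Rightarrow> bool" where
  "top_generates G X S \<longleftrightarrow> S \<subseteq> carrier G \<and> X closure_of (generate G S) = topspace X"

definition irredundant_generating :: "('a, 'b) monoid_scheme \<Rightarrow> 'a topology \<Rightarrow> 'a set \<Rightarrow> bool" where
  "irredundant_generating G X S \<longleftrightarrow>
     top_generates G X S \<and> (\<forall>s\<in>S. \<not> top_generates G X (S - {s}))"

text \<open>
  The supremum in \<^typ>\<open>enat\<close> is a maximum, or \<open>\<infinity>\<close> if the sizes are unbounded; it is \<open>0\<close> if there is no
  finite generating set, as in the description by the least bound \<open>m\<close>.
\<close>

definition redundancy_rank :: "('a, 'b) monoid_scheme \<Rightarrow> 'a topology \<Rightarrow> enat" where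
  "redundancy_rank G X = (SUP S\<in>{S. finite S \<and> irredundant_generating G X S}. enat (card S))"

end

theory Submission
  imports Defs "HOL-Library.Function_Algebras" "HOL-Homology.Invariance_of_Domain"
begin

text \<open>
  In a chart around the identity the group law is \<open>x + y + R x y\<close> where the mixed second differences
  of \<open>R\<close> are bounded, so \<open>2 ^ k\<close>-th powers of \<open>v / 2 ^ k\<close> converge to a local homomorphism that is
  bi-Lipschitz, hence open by invariance of domain. It extends to a continuous open surjective
  homomorphism \<open>E\<close> from \<open>\<real>\<^sup>n\<close> with discrete kernel \<open>\<Gamma>\<close>, and one may assume that \<open>\<Gamma>\<close> spans \<open>\<real>\<^sup>b\<close>
  and contains the first \<open>b\<close> unit vectors. The maximal torus is then \<open>E (\<real>\<^sup>b)\<close>.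

  By Kronecker's theorem a set generates the group iff no nonzero linear functional on \<open>\<real>\<^sup>n\<close> is integral
  on all preimages of its elements and on \<open>\<Gamma>\<close>. The lifts of an irredundant generating set contain at
  most \<open>n - b\<close> vectors completing the \<open>b\<close> unit vectors to an independent set, and the remaining elements
  have functionals that are linearly independent over the rationals in a space of dimension at
  most \<open>n\<close>; this gives the bound \<open>2 n - b\<close>. It is attained by the images of the last \<open>n - b\<close> unit vectors
  and of an irrational multiple of all \<open>n\<close> unit vectors.
\<close>


section \<open>Kronecker's theorem for subgroups of a real coordinate space\<close>

text \<open>Working with mixed second differences makes every estimate one about finite differences
  in the 1-norm: with one corner at the identity a mixed difference compares \<open>\<mu>\<close>
  with addition, one squaring is a doubling up to a quadratic error, and over \<open>k\<close>
  squarings the relative errors form a geometric series dominated by the last one. Commutativity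
  makes the limit additive, because the power of a product is the product of the powers. The
  exponential is obtained as a bi-Lipschitz map, so the Lie structure on the torus, which
  \<open>lie_dim\<close> asks for, is built afresh from local inverses of \<open>E\<close>, whose
  transition maps are affine.

  The kernel may be strictly larger than the integral points of its span.

  Linear independence is taken over the rationals because a generator is detected by a functional
  that is integral on the other generators and irrational on this one; real coefficients would blur
  the distinction. Hence a direction outside the torus can carry two generators, like 1 and an
  irrational number in the real line, and a direction inside it only one.\<close>

instantiation "fun" :: (type, real_vector) real_vector
begin

definition "c *\<^sub>R f = (\<lambda>x. c *\<^sub>R f x)"

instance
  by standard (auto simp: scaleR_fun_def fun_eq_iff algebra_simps)

end

lemma scaleR_fun_apply [simp]: "(c *\<^sub>R f) x = c *\<^sub>R f x"
  by (simp add: scaleR_fun_def)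

lemma sum_fun_apply: "(\<Sum>i\<in>I. f i) x = (\<Sum>i\<in>I. f i x)"
  by (induction I rule: infinite_finite_induct) auto

definition additive_subgroup :: "'a::ab_group_add set \<Rightarrow> bool" where
  "additive_subgroup H \<longleftrightarrow> 0 \<in> H \<and> (\<forall>x\<in>H. \<forall>y\<in>H. x - y \<in> H)"

lemma additive_subgroup_zero: "additive_subgroup H \<Longrightarrow> 0 \<in> H"
  and additive_subgroup_diff: "additive_subgroup H \<Longrightarrow> x \<in> H \<Longrightarrow> y \<in> H \<Longrightarrow> x - y \<in> H"
  by (auto simp: additive_subgroup_def)

lemma additive_subgroup_minus: "additive_subgroup H \<Longrightarrow> x \<in> H \<Longrightarrow> - x \<in> H"
  using additive_subgroup_diff[of H 0 x] additive_subgroup_zero by fastforce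

lemma additive_subgroup_add: "additive_subgroup H \<Longrightarrow> x \<in> H \<Longrightarrow> y \<in> H \<Longrightarrow> x + y \<in> H"
  using additive_subgroup_diff[of H x "- y"] additive_subgroup_minus by fastforce

lemma additive_subgroup_of_nat_scaleR:
  fixes x :: "'a::real_vector"
  assumes "additive_subgroup H" "x \<in> H"
  shows "of_nat k *\<^sub>R x \<in> H"
  by (induction k)
    (auto simp: scaleR_add_left additive_subgroup_zero additive_subgroup_add assms)

lemma additive_subgroup_of_int_scaleR:
  fixes x :: "'a::real_vector"
  assumes "additive_subgroup H" "x \<in> H"
  shows "of_int k *\<^sub>R x \<in> H"
proof (cases k)
  case (nonneg m)
  then show ?thesis using additive_subgroup_of_nat_scaleR[OF assms, of m] by simp
next
  case (neg m)
  then show ?thesis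
    using additive_subgroup_minus[OF assms(1) additive_subgroup_of_nat_scaleR[OF assms, of "Suc m"]]
    by (simp del: of_nat_Suc)
qed

text \<open>Only the coordinates in \<open>I\<close> are compared, so the induction in
  \<open>kronecker_duality\<close> can drop a coordinate without changing the type.\<close>

definition dense_on_coords :: "'i set \<Rightarrow> ('i \<Rightarrow> real) set \<Rightarrow> bool" where
  "dense_on_coords I H \<longleftrightarrow> (\<forall>x. \<forall>e>0. \<exists>h\<in>H. \<forall>i\<in>I. \<bar>h i - x i\<bar> < e)"

text \<open>Bolzano-Weierstrass by successive extraction, one coordinate of \<open>I\<close> after
  another; passing to a further subsequence preserves the limits already obtained.\<close>

lemma coordinatewise_convergent_subsequence:
  fixes x :: "nat \<Rightarrow> 'i \<Rightarrow> real"
  assumes "finite I" "\<And>k i. i \<in> I \<Longrightarrow> \<bar>x k i\<bar> \<le> M i"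
  shows "\<exists>r l. strict_mono (r::nat \<Rightarrow> nat) \<and> (\<forall>i\<in>I. (\<lambda>k. x (r k) i) \<longlonglongrightarrow> l i)"
  using assms
proof (induction I rule: finite_induct)
  case empty
  then show ?case using strict_mono_id by blast
next
  case (insert j I)
  then obtain r l where r: "strict_mono (r::nat \<Rightarrow> nat)"
    and l: "\<And>i. i \<in> I \<Longrightarrow> (\<lambda>k. x (r k) i) \<longlonglongrightarrow> l i"
    by (metis insertCI)
  have "bounded (range (\<lambda>k. x (r k) j))"
    using insert.prems[of j] by (intro boundedI[of _ "M j"]) auto
  then obtain a s where s: "strict_mono (s::nat \<Rightarrow> nat)" and a: "((\<lambda>k. x (r k) j) \<circ> s) \<longlonglongrightarrow> a"
    using bounded_imp_convergent_subsequence by blast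
  have "(\<lambda>k. x ((r \<circ> s) k) i) \<longlonglongrightarrow> (l(j := a)) i" if "i \<in> insert j I" for i
  proof (cases "i = j")
    case True
    then show ?thesis using a by (simp add: o_def)
  next
    case False
    then show ?thesis
      using LIMSEQ_subseq_LIMSEQ[OF l[of i] s] that by (simp add: o_def)
  qed
  then show ?case
    using strict_mono_o[OF r s] by blast
qed

text \<open>Arbitrarily short elements, scaled to 1-norm 1, have directions that accumulate at some
  \<open>u\<close>. Integer multiples of a very short element then approximate every point of the
  line through \<open>u\<close>, because the rounding error is at most the length of that
  element.\<close>

lemma closure_contains_line:
  fixes H :: "('i \<Rightarrow> real) set"
  assumes I: "finite I" and H: "additive_subgroup H"
    and small: "\<And>e. e > 0 \<Longrightarrow> \<exists>h\<in>H. (\<exists>i\<in>I. h i \<noteq> 0) \<and> (\<forall>i\<in>I. \<bar>h i\<bar> < e)"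
  shows "\<exists>u. (\<exists>j\<in>I. u j \<noteq> 0) \<and> (\<forall>t. \<forall>e>0. \<exists>h\<in>H. \<forall>i\<in>I. \<bar>h i - t * u i\<bar> < e)"
proof -
  have "\<exists>h\<in>H. (\<exists>i\<in>I. h i \<noteq> 0) \<and> (\<forall>i\<in>I. \<bar>h i\<bar> < inverse (real (Suc k)))" for k
    by (rule small) auto
  then obtain h where hH: "\<And>k. h k \<in> H" and h0: "\<And>k. \<exists>i\<in>I. h k i \<noteq> 0"
    and hs: "\<And>k i. i \<in> I \<Longrightarrow> \<bar>h k i\<bar> < inverse (real (Suc k))"
    by metis
  define N where "N k = (\<Sum>i\<in>I. \<bar>h k i\<bar>)" for k
  have Npos: "N k > 0" for k
  proof -
    obtain i where "i \<in> I" "h k i \<noteq> 0" using h0 by blast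
    then show ?thesis unfolding N_def by (intro sum_pos2[OF I]) auto
  qed
  have le: "\<bar>h k i\<bar> \<le> N k" if "i \<in> I" for k i
    unfolding N_def using that I by (intro member_le_sum) auto
  have N0: "N \<longlonglongrightarrow> 0"
  proof (rule tendsto_sandwich[of "\<lambda>_. 0" N _ "\<lambda>k. real (card I) * inverse (real (Suc k))"])
    show "\<forall>\<^sub>F k in sequentially. N k \<le> real (card I) * inverse (real (Suc k))"
      unfolding N_def using hs by (intro always_eventually allI sum_bounded_above) (auto intro: less_imp_le)
    show "(\<lambda>k. real (card I) * inverse (real (Suc k))) \<longlonglongrightarrow> 0"
      using tendsto_mult_right_zero[OF LIMSEQ_inverse_real_of_nat] .
  qed (use Npos in \<open>auto intro!: always_eventually less_imp_le\<close>)
  define x where "x k i = h k i / N k" for k i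
  have "\<bar>x k i\<bar> \<le> 1" if "i \<in> I" for k i
    using le[OF that, of k] Npos[of k] by (simp add: x_def)
  then obtain r u where r: "strict_mono (r::nat \<Rightarrow> nat)" and u: "\<And>i. i \<in> I \<Longrightarrow> (\<lambda>k. x (r k) i) \<longlonglongrightarrow> u i"
    using coordinatewise_convergent_subsequence[OF I, of x "\<lambda>_. 1"] by blast
  \<comment> \<open>The norm is a finite sum over \<open>I\<close>, so the limit direction keeps
    norm 1 and is nonzero.\<close>
  have "(\<lambda>k. \<Sum>i\<in>I. \<bar>x (r k) i\<bar>) \<longlonglongrightarrow> (\<Sum>i\<in>I. \<bar>u i\<bar>)"
    by (intro tendsto_sum tendsto_rabs u)
  moreover have "(\<Sum>i\<in>I. \<bar>x k i\<bar>) = 1" for k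
  proof -
    have "(\<Sum>i\<in>I. \<bar>x k i\<bar>) = (\<Sum>i\<in>I. \<bar>h k i\<bar>) / N k"
      using Npos[of k] by (simp add: x_def abs_divide flip: sum_divide_distrib)
    also have "\<dots> = N k / N k" by (simp add: N_def)
    finally have "(\<Sum>i\<in>I. \<bar>x k i\<bar>) = N k / N k" .
    then show ?thesis using Npos[of k] by simp
  qed
  ultimately have "(\<Sum>i\<in>I. \<bar>u i\<bar>) = 1"
    by (simp add: LIMSEQ_const_iff)
  then have "\<exists>j\<in>I. u j \<noteq> 0"
    by (metis abs_zero sum.neutral zero_neq_one)
  moreover have "\<exists>g\<in>H. \<forall>i\<in>I. \<bar>g i - t * u i\<bar> < e" if "e > 0" for t e
  proof -
    have NN: "(\<lambda>k. N (r k)) \<longlonglongrightarrow> 0"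
      using LIMSEQ_subseq_LIMSEQ[OF N0 r] by (simp add: o_def)
    \<comment> \<open>Rounding \<open>t\<close> down to a multiple of \<open>N (r k)\<close> costs
      at most \<open>N (r k)\<close>, which tends to 0.\<close>
    have "(\<lambda>k. of_int \<lfloor>t / N (r k)\<rfloor> * N (r k) - t) \<longlonglongrightarrow> 0"
    proof (rule Lim_null_comparison[OF _ NN])
      have "\<bar>of_int \<lfloor>t / N k\<rfloor> * N k - t\<bar> \<le> N k" for k
        using floor_divide_lower[OF Npos, of t k] floor_divide_upper[OF Npos, of t k]
        by (simp add: distrib_right abs_le_iff)
      then show "\<forall>\<^sub>F k in sequentially. norm (of_int \<lfloor>t / N (r k)\<rfloor> * N (r k) - t) \<le> N (r k)"
        by simp
    qed
    then have t: "(\<lambda>k. of_int \<lfloor>t / N (r k)\<rfloor> * N (r k)) \<longlonglongrightarrow> t"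
      by (rule LIM_zero_cancel)
    have "\<forall>\<^sub>F k in sequentially. \<bar>of_int \<lfloor>t / N (r k)\<rfloor> * h (r k) i - t * u i\<bar> < e" if "i \<in> I" for i
    proof -
      have "of_int \<lfloor>t / N (r k)\<rfloor> * N (r k) * x (r k) i = of_int \<lfloor>t / N (r k)\<rfloor> * h (r k) i" for k
        using Npos[of "r k"] by (simp add: x_def)
      then have "(\<lambda>k. of_int \<lfloor>t / N (r k)\<rfloor> * h (r k) i) \<longlonglongrightarrow> t * u i"
        using tendsto_mult[OF t u[OF that]] by (simp only:)
      then show ?thesis
        using \<open>e > 0\<close> by (auto simp: tendsto_iff dist_real_def)
    qed
    then have "\<forall>\<^sub>F k in sequentially. \<forall>i\<in>I. \<bar>of_int \<lfloor>t / N (r k)\<rfloor> * h (r k) i - t * u i\<bar> < e"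
      using I by (simp add: eventually_ball_finite)
    then obtain k where "\<forall>i\<in>I. \<bar>of_int \<lfloor>t / N (r k)\<rfloor> * h (r k) i - t * u i\<bar> < e"
      using eventually_sequentially by auto
    then show ?thesis
      using additive_subgroup_of_int_scaleR[OF H hH, of "\<lfloor>t / N (r k)\<rfloor>" "r k"] by (intro bexI) auto
  qed
  ultimately show ?thesis by blast
qed

text \<open>For \<open>u j \<noteq> 0\<close> this is the projection along the line of
  \<open>u\<close> onto the hyperplane where coordinate \<open>j\<close> vanishes, a model of the
  quotient by that line in the remaining coordinates.\<close>

definition project_along :: "'i \<Rightarrow> ('i \<Rightarrow> real) \<Rightarrow> ('i \<Rightarrow> real) \<Rightarrow> 'i \<Rightarrow> real" where
  "project_along j u h = h - (h j / u j) *\<^sub>R u"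

lemma project_along_diff:
  "project_along j u (g - h) = project_along j u g - project_along j u h"
  by (simp add: project_along_def fun_eq_iff algebra_simps diff_divide_distrib)

lemma additive_subgroup_project_along:
  assumes "additive_subgroup H"
  shows "additive_subgroup (project_along j u ` H)"
  using assms unfolding additive_subgroup_def
  by (auto simp flip: project_along_diff intro!: image_eqI[of _ "project_along j u" 0])
     (auto simp: project_along_def)

text \<open>For \<open>u j \<noteq> 0\<close> a functional on the quotient by the line is pulled
  back to one that vanishes on \<open>u\<close>; this condition dictates its coefficient at
  \<open>j\<close>.\<close>

lemma functional_from_projection:
  fixes H :: "('i \<Rightarrow> real) set"
  assumes I: "finite I" and j: "j \<in> I"
    and c: "\<exists>i\<in>I - {j}. c i \<noteq> 0"
    and int: "\<And>h. h \<in> H \<Longrightarrow> (\<Sum>i\<in>I - {j}. c i * project_along j u h i) \<in> \<int>"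
  shows "\<exists>c. (\<exists>i\<in>I. c i \<noteq> 0) \<and> (\<forall>h\<in>H. (\<Sum>i\<in>I. c i * h i) \<in> \<int>)"
proof -
  define d where "d = c(j := - (\<Sum>i\<in>I - {j}. c i * u i) / u j)"
  have "(\<Sum>i\<in>I. d i * h i) = (\<Sum>i\<in>I - {j}. c i * project_along j u h i)" for h
  proof -
    have "(\<Sum>i\<in>I. d i * h i) = d j * h j + (\<Sum>i\<in>I - {j}. d i * h i)"
      using I j by (simp add: sum.remove)
    also have "(\<Sum>i\<in>I - {j}. d i * h i) = (\<Sum>i\<in>I - {j}. c i * h i)"
      by (intro sum.cong) (auto simp: d_def)
    also have "d j * h j = - (\<Sum>i\<in>I - {j}. c i * (h j / u j * u i))"
      by (simp add: d_def sum_divide_distrib sum_distrib_left mult_ac)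
    finally show ?thesis
      by (simp add: project_along_def right_diff_distrib sum_subtractf)
  qed
  then have "\<forall>h\<in>H. (\<Sum>i\<in>I. d i * h i) \<in> \<int>" using int by simp
  moreover have "\<exists>i\<in>I. d i \<noteq> 0" using c by (auto simp: d_def)
  ultimately show ?thesis by blast
qed

text \<open>Density would lift through the projection: once a target is matched modulo the line, the
  remaining error is a multiple of \<open>u\<close> up to \<open>e / 2\<close>, and elements of
  \<open>H\<close> approximate that multiple.\<close>

lemma not_dense_projection_line:
  fixes H :: "('i \<Rightarrow> real) set"
  assumes I: "finite I" and H: "additive_subgroup H" and nd: "\<not> dense_on_coords I H"
    and j: "u j \<noteq> 0"
    and line: "\<And>t e. e > 0 \<Longrightarrow> \<exists>h\<in>H. \<forall>i\<in>I. \<bar>h i - t * u i\<bar> < e"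
  shows "\<not> dense_on_coords (I - {j}) (project_along j u ` H)"
proof
  assume d: "dense_on_coords (I - {j}) (project_along j u ` H)"
  have "\<exists>h\<in>H. \<forall>i\<in>I. \<bar>h i - x i\<bar> < e" if "e > 0" for x e
  proof -
    obtain h where h: "h \<in> H" "\<And>i. i \<in> I - {j} \<Longrightarrow> \<bar>project_along j u h i - project_along j u x i\<bar> < e/2"
      using d[unfolded dense_on_coords_def, rule_format, of "e/2" "project_along j u x"] \<open>e > 0\<close>
      by auto
    obtain g where g: "g \<in> H" "\<And>i. i \<in> I \<Longrightarrow> \<bar>g i - (x j / u j - h j / u j) * u i\<bar> < e/2"
      using line \<open>e > 0\<close> by (meson half_gt_zero)
    have "\<bar>(h + g) i - x i\<bar> < e" if "i \<in> I" for i
    proof -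
      have "\<bar>project_along j u h i - project_along j u x i\<bar> < e/2"
        using h(2)[of i] that j \<open>e > 0\<close> by (cases "i = j") (auto simp: project_along_def)
      moreover have "(h + g) i - x i = (project_along j u h i - project_along j u x i)
          + (g i - (x j / u j - h j / u j) * u i)"
        by (simp add: project_along_def algebra_simps)
      ultimately show ?thesis using g(2)[OF that] by linarith
    qed
    then show ?thesis using additive_subgroup_add[OF H h(1) g(1)] by blast
  qed
  then show False using nd unfolding dense_on_coords_def by blast
qed

text \<open>Density of the projection would yield elements of \<open>H\<close> whose projection has
  a coordinate that is positive and tends to 0. Reducing them modulo \<open>v\<close> keeps them
  bounded and does not change the projection, so a subsequence converges. Discreteness makes it
  eventually constant, a contradiction.\<close>

lemma not_dense_projection_discrete:
  fixes H :: "('i \<Rightarrow> real) set"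
  assumes I: "finite I" and H: "additive_subgroup H" and e0: "e0 > 0"
    and disc: "\<And>h. h \<in> H \<Longrightarrow> (\<And>i. i \<in> I \<Longrightarrow> \<bar>h i\<bar> < e0) \<Longrightarrow> (\<forall>i\<in>I. h i = 0)"
    and v: "v \<in> H" "j \<in> I" "v j \<noteq> 0" and ne: "I - {j} \<noteq> {}"
  shows "\<not> dense_on_coords (I - {j}) (project_along j v ` H)"
proof
  assume d: "dense_on_coords (I - {j}) (project_along j v ` H)"
  obtain i0 where i0: "i0 \<in> I - {j}" using ne by blast
  let ?p = "project_along j v"
  \<comment> \<open>Aiming at \<open>1 / (k + 1)\<close> with an error below
    \<open>1 / (k + 1)\<close> forces values strictly between 0 and
    \<open>2 / (k + 1)\<close>.\<close>
  have "\<exists>h\<in>H. \<forall>i\<in>I - {j}. \<bar>?p h i - inverse (real (Suc k))\<bar> < inverse (real (Suc k))" for k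
    using d[unfolded dense_on_coords_def, rule_format, of "inverse (real (Suc k))" "\<lambda>_. inverse (real (Suc k))"]
    by auto
  then obtain h where hH: "\<And>k. h k \<in> H"
    and h: "\<And>k i. i \<in> I - {j} \<Longrightarrow> \<bar>?p (h k) i - inverse (real (Suc k))\<bar> < inverse (real (Suc k))"
    by metis
  define g where "g k = h k - of_int \<lfloor>h k j / v j\<rfloor> *\<^sub>R v" for k
  have gH: "g k \<in> H" for k
    unfolding g_def by (intro additive_subgroup_diff additive_subgroup_of_int_scaleR H hH v)
  have pg: "?p (g k) = ?p (h k)" for k
    using v(3) by (simp add: g_def project_along_def fun_eq_iff field_simps)
  have gi: "g k i = ?p (h k) i + frac (h k j / v j) * v i" for k i
    by (simp add: g_def project_along_def frac_def algebra_simps)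
  have "\<bar>g k i\<bar> \<le> 2 + \<bar>v i\<bar>" if "i \<in> I" for k i
  proof -
    have "\<bar>?p (h k) i\<bar> \<le> 2"
    proof (cases "i = j")
      case True
      then show ?thesis using v(3) by (simp add: project_along_def)
    next
      case False
      moreover have "inverse (real (Suc k)) \<le> 1" by (simp add: field_simps)
      ultimately show ?thesis using h[of i k] that by auto
    qed
    moreover have "\<bar>frac (h k j / v j) * v i\<bar> \<le> 1 * \<bar>v i\<bar>"
      unfolding abs_mult using frac_lt_1[of "h k j / v j"] frac_ge_0[of "h k j / v j"]
      by (intro mult_right_mono) auto
    ultimately show ?thesis unfolding gi by linarith
  qed
  then obtain r l where r: "strict_mono (r::nat \<Rightarrow> nat)" and l: "\<And>i. i \<in> I \<Longrightarrow> (\<lambda>k. g (r k) i) \<longlonglongrightarrow> l i"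
    using coordinatewise_convergent_subsequence[OF I, of g "\<lambda>i. 2 + \<bar>v i\<bar>"] by blast
  have "\<forall>\<^sub>F k in sequentially. \<bar>g (r k) i - l i\<bar> < e0 / 2" if "i \<in> I" for i
    using tendstoD[OF l[OF that], of "e0 / 2"] e0 by (simp add: dist_real_def)
  then have "\<forall>\<^sub>F k in sequentially. \<forall>i\<in>I. \<bar>g (r k) i - l i\<bar> < e0 / 2"
    using I by (simp add: eventually_ball_finite)
  then obtain K where K: "\<And>k i. k \<ge> K \<Longrightarrow> i \<in> I \<Longrightarrow> \<bar>g (r k) i - l i\<bar> < e0 / 2"
    unfolding eventually_sequentially by blast
  have eq: "g (r k) i = g (r K) i" if "k \<ge> K" "i \<in> I" for k i
  proof -
    have "\<bar>(g (r k) - g (r K)) i'\<bar> < e0" if i': "i' \<in> I" for i'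
      using K[OF \<open>k \<ge> K\<close> i'] K[OF order_refl i']
      unfolding fun_diff_def by (simp add: field_simps abs_if split: if_splits)
    then have "\<forall>i\<in>I. (g (r k) - g (r K)) i = 0"
      by (intro disc additive_subgroup_diff H gH) auto
    then show ?thesis using that by auto
  qed
  define a where "a = ?p (h (r K)) i0"
  have a: "?p (h (r k)) i0 = a" if "k \<ge> K" for k
    using eq[OF that, of i0] eq[OF that, of j] i0 v(2) unfolding a_def pg[symmetric]
    by (simp add: project_along_def)
  have "a > 0"
    using h[OF i0, of "r K"] by (auto simp: a_def abs_less_iff)
  obtain m where m: "inverse (real (Suc m)) < a / 2"
    using reals_Archimedean[of "a/2"] \<open>a > 0\<close> by auto
  define k where "k = max K m"
  have "r k \<ge> m" using seq_suble[OF r, of k] by (simp add: k_def)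
  then have "inverse (real (Suc (r k))) \<le> inverse (real (Suc m))" by simp
  moreover have "?p (h (r k)) i0 < 2 * inverse (real (Suc (r k)))"
    using h[OF i0, of "r k"] by (auto simp: abs_less_iff)
  moreover have "?p (h (r k)) i0 = a" by (rule a) (simp add: k_def)
  ultimately show False using m by linarith
qed

text \<open>The coordinate values form a discrete subgroup of the reals, hence a cyclic one;
  \<open>c\<close> is the inverse of its least positive element, or 1 if the subgroup is
  trivial.\<close>

lemma discrete_real_subgroup_functional:
  fixes H :: "('i \<Rightarrow> real) set"
  assumes H: "additive_subgroup H" and e0: "e0 > 0"
    and disc: "\<And>h. h \<in> H \<Longrightarrow> \<bar>h j\<bar> < e0 \<Longrightarrow> h j = 0"
  shows "\<exists>c. c \<noteq> 0 \<and> (\<forall>h\<in>H. c * h j \<in> \<int>)"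
proof (cases "\<forall>h\<in>H. h j = 0")
  case True
  then show ?thesis by (intro exI[of _ 1]) auto
next
  case False
  then obtain v where v: "v \<in> H" "v j \<noteq> 0" by blast
  define P where "P = {h j | h. h \<in> H \<and> h j > 0}"
  have "\<bar>v j\<bar> \<in> P"
    using v additive_subgroup_minus[OF H v(1)] unfolding P_def
    by (cases "v j > 0") (auto intro: exI[of _ v] exI[of _ "- v"])
  then have "P \<noteq> {}" by blast
  moreover have "Inf P < Inf P + e0" using e0 by simp
  ultimately obtain x where "x \<in> P" and x: "x < Inf P + e0"
    using cInf_lessD by meson
  then obtain h where h: "h \<in> H" "h j > 0" "x = h j" by (auto simp: P_def)
  have bdd: "bdd_below P" by (intro bdd_belowI[of _ 0]) (auto simp: P_def)
  \<comment> \<open>A value below \<open>h j\<close> would lie with it in an interval of length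
    \<open>e0\<close> starting at \<open>Inf P\<close>, and discreteness would make the two equal.
    So the infimum is attained.\<close>
  have min: "h j \<le> w j" if "w \<in> H" "w j > 0" for w
  proof (rule ccontr)
    assume "\<not> h j \<le> w j"
    moreover have "Inf P \<le> w j" using that bdd by (intro cInf_lower) (auto simp: P_def)
    ultimately have "\<bar>(h - w) j\<bar> < e0" "(h - w) j \<noteq> 0" using x h by auto
    then show False using disc additive_subgroup_diff[OF H h(1) that(1)] by blast
  qed
  have "inverse (h j) * g j \<in> \<int>" if "g \<in> H" for g
  proof -
    define w where "w = g - of_int \<lfloor>g j / h j\<rfloor> *\<^sub>R h"
    have "w \<in> H" unfolding w_def by (intro additive_subgroup_diff additive_subgroup_of_int_scaleR H h that)
    have "w j = frac (g j / h j) * h j"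
      using h(2) by (simp add: w_def frac_def left_diff_distrib)
    then have "w j < h j" "w j \<ge> 0"
      using h(2) frac_lt_1[of "g j / h j"] by auto
    then have "w j = 0" using min[OF \<open>w \<in> H\<close>] by force
    then have "g j / h j = of_int \<lfloor>g j / h j\<rfloor>" using h(2) by (simp add: w_def field_simps)
    then show ?thesis by (metis Ints_of_int divide_inverse mult.commute)
  qed
  then show ?thesis using h(2) by (intro exI[of _ "inverse (h j)"]) auto
qed

text \<open>The induction passes to the quotient by a line: a direction in the closure of
  \<open>H\<close> if \<open>H\<close> has arbitrarily short elements, a nonzero element of
  \<open>H\<close> if it is discrete. Non-density survives in both cases. What remains is a discrete
  \<open>H\<close> that vanishes on \<open>I\<close> or has a single coordinate.\<close>

theorem kronecker_duality:
  fixes H :: "('i \<Rightarrow> real) set"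
  assumes "finite I" "additive_subgroup H" "\<not> dense_on_coords I H"
  shows "\<exists>c. (\<exists>i\<in>I. c i \<noteq> 0) \<and> (\<forall>h\<in>H. (\<Sum>i\<in>I. c i * h i) \<in> \<int>)"
  using assms
proof (induction I arbitrary: H rule: finite_psubset_induct)
  case (psubset I)
  note I = \<open>finite I\<close> and H = \<open>additive_subgroup H\<close> and nd = \<open>\<not> dense_on_coords I H\<close>
  have reduce: ?case if "j \<in> I" "\<not> dense_on_coords (I - {j}) (project_along j u ` H)" for j u
  proof -
    have "I - {j} \<subset> I" using that by blast
    from psubset.IH[OF this additive_subgroup_project_along[OF H] that(2)]
    obtain c where "\<exists>i\<in>I - {j}. c i \<noteq> 0"
      "\<And>h. h \<in> H \<Longrightarrow> (\<Sum>i\<in>I - {j}. c i * project_along j u h i) \<in> \<int>"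
      by auto
    then show ?case by (rule functional_from_projection[OF I that(1)])
  qed
  show ?case
  proof (cases "\<forall>e>0. \<exists>h\<in>H. (\<exists>i\<in>I. h i \<noteq> 0) \<and> (\<forall>i\<in>I. \<bar>h i\<bar> < e)")
    case True
    then obtain u j where u: "j \<in> I" "u j \<noteq> 0"
      and line: "\<And>t e. e > 0 \<Longrightarrow> \<exists>h\<in>H. \<forall>i\<in>I. \<bar>h i - t * u i\<bar> < e"
      using closure_contains_line[OF I H] by metis
    show ?thesis
      using reduce[OF u(1)] not_dense_projection_line[where u=u, OF I H nd u(2) line] by blast
  next
    case False
    then obtain e0 where e0: "e0 > 0"
      and disc: "\<And>h. h \<in> H \<Longrightarrow> (\<And>i. i \<in> I \<Longrightarrow> \<bar>h i\<bar> < e0) \<Longrightarrow> \<forall>i\<in>I. h i = 0"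
      by metis
    have "I \<noteq> {}"
      using nd additive_subgroup_zero[OF H] by (auto simp: dense_on_coords_def)
    show ?thesis
    proof (cases "\<exists>v\<in>H. \<exists>j\<in>I. v j \<noteq> 0")
      case False
      then have "\<forall>h\<in>H. (\<Sum>i\<in>I. 1 * h i) = 0" by (auto intro: sum.neutral)
      then show ?thesis using \<open>I \<noteq> {}\<close> by (intro exI[of _ "\<lambda>_. 1"]) auto
    next
      case True
      then obtain v j where v: "v \<in> H" "j \<in> I" "v j \<noteq> 0" by blast
      show ?thesis
      proof (cases "I - {j} = {}")
        case True
        then have [simp]: "I = {j}" using v(2) by blast
        obtain c where "c \<noteq> 0" "\<forall>h\<in>H. c * h j \<in> \<int>"
          using discrete_real_subgroup_functional[OF H e0, of j] disc by auto
        then show ?thesis by (intro exI[of _ "\<lambda>_. c"]) auto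
      next
        case False
        show ?thesis
          using reduce[OF v(2)] not_dense_projection_discrete[OF I H e0 disc v False] by blast
      qed
    qed
  qed
qed


section \<open>The Euclidean topology in terms of the 1-norm\<close>

definition vecs :: "nat \<Rightarrow> (nat \<Rightarrow> real) set" where
  "vecs n = {x. \<forall>i\<ge>n. x i = 0}"

text \<open>The 1-norm is additive over coordinates, which matches estimates obtained by changing
  one coordinate at a time. It is a norm on \<open>vecs n\<close> and ignores all coordinates from
  \<open>n\<close> on.\<close>

definition l1 :: "nat \<Rightarrow> (nat \<Rightarrow> real) \<Rightarrow> real" where
  "l1 n x = (\<Sum>i<n. \<bar>x i\<bar>)"

lemma topspace_Euclidean [simp]: "topspace (Euclidean_space n) = vecs n"
  by (simp add: topspace_Euclidean_space vecs_def)

lemma vecs_0 [simp]: "0 \<in> vecs n"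
  and vecs_add [simp]: "x \<in> vecs n \<Longrightarrow> y \<in> vecs n \<Longrightarrow> x + y \<in> vecs n"
  and vecs_diff [simp]: "x \<in> vecs n \<Longrightarrow> y \<in> vecs n \<Longrightarrow> x - y \<in> vecs n"
  and vecs_minus [simp]: "x \<in> vecs n \<Longrightarrow> - x \<in> vecs n"
  and vecs_scaleR [simp]: "x \<in> vecs n \<Longrightarrow> c *\<^sub>R x \<in> vecs n"
  by (auto simp: vecs_def)

lemma vecs_upd [simp]: "x \<in> vecs n \<Longrightarrow> i < n \<Longrightarrow> x(i := t) \<in> vecs n"
  by (auto simp: vecs_def)

lemma subspace_vecs: "subspace (vecs n)"
  by (simp add: subspace_def)

lemma l1_nonneg [simp]: "l1 n x \<ge> 0"
  by (simp add: l1_def sum_nonneg)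

lemma l1_0 [simp]: "l1 n 0 = 0"
  by (simp add: l1_def)

lemma l1_triangle: "l1 n (x + y) \<le> l1 n x + l1 n y"
  by (simp add: l1_def flip: sum.distrib) (intro sum_mono abs_triangle_ineq)

lemma l1_minus_commute: "l1 n (x - y) = l1 n (y - x)"
  by (simp add: l1_def abs_minus_commute)

lemma l1_triangle_diff: "l1 n (x - z) \<le> l1 n (x - y) + l1 n (y - z)"
  using l1_triangle[of n "x - y" "y - z"] by simp

lemma l1_scaleR [simp]: "l1 n (c *\<^sub>R x) = \<bar>c\<bar> * l1 n x"
  by (simp add: l1_def abs_mult sum_distrib_left)

lemma abs_le_l1: "i < n \<Longrightarrow> \<bar>x i\<bar> \<le> l1 n x"
  unfolding l1_def by (rule member_le_sum) auto

lemma l1_eq_0: "x \<in> vecs n \<Longrightarrow> l1 n x = 0 \<longleftrightarrow> x = 0"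
  by (auto simp: l1_def sum_nonneg_eq_0_iff vecs_def fun_eq_iff) (metis lessThan_iff not_less)

lemma continuous_map_Euclidean_coord:
  "continuous_map (Euclidean_space n) euclideanreal (\<lambda>x. x i)"
  unfolding Euclidean_space_def
  by (intro continuous_map_from_subtopology continuous_map_product_projection) auto

lemma continuous_map_into_Euclidean:
  assumes "\<And>x. x \<in> topspace X \<Longrightarrow> f x \<in> vecs n"
    and "\<And>i. i < n \<Longrightarrow> continuous_map X euclideanreal (\<lambda>x. f x i)"
  shows "continuous_map X (Euclidean_space n) f"
proof -
  have "continuous_map X (Euclidean_space n) (\<lambda>x i. if i < n then f x i else 0)"
    using assms(2) by (simp add: continuous_map_componentwise_Euclidean_space)
  then show ?thesis
    by (rule continuous_map_eq) (use assms(1) in \<open>auto simp: vecs_def fun_eq_iff\<close>)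
qed

definition l1_ball :: "nat \<Rightarrow> (nat \<Rightarrow> real) \<Rightarrow> real \<Rightarrow> (nat \<Rightarrow> real) set" where
  "l1_ball n x e = {y \<in> vecs n. l1 n (y - x) < e}"

lemma openin_l1_ball: "openin (Euclidean_space n) (l1_ball n x e)"
proof -
  have "continuous_map (Euclidean_space n) euclideanreal (\<lambda>y. l1 n (y - x))"
    unfolding l1_def fun_diff_def
    by (intro continuous_intros continuous_map_Euclidean_coord) auto
  from openin_continuous_map_preimage[OF this, of "{..<e}"]
  show ?thesis by (simp add: l1_ball_def)
qed

text \<open>The minimum of finitely many radii. The measure \<open>D\<close> is abstract so that the
  lemma serves distances to a point and, with the identity, plain positive numbers.\<close>

lemma uniform_radius:
  fixes D :: "'b \<Rightarrow> real"
  assumes "finite A" "\<And>a. a \<in> A \<Longrightarrow> \<exists>d>0. \<forall>z. D z < d \<longrightarrow> R a z"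
  shows "\<exists>d>0. \<forall>a\<in>A. \<forall>z. D z < d \<longrightarrow> R a z"
  using assms
proof (induction A rule: finite_induct)
  case empty
  then show ?case by (intro exI[of _ 1]) auto
next
  case (insert a A)
  then obtain d e where "d > 0" "\<forall>a\<in>A. \<forall>z. D z < d \<longrightarrow> R a z" "e > 0" "\<forall>z. D z < e \<longrightarrow> R a z"
    by (metis insertCI)
  then show ?case by (intro exI[of _ "min d e"]) auto
qed

text \<open>Points of \<open>vecs n\<close> agree from coordinate \<open>n\<close> on, so only the
  first \<open>n\<close> factors of a basic open set of the product topology matter, and finitely
  many intervals contain a common 1-norm ball.\<close>

lemma openin_Euclidean_iff:
  "openin (Euclidean_space n) S \<longleftrightarrow> S \<subseteq> vecs n \<and> (\<forall>x\<in>S. \<exists>e>0. l1_ball n x e \<subseteq> S)"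
proof safe
  fix x assume "openin (Euclidean_space n) S" "x \<in> S"
  then show "x \<in> vecs n" using openin_subset by fastforce
next
  fix x assume S: "openin (Euclidean_space n) S" and x: "x \<in> S"
  then obtain T where T: "openin (powertop_real UNIV) T" and ST: "S = T \<inter> vecs n"
    by (auto simp: Euclidean_space_def openin_subtopology vecs_def)
  then obtain U where U: "\<And>i. open (U i)" "x \<in> Pi\<^sub>E UNIV U" "Pi\<^sub>E UNIV U \<subseteq> T"
    using x unfolding openin_product_topology_alt by auto blast
  have "\<exists>e>0. \<forall>i\<in>{..<n}. \<forall>y. l1 n (y - x) < e \<longrightarrow> y i \<in> U i"
  proof (rule uniform_radius)
    fix i assume i: "i \<in> {..<n}"
    obtain e where "e > 0" "\<And>t. dist t (x i) < e \<Longrightarrow> t \<in> U i"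
      using U(1)[of i] U(2) unfolding open_dist by (metis PiE_mem UNIV_I)
    then show "\<exists>e>0. \<forall>y. l1 n (y - x) < e \<longrightarrow> y i \<in> U i"
    proof (intro exI[of _ e] conjI allI impI)
      fix y assume "l1 n (y - x) < e"
      then have "dist (y i) (x i) < e" using abs_le_l1[of i n "y - x"] i by (simp add: dist_real_def)
      then show "y i \<in> U i" by (rule \<open>\<And>t. dist t (x i) < e \<Longrightarrow> t \<in> U i\<close>)
    qed (use \<open>e > 0\<close> in auto)
  qed auto
  then obtain e where e: "e > 0" "\<And>i y. i < n \<Longrightarrow> l1 n (y - x) < e \<Longrightarrow> y i \<in> U i" by auto
  have "l1_ball n x e \<subseteq> S"
  proof
    fix y assume y: "y \<in> l1_ball n x e"
    have "y i \<in> U i" for i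
    proof (cases "i < n")
      case True
      then show ?thesis using e y by (auto simp: l1_ball_def)
    next
      case False
      then have "y i = x i" using y x ST by (auto simp: l1_ball_def vecs_def)
      then show ?thesis using U(2) by auto
    qed
    then show "y \<in> S" using U(3) ST y by (auto simp: l1_ball_def)
  qed
  then show "\<exists>e>0. l1_ball n x e \<subseteq> S" using e by blast
next
  assume S: "S \<subseteq> vecs n" and balls: "\<forall>x\<in>S. \<exists>e>0. l1_ball n x e \<subseteq> S"
  show "openin (Euclidean_space n) S"
  proof (subst openin_subopen, intro ballI)
    fix x assume "x \<in> S"
    then obtain e where "e > 0" "l1_ball n x e \<subseteq> S" using balls by blast
    moreover have "x \<in> l1_ball n x e" using \<open>x \<in> S\<close> S \<open>e > 0\<close> by (auto simp: l1_ball_def)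
    ultimately show "\<exists>T. openin (Euclidean_space n) T \<and> x \<in> T \<and> T \<subseteq> S"
      using openin_l1_ball by blast
  qed
qed

lemma openin_translate_Euclidean:
  assumes p: "p \<in> vecs n" and S: "openin (Euclidean_space n) S"
  shows "openin (Euclidean_space n) ((+) p ` S)"
  unfolding openin_Euclidean_iff
proof (intro conjI ballI)
  show "(+) p ` S \<subseteq> vecs n" using S p by (auto simp: openin_Euclidean_iff)
  fix z assume "z \<in> (+) p ` S"
  then obtain x where x: "x \<in> S" "z = p + x" by blast
  then obtain e where e: "e > 0" "l1_ball n x e \<subseteq> S" using S openin_Euclidean_iff by blast
  have "y \<in> (+) p ` S" if "y \<in> l1_ball n z e" for y
  proof
    show "y = p + (y - p)" by simp
    show "y - p \<in> S" using that e(2) x p by (auto simp: l1_ball_def diff_diff_eq)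
  qed
  then show "\<exists>e>0. l1_ball n z e \<subseteq> (+) p ` S" using e(1) by blast
qed

lemma continuous_map_Euclidean_nbhd:
  assumes "continuous_map (subtopology (Euclidean_space n) U) Y f"
    and "x \<in> U" "x \<in> vecs n" "openin Y W" "f x \<in> W"
  shows "\<exists>e>0. \<forall>y\<in>U. y \<in> vecs n \<and> l1 n (y - x) < e \<longrightarrow> f y \<in> W"
proof -
  have "openin (subtopology (Euclidean_space n) U) {y \<in> vecs n \<inter> U. f y \<in> W}"
    using openin_continuous_map_preimage[OF assms(1,4)] by simp
  then obtain T where T: "openin (Euclidean_space n) T" "{y \<in> vecs n \<inter> U. f y \<in> W} = T \<inter> U"
    by (auto simp: openin_subtopology)
  have "x \<in> T" using T(2) assms by auto
  then obtain e where "e > 0" "l1_ball n x e \<subseteq> T" using T(1) by (auto simp: openin_Euclidean_iff)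
  then show ?thesis using T(2) by (intro exI[of _ e]) (auto simp: l1_ball_def)
qed

lemma continuous_map_real_from_Euclidean:
  assumes U: "U \<subseteq> vecs n"
    and f: "\<And>x e. x \<in> U \<Longrightarrow> e > 0 \<Longrightarrow> \<exists>d>0. \<forall>y\<in>U. l1 n (y - x) < d \<longrightarrow> \<bar>f y - f x\<bar> < e"
  shows "continuous_map (subtopology (Euclidean_space n) U) euclideanreal f"
  unfolding continuous_map_def
proof (intro conjI allI impI)
  fix W :: "real set" assume W: "openin euclideanreal W"
  show "openin (subtopology (Euclidean_space n) U)
      {x \<in> topspace (subtopology (Euclidean_space n) U). f x \<in> W}"
  proof (subst openin_subopen, intro ballI)
    fix x assume "x \<in> {x \<in> topspace (subtopology (Euclidean_space n) U). f x \<in> W}"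
    then have x: "x \<in> U" "f x \<in> W" by auto
    obtain e where "e > 0" and e: "\<And>t. \<bar>t - f x\<bar> < e \<Longrightarrow> t \<in> W"
      using W x(2) by (auto simp: open_dist dist_real_def)
    obtain d where d: "d > 0" "\<And>y. y \<in> U \<Longrightarrow> l1 n (y - x) < d \<Longrightarrow> \<bar>f y - f x\<bar> < e"
      using f[OF x(1) \<open>e > 0\<close>] by blast
    show "\<exists>T. openin (subtopology (Euclidean_space n) U) T \<and> x \<in> T \<and>
        T \<subseteq> {x \<in> topspace (subtopology (Euclidean_space n) U). f x \<in> W}"
      using x U d e by (intro exI[of _ "l1_ball n x d \<inter> U"])
        (auto simp: l1_ball_def intro!: openin_subtopology_Int openin_l1_ball[unfolded l1_ball_def])
  qed
qed auto

lemma continuous_map_Euclidean_Lipschitz: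
  assumes "U \<subseteq> vecs n" "\<And>x. x \<in> U \<Longrightarrow> f x \<in> vecs m"
    and lip: "\<And>x y. x \<in> U \<Longrightarrow> y \<in> U \<Longrightarrow> l1 m (f y - f x) \<le> K * l1 n (y - x)"
  shows "continuous_map (subtopology (Euclidean_space n) U) (Euclidean_space m) f"
proof (rule continuous_map_into_Euclidean)
  fix i assume i: "i < m"
  show "continuous_map (subtopology (Euclidean_space n) U) euclideanreal (\<lambda>x. f x i)"
  proof (rule continuous_map_real_from_Euclidean[OF assms(1)])
    fix x and e :: real assume x: "x \<in> U" and e: "e > 0"
    have "\<bar>f y i - f x i\<bar> < e" if "y \<in> U" "l1 n (y - x) < e / (\<bar>K\<bar> + 1)" for y
    proof -
      have "\<bar>f y i - f x i\<bar> \<le> l1 m (f y - f x)" using abs_le_l1[OF i, of "f y - f x"] by simp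
      also have "\<dots> \<le> K * l1 n (y - x)" by (intro lip x that)
      also have "\<dots> \<le> (\<bar>K\<bar> + 1) * l1 n (y - x)" by (intro mult_right_mono) auto
      also have "\<dots> < e" using that(2) by (simp add: field_simps)
      finally show ?thesis .
    qed
    moreover have "e / (\<bar>K\<bar> + 1) > 0" using e by (intro divide_pos_pos) auto
    ultimately show "\<exists>d>0. \<forall>y\<in>U. l1 n (y - x) < d \<longrightarrow> \<bar>f y i - f x i\<bar> < e" by blast
  qed
qed (use assms in auto)


section \<open>Mixed second differences of a twice differentiable function\<close>

text \<open>Unlike a ball of \<open>l1\<close>, a box contains every point whose coordinates are
  taken partly from one and partly from another of its points.\<close>

definition coord_box :: "nat \<Rightarrow> (nat \<Rightarrow> real) \<Rightarrow> real \<Rightarrow> (nat \<Rightarrow> real) set" where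
  "coord_box N P d = {z \<in> vecs N. \<forall>i<N. \<bar>z i - P i\<bar> < d}"

lemma coord_box_subset_l1_ball: "e > 0 \<Longrightarrow> \<exists>d>0. coord_box n p d \<subseteq> l1_ball n p e"
proof -
  assume e: "e > 0"
  have "l1 n (x - p) < e" if "x \<in> coord_box n p (e / (real n + 1))" for x
  proof -
    have "l1 n (x - p) \<le> of_nat (card {..<n}) * (e / (real n + 1))"
      unfolding l1_def using that by (intro sum_bounded_above) (auto simp: coord_box_def less_imp_le)
    also have "\<dots> < e" using e by (simp add: field_simps)
    finally show ?thesis .
  qed
  then show ?thesis using e
    by (intro exI[of _ "e / (real n + 1)"]) (auto simp: l1_ball_def coord_box_def)
qed

lemma partial_deriv_DERIV:
  assumes "(\<lambda>t. g (z(i := t))) field_differentiable at (z i)"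
  shows "((\<lambda>t. g (z(i := t))) has_real_derivative partial_deriv i g z) (at (z i))"
  using assms unfolding partial_deriv_def by (simp add: DERIV_deriv_iff_field_differentiable)

text \<open>The mean value inequality is applied twice: along \<open>j\<close> to
  \<open>partial_deriv i g\<close>, and then along \<open>i\<close> to the difference
  \<open>F\<close> of \<open>g\<close> on two parallel segments, whose derivative the first
  application bounds.\<close>

lemma mixed_difference_two_coords:
  fixes g :: "(nat \<Rightarrow> real) \<Rightarrow> real"
  assumes ij: "i < N" "j < N" "i \<noteq> j"
    and d1: "\<And>x. x \<in> coord_box N P \<delta> \<Longrightarrow> (\<lambda>t. g (x(i := t))) field_differentiable at (x i)"
    and d2: "\<And>x. x \<in> coord_box N P \<delta> \<Longrightarrow> (\<lambda>t. partial_deriv i g (x(j := t))) field_differentiable at (x j)"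
    and M: "\<And>x. x \<in> coord_box N P \<delta> \<Longrightarrow> \<bar>partial_deriv j (partial_deriv i g) x\<bar> \<le> M"
    and z: "z \<in> coord_box N P \<delta>" and z': "z' \<in> coord_box N P \<delta>"
  shows "\<bar>g z - g (z(i := z' i)) - g (z(j := z' j)) + g (z(i := z' i, j := z' j))\<bar>
      \<le> M * \<bar>z i - z' i\<bar> * \<bar>z j - z' j\<bar>"
proof -
  let ?I = "\<lambda>k. {P k - \<delta><..<P k + \<delta>}"
  let ?p = "partial_deriv i g"
  have upd: "x(k := t) \<in> coord_box N P \<delta>" if "x \<in> coord_box N P \<delta>" "k < N" "t \<in> ?I k" for x k t
    using that by (auto simp: coord_box_def)
  have I: "z i \<in> ?I i" "z' i \<in> ?I i" "z j \<in> ?I j" "z' j \<in> ?I j"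
    using z z' ij by (auto simp: coord_box_def abs_less_iff)
  have b1: "\<bar>?p (x(j := s)) - ?p (x(j := t))\<bar> \<le> M * \<bar>s - t\<bar>"
    if x: "x \<in> coord_box N P \<delta>" and st: "s \<in> ?I j" "t \<in> ?I j" for x s t
  proof -
    have der: "((\<lambda>t. ?p (x(j := t))) has_real_derivative partial_deriv j ?p (x(j := r))) (at r within ?I j)"
      if "r \<in> ?I j" for r
      using partial_deriv_DERIV[OF d2[OF upd[OF x ij(2) that]]]
      by (simp only: fun_upd_upd fun_upd_same has_field_derivative_at_within)
    have "norm (?p (x(j := s)) - ?p (x(j := t))) \<le> M * norm (s - t)"
      by (rule field_differentiable_bound[OF _ der _ st])
        (use M[OF upd[OF x ij(2)]] in simp_all)
    then show ?thesis by simp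
  qed
  define F where "F r = g (z(i := r)) - g (z(j := z' j, i := r))" for r
  have zj: "z(j := z' j) \<in> coord_box N P \<delta>" using upd[OF z ij(2) I(4)] .
  have "(F has_real_derivative ?p (z(i := r)) - ?p (z(j := z' j, i := r))) (at r within ?I i)"
    if "r \<in> ?I i" for r
  proof -
    have "((\<lambda>t. g (z(i := t))) has_real_derivative ?p (z(i := r))) (at r within ?I i)"
      using partial_deriv_DERIV[OF d1[OF upd[OF z ij(1) that]]]
      by (simp only: fun_upd_upd fun_upd_same has_field_derivative_at_within)
    moreover have "((\<lambda>t. g (z(j := z' j, i := t))) has_real_derivative ?p (z(j := z' j, i := r))) (at r within ?I i)"
      using partial_deriv_DERIV[OF d1[OF upd[OF zj ij(1) that]]]
      by (simp only: fun_upd_upd fun_upd_same has_field_derivative_at_within)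
    ultimately show ?thesis unfolding F_def by (intro derivative_intros)
  qed
  moreover have "\<bar>?p (z(i := r)) - ?p (z(j := z' j, i := r))\<bar> \<le> M * \<bar>z j - z' j\<bar>" if "r \<in> ?I i" for r
  proof -
    have "z(i := r) = (z(i := r))(j := z j)" "z(j := z' j, i := r) = (z(i := r))(j := z' j)"
      using ij by auto
    then show ?thesis using b1[OF upd[OF z ij(1) that] I(3,4)] by metis
  qed
  ultimately have "norm (F (z i) - F (z' i)) \<le> M * \<bar>z j - z' j\<bar> * norm (z i - z' i)"
    using I by (intro field_differentiable_bound[where S = "?I i"
        and f' = "\<lambda>r. ?p (z(i := r)) - ?p (z(j := z' j, i := r))"]) auto
  moreover have "z(j := z' j, i := z' i) = z(i := z' i, j := z' j)" "z(j := z' j, i := z i) = z(j := z' j)"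
    using ij by auto
  ultimately show ?thesis by (simp add: F_def algebra_simps)
qed

text \<open>Replacing the coordinates in \<open>J\<close> one at a time telescopes the mixed
  difference into mixed differences in \<open>i\<close> and a single \<open>j\<close>, taken at
  hybrid points of the box.\<close>

lemma mixed_difference_hybrid_single:
  fixes g :: "(nat \<Rightarrow> real) \<Rightarrow> real"
  assumes two: "\<And>i j z. i < N \<Longrightarrow> j < N \<Longrightarrow> i \<noteq> j \<Longrightarrow> z \<in> coord_box N P \<delta> \<Longrightarrow>
      \<bar>g z - g (z(i := z' i)) - g (z(j := z' j)) + g (z(i := z' i, j := z' j))\<bar>
      \<le> M * \<bar>z i - z' i\<bar> * \<bar>z j - z' j\<bar>"
    and z: "z \<in> coord_box N P \<delta>" and z': "z' \<in> coord_box N P \<delta>"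
    and J: "finite J" "J \<subseteq> {..<N}" "i \<notin> J" "i < N"
  shows "\<bar>g z - g (z(i := z' i)) - g (override_on z z' J) + g (override_on z z' (insert i J))\<bar>
      \<le> M * \<bar>z i - z' i\<bar> * (\<Sum>j\<in>J. \<bar>z j - z' j\<bar>)"
  using J
proof (induction J rule: finite_induct)
  case empty
  then show ?case by (simp add: override_on_insert)
next
  case (insert j J)
  let ?w = "override_on z z' J"
  have w: "?w \<in> coord_box N P \<delta>" using z z' by (auto simp: coord_box_def override_on_def vecs_def)
  have wij: "?w i = z i" "?w j = z j" using insert by (auto simp: override_on_def)
  have eqs: "?w(i := z' i) = override_on z z' (insert i J)"
    "?w(j := z' j) = override_on z z' (insert j J)"
    "(override_on z z' (insert i J))(j := z' j) = override_on z z' (insert i (insert j J))"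
    using insert.prems by (auto simp: override_on_def fun_eq_iff)
  have "\<bar>g ?w - g (override_on z z' (insert i J)) - g (override_on z z' (insert j J))
      + g (override_on z z' (insert i (insert j J)))\<bar> \<le> M * \<bar>z i - z' i\<bar> * \<bar>z j - z' j\<bar>"
    using two[OF _ _ _ w, of i j] insert.prems unfolding eqs wij by simp
  moreover have "\<bar>g z - g (z(i := z' i)) - g (override_on z z' J) + g (override_on z z' (insert i J))\<bar>
      \<le> M * \<bar>z i - z' i\<bar> * (\<Sum>j\<in>J. \<bar>z j - z' j\<bar>)"
    by (rule insert.IH) (use insert.prems in auto)
  ultimately show ?case
    unfolding sum.insert[OF insert.hyps(1,2)] distrib_left by linarith
qed

text \<open>The same telescoping, now in the coordinates of \<open>I\<close>; the sum of the bounds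
  factors into the product of two block distances.\<close>

lemma mixed_difference_hybrid:
  fixes g :: "(nat \<Rightarrow> real) \<Rightarrow> real"
  assumes two: "\<And>i j z. i < N \<Longrightarrow> j < N \<Longrightarrow> i \<noteq> j \<Longrightarrow> z \<in> coord_box N P \<delta> \<Longrightarrow>
      \<bar>g z - g (z(i := z' i)) - g (z(j := z' j)) + g (z(i := z' i, j := z' j))\<bar>
      \<le> M * \<bar>z i - z' i\<bar> * \<bar>z j - z' j\<bar>"
    and z: "z \<in> coord_box N P \<delta>" and z': "z' \<in> coord_box N P \<delta>"
    and J: "finite J" "J \<subseteq> {..<N}"
    and I: "finite I" "I \<subseteq> {..<N}" "I \<inter> J = {}"
  shows "\<bar>g z - g (override_on z z' I) - g (override_on z z' J) + g (override_on z z' (I \<union> J))\<bar>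
      \<le> M * (\<Sum>i\<in>I. \<bar>z i - z' i\<bar>) * (\<Sum>j\<in>J. \<bar>z j - z' j\<bar>)"
  using I
proof (induction I rule: finite_induct)
  case empty
  then show ?case by simp
next
  case (insert i I)
  let ?w = "override_on z z' I"
  have w: "?w \<in> coord_box N P \<delta>" using z z' by (auto simp: coord_box_def override_on_def vecs_def)
  have wi: "?w i = z i" using insert by (auto simp: override_on_def)
  have wJ: "(\<Sum>j\<in>J. \<bar>?w j - z' j\<bar>) = (\<Sum>j\<in>J. \<bar>z j - z' j\<bar>)"
    using insert.prems by (intro sum.cong) (auto simp: override_on_def)
  have eqs: "?w(i := z' i) = override_on z z' (insert i I)"
    "override_on ?w z' J = override_on z z' (I \<union> J)"
    "override_on ?w z' (insert i J) = override_on z z' (insert i I \<union> J)"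
    using insert.prems by (auto simp: override_on_def fun_eq_iff)
  have "\<bar>g ?w - g (override_on z z' (insert i I)) - g (override_on z z' (I \<union> J))
      + g (override_on z z' (insert i I \<union> J))\<bar> \<le> M * \<bar>z i - z' i\<bar> * (\<Sum>j\<in>J. \<bar>z j - z' j\<bar>)"
  proof -
    have "i \<notin> J" "i < N" using insert.prems by auto
    from mixed_difference_hybrid_single[OF two w z' J this] show ?thesis
      unfolding eqs wi wJ .
  qed
  moreover have "\<bar>g z - g (override_on z z' I) - g (override_on z z' J) + g (override_on z z' (I \<union> J))\<bar>
      \<le> M * (\<Sum>i\<in>I. \<bar>z i - z' i\<bar>) * (\<Sum>j\<in>J. \<bar>z j - z' j\<bar>)"
    by (rule insert.IH) (use insert.prems in auto)
  ultimately show ?case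
    using insert.hyps by (simp add: distrib_left distrib_right)
qed

lemma coord_append_vecs: "x \<in> vecs n \<Longrightarrow> y \<in> vecs m \<Longrightarrow> coord_append n x y \<in> vecs (n + m)"
  by (auto simp: coord_append_def vecs_def)

lemma coord_append_coord_box:
  "x \<in> coord_box n p d \<Longrightarrow> y \<in> coord_box m q d \<Longrightarrow> coord_append n x y \<in> coord_box (n + m) (coord_append n p q) d"
  by (auto simp: coord_append_vecs coord_box_def) (auto simp: coord_append_def)

text \<open>The two arguments of a binary operation in coordinates occupy the two halves of the
  \<open>n + n\<close> coordinates, so a mixed difference between these blocks is a mixed difference
  in the two arguments.\<close>

theorem C2_mixed_difference:
  fixes g :: "(nat \<Rightarrow> real) \<Rightarrow> real"
  assumes C2: "C_on 2 (n + n) W g" and p: "p \<in> vecs n"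
    and W: "coord_box (n + n) (coord_append n p p) \<delta> \<subseteq> W" and \<delta>: "\<delta> > 0"
  shows "\<exists>d>0. \<exists>M. \<forall>x\<in>coord_box n p d. \<forall>x'\<in>coord_box n p d. \<forall>y\<in>coord_box n p d. \<forall>y'\<in>coord_box n p d.
    \<bar>g (coord_append n x y) - g (coord_append n x' y) - g (coord_append n x y') + g (coord_append n x' y')\<bar>
      \<le> M * l1 n (x - x') * l1 n (y - y')"
proof -
  define N where "N = n + n"
  define P where "P = coord_append n p p"
  have P: "P \<in> vecs N" unfolding P_def N_def by (intro coord_append_vecs p)
  have PW: "P \<in> W" using W P \<delta> by (auto simp: P_def N_def coord_box_def)
  let ?pp = "\<lambda>i j. partial_deriv j (partial_deriv i g)"
  have "C_on (Suc (Suc 0)) N W g" using C2 by (simp add: N_def numeral_2_eq_2)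
  then have d1: "\<And>i x. i < N \<Longrightarrow> x \<in> W \<Longrightarrow> (\<lambda>t. g (x(i := t))) field_differentiable at (x i)"
    and d2: "\<And>i j x. i < N \<Longrightarrow> j < N \<Longrightarrow> x \<in> W \<Longrightarrow> (\<lambda>t. partial_deriv i g (x(j := t))) field_differentiable at (x j)"
    and cont: "\<And>i j. i < N \<Longrightarrow> j < N \<Longrightarrow> continuous_map (subtopology (Euclidean_space N) W) euclideanreal (?pp i j)"
    by auto
  \<comment> \<open>A crude common bound: the sum dominates each of its nonnegative terms, and the
    added 1 absorbs the variation of a second partial derivative near \<open>P\<close>.\<close>
  define M where "M = (\<Sum>(i,j)\<in>{..<N}\<times>{..<N}. \<bar>?pp i j P\<bar> + 1)"
  have M: "\<bar>?pp i j P\<bar> + 1 \<le> M" if "i < N" "j < N" for i j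
    unfolding M_def using that member_le_sum[of "(i,j)" "{..<N}\<times>{..<N}" "\<lambda>(i,j). \<bar>?pp i j P\<bar> + 1"] by auto
  have "\<exists>e>0. \<forall>ij\<in>{..<N}\<times>{..<N}. \<forall>x. l1 N (x - P) < e \<longrightarrow>
      (x \<in> W \<inter> vecs N \<longrightarrow> \<bar>?pp (fst ij) (snd ij) x\<bar> \<le> M)"
  proof (rule uniform_radius)
    fix ij assume "ij \<in> {..<N} \<times> {..<N}"
    then obtain i j where ij: "ij = (i, j)" "i < N" "j < N" by auto
    obtain e where "e > 0" and e: "\<And>y. y \<in> W \<Longrightarrow> y \<in> vecs N \<Longrightarrow> l1 N (y - P) < e \<Longrightarrow> ?pp i j y \<in> ball (?pp i j P) 1"
      using continuous_map_Euclidean_nbhd[OF cont[OF ij(2,3)] PW P, of "ball (?pp i j P) 1"] by auto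
    have "\<bar>?pp i j y\<bar> \<le> M" if "y \<in> W" "y \<in> vecs N" "l1 N (y - P) < e" for y
      using e[OF that] M[OF ij(2,3)] by (auto simp: dist_real_def)
    then show "\<exists>e>0. \<forall>x. l1 N (x - P) < e \<longrightarrow> (x \<in> W \<inter> vecs N \<longrightarrow> \<bar>?pp (fst ij) (snd ij) x\<bar> \<le> M)"
      using \<open>e > 0\<close> ij by auto
  qed auto
  then obtain e where e: "e > 0" and bound: "\<And>i j x. i < N \<Longrightarrow> j < N \<Longrightarrow> l1 N (x - P) < e \<Longrightarrow>
      x \<in> W \<Longrightarrow> x \<in> vecs N \<Longrightarrow> \<bar>?pp i j x\<bar> \<le> M"
    by auto
  obtain d0 where d0: "d0 > 0" "coord_box N P d0 \<subseteq> l1_ball N P e"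
    using coord_box_subset_l1_ball[OF e] by blast
  define d where "d = min \<delta> d0"
  have d: "d > 0" using d0(1) \<delta> by (simp add: d_def)
  have boxW: "coord_box N P d \<subseteq> W" using W by (auto simp: coord_box_def d_def N_def P_def)
  have boxl1: "l1 N (x - P) < e" if "x \<in> coord_box N P d" for x
    using that d0(2) by (auto simp: coord_box_def d_def l1_ball_def)
  have "\<bar>g (coord_append n x y) - g (coord_append n x' y) - g (coord_append n x y') + g (coord_append n x' y')\<bar>
      \<le> M * l1 n (x - x') * l1 n (y - y')"
    if xs: "x \<in> coord_box n p d" "x' \<in> coord_box n p d" "y \<in> coord_box n p d" "y' \<in> coord_box n p d" for x x' y y'
  proof -
    define z z' where "z = coord_append n x y" and "z' = coord_append n x' y'"
    have zz: "z \<in> coord_box N P d" "z' \<in> coord_box N P d"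
      unfolding z_def z'_def N_def P_def by (intro coord_append_coord_box xs)+
    have two: "\<bar>g z - g (z(i := z' i)) - g (z(j := z' j)) + g (z(i := z' i, j := z' j))\<bar>
      \<le> M * \<bar>z i - z' i\<bar> * \<bar>z j - z' j\<bar>" if "i < N" "j < N" "i \<noteq> j" "z \<in> coord_box N P d" for i j z
    proof (rule mixed_difference_two_coords[OF that(1-3) _ _ _ that(4) zz(2)])
      fix x assume x: "x \<in> coord_box N P d"
      then have xW: "x \<in> W" "x \<in> vecs N" using boxW by (auto simp: coord_box_def)
      show "(\<lambda>t. g (x(i := t))) field_differentiable at (x i)" by (intro d1 that xW)
      show "(\<lambda>t. partial_deriv i g (x(j := t))) field_differentiable at (x j)" by (intro d2 that xW)
      show "\<bar>?pp i j x\<bar> \<le> M" by (intro bound that xW boxl1 x)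
    qed
    have "\<bar>g z - g (override_on z z' {..<n}) - g (override_on z z' {n..<N}) + g (override_on z z' ({..<n} \<union> {n..<N}))\<bar>
      \<le> M * (\<Sum>i\<in>{..<n}. \<bar>z i - z' i\<bar>) * (\<Sum>j\<in>{n..<N}. \<bar>z j - z' j\<bar>)"
      by (rule mixed_difference_hybrid[OF two zz]) (auto simp: N_def)
    moreover have "override_on z z' {..<n} = coord_append n x' y"
      by (auto simp: override_on_def z_def z'_def coord_append_def)
    moreover have "override_on z z' {n..<N} = coord_append n x y'"
      using xs by (auto simp: override_on_def z_def z'_def coord_append_def fun_eq_iff coord_box_def vecs_def N_def)
    moreover have "override_on z z' ({..<n} \<union> {n..<N}) = z'"
      using xs by (auto simp: override_on_def z_def z'_def coord_append_def fun_eq_iff coord_box_def vecs_def N_def)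
    moreover have "(\<Sum>i\<in>{..<n}. \<bar>z i - z' i\<bar>) = l1 n (x - x')"
      by (simp add: l1_def z_def z'_def coord_append_def)
    moreover have "(\<Sum>j\<in>{n..<N}. \<bar>z j - z' j\<bar>) = l1 n (y - y')"
    proof -
      have "(\<Sum>j\<in>{n..<N}. \<bar>z j - z' j\<bar>) = (\<Sum>j\<in>{0..<n}. \<bar>z (j + n) - z' (j + n)\<bar>)"
        using sum.shift_bounds_nat_ivl[of "\<lambda>j. \<bar>z j - z' j\<bar>" 0 n n] by (simp add: N_def)
      then show ?thesis by (simp add: l1_def z_def z'_def coord_append_def lessThan_atLeast0)
    qed
    ultimately show ?thesis by (simp add: z_def z'_def)
  qed
  then show ?thesis using d by blast
qed


section \<open>Local coordinates in which the group law is almost additive\<close>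

lemma l1_ball_subset_coord_box: "l1_ball n p d \<subseteq> coord_box n p d"
proof
  fix x assume x: "x \<in> l1_ball n p d"
  have "\<bar>x i - p i\<bar> < d" if "i < n" for i
    using abs_le_l1[OF that, of "x - p"] x by (simp add: l1_ball_def)
  then show "x \<in> coord_box n p d" using x by (simp add: l1_ball_def coord_box_def)
qed

lemma coord_append_inj:
  assumes "x \<in> vecs n" "x' \<in> vecs n" "coord_append n x y = coord_append n x' y'"
  shows "x = x' \<and> y = y'"
proof
  show "x = x'"
  proof
    fix i show "x i = x' i"
      using assms(1,2) fun_cong[OF assms(3), of i] by (cases "i < n") (auto simp: coord_append_def vecs_def)
  qed
  show "y = y'"
  proof
    fix i show "y i = y' i"
      using fun_cong[OF assms(3), of "n + i"] by (simp add: coord_append_def)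
  qed
qed

lemma coord_append_split:
  assumes "z \<in> vecs (n + m)"
  obtains x y where "x \<in> vecs n" "y \<in> vecs m" "z = coord_append n x y"
proof
  show "(\<lambda>i. if i < n then z i else 0) \<in> vecs n" by (simp add: vecs_def)
  show "(\<lambda>i. z (n + i)) \<in> vecs m" using assms by (simp add: vecs_def)
  show "z = coord_append n (\<lambda>i. if i < n then z i else 0) (\<lambda>i. z (n + i))"
    by (auto simp: coord_append_def)
qed

lemma coord_append_in_coord_box:
  assumes "coord_append n x y \<in> coord_box (n + m) (coord_append n p q) d" "x \<in> vecs n" "y \<in> vecs m"
  shows "x \<in> coord_box n p d" "y \<in> coord_box m q d"
proof -
  have *: "\<bar>coord_append n x y i - coord_append n p q i\<bar> < d" if "i < n + m" for i
    using assms that by (auto simp: coord_box_def)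
  show "x \<in> coord_box n p d" using *[of i for i] assms(2)
    by (auto simp: coord_box_def) (metis coord_append_def trans_less_add1)
  have "\<bar>y i - q i\<bar> < d" if "i < m" for i
    using *[of "n + i"] that by (simp add: coord_append_def)
  then show "y \<in> coord_box m q d" using assms(3) by (auto simp: coord_box_def)
qed

lemma (in topological_group) exists_open_square_subset:
  assumes "openin X U" "\<one> \<in> U"
  shows "\<exists>V. openin X V \<and> \<one> \<in> V \<and> V \<subseteq> U \<and> (\<forall>x\<in>V. \<forall>y\<in>V. x \<otimes> y \<in> U)"
proof -
  have "openin (prod_topology X X) {z \<in> topspace (prod_topology X X). (\<lambda>(x, y). x \<otimes> y) z \<in> U}"
    using openin_continuous_map_preimage[OF continuous_mult assms(1)] .
  moreover have "(\<one>, \<one>) \<in> {z \<in> topspace (prod_topology X X). (\<lambda>(x, y). x \<otimes> y) z \<in> U}"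
    using assms(2) by (simp add: topspace_eq)
  ultimately have "\<exists>A B. openin X A \<and> openin X B \<and> \<one> \<in> A \<and> \<one> \<in> B \<and>
      A \<times> B \<subseteq> {z \<in> topspace (prod_topology X X). (\<lambda>(x, y). x \<otimes> y) z \<in> U}"
    unfolding openin_prod_topology_alt by (elim allE impE) assumption
  then obtain A B where AB: "openin X A" "openin X B" "\<one> \<in> A" "\<one> \<in> B"
    "A \<times> B \<subseteq> {z \<in> topspace (prod_topology X X). (\<lambda>(x, y). x \<otimes> y) z \<in> U}"
    by (elim exE conjE)
  show ?thesis
  proof (intro exI[of _ "A \<inter> B \<inter> U"] conjI ballI)
    fix x y assume "x \<in> A \<inter> B \<inter> U" "y \<in> A \<inter> B \<inter> U"
    then have "(x, y) \<in> A \<times> B" by auto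
    from subsetD[OF AB(5) this] show "x \<otimes> y \<in> U" by simp
  qed (use AB assms in \<open>auto intro: openin_Int\<close>)
qed

text \<open>Here \<open>\<psi>\<close> is an inverse chart, translated so that the identity has
  coordinates 0, and \<open>\<mu>\<close> is the group law in these coordinates. Smoothness is
  condensed into \<open>mixed\<close>; the condition \<open>C * r \<le> 1 / 8\<close> keeps
  quadratic errors to a small fraction of the linear terms.\<close>

locale local_coordinates = topological_group G X for G (structure) and X +
  fixes n :: nat and \<psi> :: "(nat \<Rightarrow> real) \<Rightarrow> 'a" and \<mu> :: "(nat \<Rightarrow> real) \<Rightarrow> (nat \<Rightarrow> real) \<Rightarrow> (nat \<Rightarrow> real)"
    and \<delta> r C :: real
  assumes comm: "a \<in> carrier G \<Longrightarrow> b \<in> carrier G \<Longrightarrow> a \<otimes> b = b \<otimes> a"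
    and pos: "\<delta> > 0" "r > 0" "C \<ge> 0" "r \<le> \<delta>" "C * r \<le> 1 / 8"
    and \<psi>_cont: "continuous_map (subtopology (Euclidean_space n) (l1_ball n 0 \<delta>)) X \<psi>"
    and \<psi>_inj: "inj_on \<psi> (l1_ball n 0 \<delta>)"
    and \<psi>_open: "openin (Euclidean_space n) S \<Longrightarrow> S \<subseteq> l1_ball n 0 \<delta> \<Longrightarrow> openin X (\<psi> ` S)"
    and \<psi>_0: "\<psi> 0 = \<one>"
    and \<mu>_in: "x \<in> l1_ball n 0 r \<Longrightarrow> y \<in> l1_ball n 0 r \<Longrightarrow> \<mu> x y \<in> l1_ball n 0 \<delta>"
    and \<psi>_\<mu>: "x \<in> l1_ball n 0 r \<Longrightarrow> y \<in> l1_ball n 0 r \<Longrightarrow> \<psi> (\<mu> x y) = \<psi> x \<otimes> \<psi> y"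
    and mixed: "x \<in> l1_ball n 0 r \<Longrightarrow> x' \<in> l1_ball n 0 r \<Longrightarrow> y \<in> l1_ball n 0 r \<Longrightarrow> y' \<in> l1_ball n 0 r \<Longrightarrow>
        l1 n (\<mu> x y - \<mu> x' y - \<mu> x y' + \<mu> x' y') \<le> C * l1 n (x - x') * l1 n (y - y')"

text \<open>The homeomorphism provides some inverse \<open>g\<close>, whereas smoothness is defined
  through \<open>inv_into U \<phi>\<close>. The two agree on the image of the chart, so continuity
  and openness carry over.\<close>

lemma (in lie_group) chart_inverse:
  assumes "(U, \<phi>) \<in> atlas"
  shows "openin X U" "openin (Euclidean_space n) (\<phi> ` U)" "inj_on \<phi> U" "U \<subseteq> carrier G" "\<phi> ` U \<subseteq> vecs n"
    and "continuous_map (subtopology (Euclidean_space n) (\<phi> ` U)) (subtopology X U) (inv_into U \<phi>)"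
    and "\<And>S. openin (Euclidean_space n) S \<Longrightarrow> S \<subseteq> \<phi> ` U \<Longrightarrow> openin X (inv_into U \<phi> ` S)"
proof -
  have c: "openin X U" "openin (Euclidean_space n) (\<phi> ` U)"
    "homeomorphic_map (subtopology X U) (subtopology (Euclidean_space n) (\<phi> ` U)) \<phi>"
    using charts[OF assms] by (auto simp: is_chart_def)
  show "openin X U" "openin (Euclidean_space n) (\<phi> ` U)" by fact+
  show UG: "U \<subseteq> carrier G" using openin_subset[OF c(1)] by (simp add: topspace_eq)
  show Dv: "\<phi> ` U \<subseteq> vecs n" using openin_subset[OF c(2)] by simp
  have tU: "topspace (subtopology X U) = U" using openin_subset[OF c(1)] by auto
  have tD: "topspace (subtopology (Euclidean_space n) (\<phi> ` U)) = \<phi> ` U" using Dv by auto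
  show inj: "inj_on \<phi> U" using c(3) unfolding homeomorphic_eq_everything_map tU by blast
  obtain g where g: "homeomorphic_maps (subtopology X U) (subtopology (Euclidean_space n) (\<phi> ` U)) \<phi> g"
    using c(3) homeomorphic_map_maps by blast
  have geq: "g z = inv_into U \<phi> z" if "z \<in> \<phi> ` U" for z
    using g that inj unfolding homeomorphic_maps_def tU tD by auto
  show "continuous_map (subtopology (Euclidean_space n) (\<phi> ` U)) (subtopology X U) (inv_into U \<phi>)"
    using g geq unfolding homeomorphic_maps_def tD by (metis continuous_map_eq tD)
  fix S assume S: "openin (Euclidean_space n) S" "S \<subseteq> \<phi> ` U"
  have "openin (subtopology X U) {x \<in> topspace (subtopology X U). \<phi> x \<in> S}"
    using g S unfolding homeomorphic_maps_def
    by (intro openin_continuous_map_preimage[where Y = "subtopology (Euclidean_space n) (\<phi> ` U)"])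
      (auto simp: openin_subtopology intro!: exI[of _ S])
  moreover have "{x \<in> topspace (subtopology X U). \<phi> x \<in> S} = inv_into U \<phi> ` S"
    unfolding tU using S(2) inj by (auto simp: image_iff) (metis imageI inv_into_f_f subsetD)
  ultimately show "openin X (inv_into U \<phi> ` S)"
    using c(1) openin_trans_full by fastforce
qed

theorem (in lie_group) exists_local_coordinates:
  assumes "comm_group G"
  shows "\<exists>\<psi> \<mu> \<delta> r C. local_coordinates G X n \<psi> \<mu> \<delta> r C"
proof -
  interpret comm_group G by fact
  have "\<one> \<in> topspace X" by (simp add: topspace_eq)
  then obtain U \<phi> where U: "(U, \<phi>) \<in> atlas" "\<one> \<in> U" using cover by auto
  note ch = chart_inverse[OF U(1)]
  define g where "g = inv_into U \<phi>"
  define p where "p = \<phi> \<one>"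
  define D where "D = \<phi> ` U"
  have pD: "p \<in> D" and pv: "p \<in> vecs n" using U(2) ch(5) by (auto simp: p_def D_def)
  have gp: "g p = \<one>" using ch(3) U(2) by (simp add: g_def p_def)
  have gU: "g z \<in> U" if "z \<in> D" for z using that by (simp add: g_def D_def inv_into_into)
  have \<phi>g: "\<phi> (g z) = z" if "z \<in> D" for z using that by (simp add: g_def D_def f_inv_into_f)
  obtain V where V: "openin X V" "\<one> \<in> V" "V \<subseteq> U" and VV: "\<And>x y. x \<in> V \<Longrightarrow> y \<in> V \<Longrightarrow> x \<otimes> y \<in> U"
    using exists_open_square_subset[OF ch(1) U(2)] by blast
  have contg: "continuous_map (subtopology (Euclidean_space n) D) X g"
    using ch(6) unfolding g_def D_def by (rule continuous_map_into_fulltopology)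
  obtain e1 where e1: "e1 > 0" "\<And>y. y \<in> D \<Longrightarrow> y \<in> vecs n \<Longrightarrow> l1 n (y - p) < e1 \<Longrightarrow> g y \<in> V"
    using continuous_map_Euclidean_nbhd[OF contg pD pv V(1)] V(2) gp by auto
  obtain e2 where e2: "e2 > 0" "l1_ball n p e2 \<subseteq> D"
    using ch(2) pD unfolding openin_Euclidean_iff D_def by blast
  define \<delta> where "\<delta> = min e1 e2"
  have \<delta>: "\<delta> > 0" using e1 e2 by (simp add: \<delta>_def)
  have ballD: "z \<in> D" and ballV: "g z \<in> V" if "z \<in> l1_ball n p \<delta>" for z
    using that e1 e2 by (auto simp: l1_ball_def \<delta>_def)
  obtain d0 where d0: "d0 > 0" "coord_box n p d0 \<subseteq> l1_ball n p \<delta>"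
    using coord_box_subset_l1_ball[OF \<delta>] by blast
  \<comment> \<open>\<open>\<Phi>\<close>, \<open>W\<close> and \<open>F\<close> reproduce the
    product chart, the domain and the coordinate expression to which \<open>smooth_map\<close>
    refers for multiplication.\<close>
  define \<Phi> where "\<Phi> = (\<lambda>(x, y). coord_append n (\<phi> x) (\<phi> y))"
  define W where "W = \<Phi> ` ((U \<times> U) \<inter> (\<lambda>(x, y). x \<otimes> y) -` U)"
  define F where "F = \<phi> \<circ> (\<lambda>(x, y). x \<otimes> y) \<circ> inv_into (U \<times> U) \<Phi>"
  have \<Phi>inj: "inj_on \<Phi> (U \<times> U)"
  proof (rule inj_onI, clarify)
    fix a b a' b' assume ab: "a \<in> U" "b \<in> U" "a' \<in> U" "b' \<in> U" "\<Phi> (a, b) = \<Phi> (a', b')"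
    then have "\<phi> a = \<phi> a' \<and> \<phi> b = \<phi> b'"
      using ch(5) by (intro coord_append_inj[of _ n]) (auto simp: \<Phi>_def)
    then show "a = a' \<and> b = b'" using ab ch(3) by (auto dest: inj_onD)
  qed
  have F: "F (coord_append n x y) = \<phi> (g x \<otimes> g y)" if "x \<in> D" "y \<in> D" for x y
  proof -
    have "coord_append n x y = \<Phi> (g x, g y)" using that by (simp add: \<Phi>_def \<phi>g)
    then show ?thesis using inv_into_f_f[OF \<Phi>inj, of "(g x, g y)"] gU that by (simp add: F_def)
  qed
  have boxW: "coord_box (n + n) (coord_append n p p) d0 \<subseteq> W"
  proof
    fix z assume z: "z \<in> coord_box (n + n) (coord_append n p p) d0"
    then have "z \<in> vecs (n + n)" by (simp add: coord_box_def)
    then obtain x y where xy: "x \<in> vecs n" "y \<in> vecs n" "z = coord_append n x y"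
      by (rule coord_append_split)
    then have "x \<in> l1_ball n p \<delta>" "y \<in> l1_ball n p \<delta>"
      using coord_append_in_coord_box[OF z[unfolded xy(3)] xy(1,2)] d0 by auto
    then have "x \<in> D" "y \<in> D" "g x \<otimes> g y \<in> U" using ballD ballV VV by auto
    moreover from this have "z = \<Phi> (g x, g y)" by (simp add: \<Phi>_def \<phi>g xy)
    ultimately show "z \<in> W" unfolding W_def using gU by (intro image_eqI) auto
  qed
  have "(U \<times> U, \<Phi>) \<in> prod_atlas n atlas atlas"
    unfolding prod_atlas_def \<Phi>_def using U(1) by blast
  then have smooth: "smooth_real_map_on (n + n) n W F"
    using smooth_mult U(1) unfolding smooth_map_def W_def F_def by (auto dest!: bspec)
  have "\<exists>d>0. \<exists>M. \<forall>x\<in>coord_box n p d. \<forall>x'\<in>coord_box n p d. \<forall>y\<in>coord_box n p d. \<forall>y'\<in>coord_box n p d.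
    \<bar>F (coord_append n x y) j - F (coord_append n x' y) j - F (coord_append n x y') j + F (coord_append n x' y') j\<bar>
      \<le> M * l1 n (x - x') * l1 n (y - y')" if "j < n" for j
    using C2_mixed_difference[OF _ pv boxW d0(1), of "\<lambda>z. F z j"] smooth that
    by (auto simp: smooth_real_map_on_def)
  then obtain d M where d: "\<And>j. j < n \<Longrightarrow> d j > 0" and M: "\<And>j x x' y y'. j < n \<Longrightarrow> x\<in>coord_box n p (d j) \<Longrightarrow>
     x'\<in>coord_box n p (d j) \<Longrightarrow> y\<in>coord_box n p (d j) \<Longrightarrow> y'\<in>coord_box n p (d j) \<Longrightarrow>
    \<bar>F (coord_append n x y) j - F (coord_append n x' y) j - F (coord_append n x y') j + F (coord_append n x' y') j\<bar>
      \<le> M j * l1 n (x - x') * l1 n (y - y')"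
    by metis
  have "\<exists>d1>0. \<forall>j\<in>{..<n}. \<forall>t. t < d1 \<longrightarrow> t \<le> d j"
    by (rule uniform_radius) (use d in \<open>auto intro: less_imp_le\<close>)
  then obtain d1 where d1: "d1 > 0" "\<And>j t. j < n \<Longrightarrow> t < d1 \<Longrightarrow> t \<le> d j" by auto
  define C where "C = (\<Sum>j<n. \<bar>M j\<bar>)"
  have C: "C \<ge> 0" by (simp add: C_def sum_nonneg)
  \<comment> \<open>A quarter of \<open>\<delta>\<close> leaves room for products, whose norm is
    below \<open>3 * r\<close>; half of \<open>d1\<close> makes \<open>r < d1\<close> strict; the
    last term gives \<open>C * r \<le> 1 / 8\<close>, with \<open>C + 1\<close> as denominator in
    case \<open>C = 0\<close>.\<close>
  define r where "r = min (min (\<delta> / 4) (d1 / 2)) (1 / (8 * (C + 1)))"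
  have r: "r > 0" "r \<le> \<delta> / 4" "r < d1" using \<delta> d1(1) C by (auto simp: r_def)
  have Cr: "C * r \<le> 1 / 8"
  proof -
    have "C * r \<le> C * (1 / (8 * (C + 1)))" using C by (intro mult_left_mono) (auto simp: r_def)
    also have "\<dots> \<le> 1 / 8" using C by (simp add: field_simps)
    finally show ?thesis .
  qed
  define \<psi> where "\<psi> x = g (p + x)" for x
  define \<mu> where "\<mu> x y = \<phi> (\<psi> x \<otimes> \<psi> y) - p" for x y
  have shift: "p + x \<in> l1_ball n p s \<longleftrightarrow> x \<in> l1_ball n 0 s" for x s
  proof -
    have "p + x \<in> vecs n \<longleftrightarrow> x \<in> vecs n" using vecs_diff[OF _ pv, of "p + x"] pv by auto
    then show ?thesis by (simp add: l1_ball_def)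
  qed
  have pxD: "p + x \<in> D" and \<psi>V: "\<psi> x \<in> V" if "x \<in> l1_ball n 0 \<delta>" for x
    using that ballD ballV shift by (auto simp: \<psi>_def)
  have small: "x \<in> l1_ball n 0 \<delta>" if "x \<in> l1_ball n 0 r" for x
    using that r by (auto simp: l1_ball_def)
  have \<psi>0: "\<psi> 0 = \<one>" using gp by (simp add: \<psi>_def)
  have \<psi>G: "\<psi> x \<in> carrier G" if "x \<in> l1_ball n 0 \<delta>" for x using \<psi>V[OF that] V(3) ch(4) by auto
  have \<phi>\<psi>: "\<phi> (\<psi> x) = p + x" if "x \<in> l1_ball n 0 \<delta>" for x using \<phi>g pxD[OF that] by (simp add: \<psi>_def)
  have mixed: "l1 n (\<mu> x y - \<mu> x' y - \<mu> x y' + \<mu> x' y') \<le> C * l1 n (x - x') * l1 n (y - y')"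
    if xs: "x \<in> l1_ball n 0 r" "x' \<in> l1_ball n 0 r" "y \<in> l1_ball n 0 r" "y' \<in> l1_ball n 0 r" for x x' y y'
  proof -
    have box: "p + z \<in> coord_box n p (d j)" if "z \<in> l1_ball n 0 r" "j < n" for z j
      using that l1_ball_subset_coord_box[of n p r] d1(2)[OF that(2) r(3)] shift[of z r]
      by (fastforce simp: coord_box_def)
    have \<mu>F: "\<mu> a b = F (coord_append n (p + a) (p + b)) - p" if "a \<in> l1_ball n 0 r" "b \<in> l1_ball n 0 r" for a b
      using F pxD small that by (simp add: \<mu>_def \<psi>_def)
    have "l1 n (\<mu> x y - \<mu> x' y - \<mu> x y' + \<mu> x' y') \<le> (\<Sum>j<n. \<bar>M j\<bar> * l1 n (x - x') * l1 n (y - y'))"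
      unfolding l1_def[of n "\<mu> x y - \<mu> x' y - \<mu> x y' + \<mu> x' y'"]
    proof (rule sum_mono)
      fix j assume "j \<in> {..<n}"
      then have j: "j < n" by simp
      have "\<bar>(\<mu> x y - \<mu> x' y - \<mu> x y' + \<mu> x' y') j\<bar> \<le> M j * l1 n (x - x') * l1 n (y - y')"
        using M[OF j box[OF xs(1) j] box[OF xs(2) j] box[OF xs(3) j] box[OF xs(4) j]] xs
        by (simp add: \<mu>F)
      also have "\<dots> \<le> \<bar>M j\<bar> * l1 n (x - x') * l1 n (y - y')"
        by (intro mult_right_mono) auto
      finally show "\<bar>(\<mu> x y - \<mu> x' y - \<mu> x y' + \<mu> x' y') j\<bar> \<le> \<bar>M j\<bar> * l1 n (x - x') * l1 n (y - y')" .
    qed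
    then show ?thesis by (simp add: C_def sum_distrib_right)
  qed
  have \<mu>v: "\<mu> x y \<in> vecs n" if "x \<in> l1_ball n 0 \<delta>" "y \<in> l1_ball n 0 \<delta>" for x y
    using VV[OF \<psi>V \<psi>V, OF that] ch(5) pv unfolding \<mu>_def by (intro vecs_diff) auto
  have B0: "0 \<in> l1_ball n 0 r" using r by (simp add: l1_ball_def)
  have \<mu>0: "\<mu> x 0 = x" "\<mu> 0 x = x" if "x \<in> l1_ball n 0 r" for x
    using \<psi>G[OF small[OF that]] \<phi>\<psi>[OF small[OF that]] by (auto simp: \<mu>_def \<psi>0)
  have \<mu>in: "\<mu> x y \<in> l1_ball n 0 \<delta>" if "x \<in> l1_ball n 0 r" "y \<in> l1_ball n 0 r" for x y
  proof -
    have "l1 n (\<mu> x y - y - x) \<le> C * l1 n x * l1 n y"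
      using mixed[OF that(1) B0 that(2) B0] that \<mu>0 B0 by simp
    also have "\<dots> \<le> (C * r) * l1 n y"
      using that C by (intro mult_right_mono mult_left_mono) (auto simp: l1_ball_def)
    also have "\<dots> \<le> 1 * l1 n y" using Cr by (intro mult_right_mono) auto
    finally have "l1 n (\<mu> x y - y - x) \<le> l1 n y" by simp
    moreover have "l1 n (\<mu> x y) \<le> l1 n (\<mu> x y - y - x) + (l1 n x + l1 n y)"
      using l1_triangle[of n "\<mu> x y - y - x" "x + y"] l1_triangle[of n x y] by simp
    ultimately have "l1 n (\<mu> x y) < \<delta>" using that r by (auto simp: l1_ball_def)
    then show ?thesis using \<mu>v small that by (simp add: l1_ball_def)
  qed
  have "local_coordinates G X n \<psi> \<mu> \<delta> r C"
  proof unfold_locales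
    show "continuous_map (subtopology (Euclidean_space n) (l1_ball n 0 \<delta>)) X \<psi>"
    proof -
      have "continuous_map (subtopology (Euclidean_space n) (l1_ball n 0 \<delta>)) (Euclidean_space n) (\<lambda>x. p + x)"
        by (rule continuous_map_Euclidean_Lipschitz[where K = 1]) (auto simp: l1_ball_def pv)
      then have "continuous_map (subtopology (Euclidean_space n) (l1_ball n 0 \<delta>)) (subtopology (Euclidean_space n) D) (\<lambda>x. p + x)"
        using pxD by (auto simp: continuous_map_in_subtopology)
      from continuous_map_compose[OF this contg] show ?thesis
        by (simp add: o_def \<psi>_def[abs_def])
    qed
    show "inj_on \<psi> (l1_ball n 0 \<delta>)" using \<phi>\<psi> by (metis inj_onI add_left_cancel)
    show "openin X (\<psi> ` S)" if S: "openin (Euclidean_space n) S" "S \<subseteq> l1_ball n 0 \<delta>" for S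
    proof -
      have "openin (Euclidean_space n) ((+) p ` S)" by (rule openin_translate_Euclidean[OF pv S(1)])
      moreover have "(+) p ` S \<subseteq> D" using S(2) pxD by auto
      ultimately have "openin X (g ` (+) p ` S)" using ch(7) by (simp add: g_def D_def)
      then show ?thesis by (simp add: image_image \<psi>_def)
    qed
    show "\<psi> (\<mu> x y) = \<psi> x \<otimes> \<psi> y" if "x \<in> l1_ball n 0 r" "y \<in> l1_ball n 0 r" for x y
    proof -
      have "\<psi> x \<otimes> \<psi> y \<in> U" using VV \<psi>V small that by simp
      then show ?thesis using ch(3) by (simp add: \<mu>_def \<psi>_def g_def)
    qed
  qed (use \<delta> r C Cr \<psi>0 \<mu>in mixed m_comm in auto)
  then show ?thesis by blast
qed


section \<open>The exponential map\<close>

lemma in_l1_ball_0: "x \<in> l1_ball n 0 s \<longleftrightarrow> x \<in> vecs n \<and> l1 n x < s"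
  by (simp add: l1_ball_def)

context local_coordinates
begin

lemma small_ball: "x \<in> l1_ball n 0 r \<Longrightarrow> x \<in> l1_ball n 0 \<delta>"
  using pos by (simp add: in_l1_ball_0)

lemma zero_in_ball: "0 \<in> l1_ball n 0 r"
  using pos by (simp add: in_l1_ball_0)

lemma \<psi>_carrier: "x \<in> l1_ball n 0 \<delta> \<Longrightarrow> \<psi> x \<in> carrier G"
  using continuous_map_funspace[OF \<psi>_cont] by (auto simp: topspace_eq in_l1_ball_0)

lemma \<mu>_vecs: "x \<in> l1_ball n 0 r \<Longrightarrow> y \<in> l1_ball n 0 r \<Longrightarrow> \<mu> x y \<in> vecs n"
  using \<mu>_in by (simp add: in_l1_ball_0)

lemma \<mu>_0_left: "x \<in> l1_ball n 0 r \<Longrightarrow> \<mu> 0 x = x"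
  using \<psi>_inj by (rule inj_onD) (use \<psi>_\<mu> zero_in_ball \<mu>_in small_ball \<psi>_0 \<psi>_carrier in auto)

lemma \<mu>_0_right: "x \<in> l1_ball n 0 r \<Longrightarrow> \<mu> x 0 = x"
  using \<psi>_inj by (rule inj_onD) (use \<psi>_\<mu> zero_in_ball \<mu>_in small_ball \<psi>_0 \<psi>_carrier in auto)

text \<open>With one argument at the neutral element 0 the mixed difference becomes a comparison of
  \<open>\<mu>\<close> with addition.\<close>

lemma \<mu>_diff_left:
  assumes "x \<in> l1_ball n 0 r" "x' \<in> l1_ball n 0 r" "y \<in> l1_ball n 0 r"
  shows "l1 n (\<mu> x y - \<mu> x' y - (x - x')) \<le> C * l1 n (x - x') * l1 n y"
proof -
  have "\<mu> x y - \<mu> x' y - \<mu> x 0 + \<mu> x' 0 = \<mu> x y - \<mu> x' y - (x - x')"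
    using assms by (simp add: \<mu>_0_right)
  then show ?thesis using mixed[OF assms(1,2,3) zero_in_ball] by (simp only: diff_zero)
qed

lemma \<mu>_diff_right:
  assumes "x \<in> l1_ball n 0 r" "y \<in> l1_ball n 0 r" "y' \<in> l1_ball n 0 r"
  shows "l1 n (\<mu> x y - \<mu> x y' - (y - y')) \<le> C * l1 n x * l1 n (y - y')"
proof -
  have "\<mu> x y - \<mu> 0 y - \<mu> x y' + \<mu> 0 y' = \<mu> x y - \<mu> x y' - (y - y')"
    using assms by (simp add: \<mu>_0_left)
  then show ?thesis using mixed[OF assms(1) zero_in_ball assms(2,3)] by (simp only: diff_zero)
qed

lemma \<mu>_approx:
  assumes "x \<in> l1_ball n 0 r" "y \<in> l1_ball n 0 r"
  shows "l1 n (\<mu> x y - (x + y)) \<le> C * l1 n x * l1 n y"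
  using \<mu>_diff_left[OF assms(1) zero_in_ball assms(2)] assms \<mu>_0_left
  by (simp add: algebra_simps)

lemma C_l1_le: "x \<in> l1_ball n 0 r \<Longrightarrow> C * l1 n x \<le> 1 / 8"
  using mult_left_mono[of "l1 n x" r C] pos by (auto simp: in_l1_ball_0)

lemma \<mu>_Lipschitz:
  assumes "x \<in> l1_ball n 0 r" "x' \<in> l1_ball n 0 r" "y \<in> l1_ball n 0 r" "y' \<in> l1_ball n 0 r"
  shows "l1 n (\<mu> x y - \<mu> x' y') \<le> 2 * l1 n (x - x') + 2 * l1 n (y - y')"
proof -
  have "l1 n (\<mu> x y - \<mu> x' y) \<le> l1 n (\<mu> x y - \<mu> x' y - (x - x')) + l1 n (x - x')"
    using l1_triangle[of n "\<mu> x y - \<mu> x' y - (x - x')" "x - x'"] by simp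
  also have "\<dots> \<le> C * l1 n y * l1 n (x - x') + l1 n (x - x')"
    using \<mu>_diff_left[OF assms(1-3)] by (simp add: mult_ac)
  also have "\<dots> \<le> 1 * l1 n (x - x') + l1 n (x - x')"
    using C_l1_le[OF assms(3)] by (intro add_right_mono mult_right_mono) auto
  finally have 1: "l1 n (\<mu> x y - \<mu> x' y) \<le> 2 * l1 n (x - x')" by simp
  have "l1 n (\<mu> x' y - \<mu> x' y') \<le> l1 n (\<mu> x' y - \<mu> x' y' - (y - y')) + l1 n (y - y')"
    using l1_triangle[of n "\<mu> x' y - \<mu> x' y' - (y - y')" "y - y'"] by simp
  also have "\<dots> \<le> C * l1 n x' * l1 n (y - y') + l1 n (y - y')"
    using \<mu>_diff_right[OF assms(2-4)] by simp
  also have "\<dots> \<le> 1 * l1 n (y - y') + l1 n (y - y')"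
    using C_l1_le[OF assms(2)] by (intro add_right_mono mult_right_mono) auto
  finally have 2: "l1 n (\<mu> x' y - \<mu> x' y') \<le> 2 * l1 n (y - y')" by simp
  show ?thesis using 1 2 l1_triangle_diff[of n "\<mu> x y" "\<mu> x' y'" "\<mu> x' y"] by linarith
qed

definition sq :: "(nat \<Rightarrow> real) \<Rightarrow> (nat \<Rightarrow> real)" where
  "sq x = \<mu> x x"

lemma sq_approx:
  assumes "x \<in> l1_ball n 0 r"
  shows "l1 n (sq x - 2 *\<^sub>R x) \<le> C * (l1 n x)\<^sup>2"
  using \<mu>_approx[OF assms assms] by (simp add: sq_def scaleR_2 power2_eq_square)

lemma sq_diff:
  assumes "x \<in> l1_ball n 0 r" "y \<in> l1_ball n 0 r"
  shows "l1 n (sq x - sq y - 2 *\<^sub>R (x - y)) \<le> C * (l1 n x + l1 n y) * l1 n (x - y)"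
proof -
  have eq: "sq x - sq y - 2 *\<^sub>R (x - y) = (\<mu> x x - \<mu> y x - (x - y)) + (\<mu> y x - \<mu> y y - (x - y))"
    by (simp add: sq_def fun_eq_iff)
  show ?thesis
    unfolding eq using \<mu>_diff_left[OF assms(1,2,1)] \<mu>_diff_right[OF assms(2,1,2)]
      l1_triangle[of n "\<mu> x x - \<mu> y x - (x - y)" "\<mu> y x - \<mu> y y - (x - y)"]
    by (simp add: algebra_simps)
qed

text \<open>With \<open>u = 2 ^ k * l1 n x\<close>, the bound \<open>u * (1 + 2 * (C * u))\<close>
  reproduces itself under one more squaring: \<open>u\<close> doubles, and so does the relative
  error, which includes the new quadratic term. The condition \<open>2 * u < r\<close> keeps that
  error small.\<close>

lemma sq_iterate:
  assumes "x \<in> vecs n" "2 ^ k * l1 n x < r / 2"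
  shows "(sq ^^ k) x \<in> l1_ball n 0 r \<and> l1 n ((sq ^^ k) x) \<le> 2 ^ k * l1 n x * (1 + 2 * (C * (2 ^ k * l1 n x)))
    \<and> \<psi> ((sq ^^ k) x) = \<psi> x [^] (2 ^ k :: nat)"
  using assms(2)
proof (induction k)
  case 0
  then have "l1 n x < r / 2" by simp
  then have "l1 n x < r" using pos(2) by linarith
  then have "x \<in> l1_ball n 0 r" using assms(1) by (simp add: in_l1_ball_0)
  moreover have "l1 n x \<le> l1 n x * (1 + 2 * (C * l1 n x))" using pos by (simp add: distrib_left)
  moreover have "\<psi> x [^] (1::nat) = \<psi> x" using \<psi>_carrier[OF small_ball[OF \<open>x \<in> l1_ball n 0 r\<close>]] by simp
  ultimately show ?case by (simp only: funpow_0 power_0 mult_1)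
next
  case (Suc k)
  define u where "u = 2 ^ k * l1 n x"
  define a where "a = l1 n ((sq ^^ k) x)"
  have u: "u \<ge> 0" "2 * u < r / 2" using Suc.prems by (simp_all add: u_def mult_ac)
  then have Cu: "C * u \<le> 1 / 32" "C * u \<ge> 0"
    using mult_left_mono[of "4 * u" r C] pos by auto
  have IH: "(sq ^^ k) x \<in> l1_ball n 0 r" "a \<le> u * (1 + 2 * (C * u))" "\<psi> ((sq ^^ k) x) = \<psi> x [^] (2 ^ k :: nat)"
  proof -
    have "2 ^ k * l1 n x < r / 2" using u unfolding u_def by linarith
    from Suc.IH[OF this] show "(sq ^^ k) x \<in> l1_ball n 0 r" "a \<le> u * (1 + 2 * (C * u))"
      "\<psi> ((sq ^^ k) x) = \<psi> x [^] (2 ^ k :: nat)"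
      unfolding u_def a_def by (rule conjunct1, rule conjunct2[THEN conjunct1], rule conjunct2[THEN conjunct2])
  qed
  have x: "x \<in> l1_ball n 0 r"
  proof -
    have "1 * l1 n x \<le> 2 ^ Suc k * l1 n x" by (rule mult_right_mono) (simp_all add: one_le_power del: power_Suc)
    then show ?thesis using Suc.prems assms(1) pos by (simp add: in_l1_ball_0)
  qed
  have a0: "a \<ge> 0" by (simp add: a_def)
  have a2: "a \<le> 2 * u" using IH(2) Cu u mult_left_mono[of "1 + 2 * (C * u)" 2 u] by simp
  have "l1 n (sq ((sq ^^ k) x)) \<le> l1 n (sq ((sq ^^ k) x) - 2 *\<^sub>R (sq ^^ k) x) + l1 n (2 *\<^sub>R (sq ^^ k) x)"
    using l1_triangle[of n "sq ((sq ^^ k) x) - 2 *\<^sub>R (sq ^^ k) x" "2 *\<^sub>R (sq ^^ k) x"] by simp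
  also have "\<dots> \<le> C * a\<^sup>2 + 2 * a" using sq_approx[OF IH(1)] by (simp add: a_def)
  \<comment> \<open>The crude bound \<open>2 * u\<close> is good enough in the quadratic term; the
    linear term takes the sharp induction hypothesis.\<close>
  also have "\<dots> \<le> C * (2 * u)\<^sup>2 + 2 * (u * (1 + 2 * (C * u)))"
    using pos a0 a2 IH(2) by (intro add_mono mult_left_mono power_mono) auto
  also have "\<dots> = 2 * u * (1 + 2 * (C * (2 * u)))"
    by (simp add: power2_eq_square algebra_simps)
  finally have bnd: "l1 n (sq ((sq ^^ k) x)) \<le> 2 * u * (1 + 2 * (C * (2 * u)))" .
  have "2 * u * (1 + 2 * (C * (2 * u))) \<le> 2 * u * 2"
    using Cu u by (intro mult_left_mono) auto
  then have "l1 n (sq ((sq ^^ k) x)) < r" using bnd u by linarith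
  moreover have "sq ((sq ^^ k) x) \<in> vecs n"
    using \<mu>_vecs[OF IH(1) IH(1)] unfolding sq_def[of "(sq ^^ k) x"] .
  moreover have "\<psi> (sq ((sq ^^ k) x)) = \<psi> x [^] (2 ^ Suc k :: nat)"
    using \<psi>_\<mu>[OF IH(1) IH(1)] IH(3) nat_pow_mult[OF \<psi>_carrier[OF small_ball[OF x]], of "2 ^ k" "2 ^ k"]
    by (simp add: sq_def mult_2)
  moreover have "l1 n (sq ((sq ^^ k) x)) \<le> 2 ^ Suc k * l1 n x * (1 + 2 * (C * (2 ^ Suc k * l1 n x)))"
    using bnd by (simp add: u_def mult_ac)
  ultimately show ?case unfolding in_l1_ball_0 funpow.simps o_apply by blast
qed

lemma sq_iterate_ball:
  assumes "x \<in> vecs n" "2 ^ k * l1 n x < r / 2"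
  shows "(sq ^^ k) x \<in> l1_ball n 0 r" "l1 n ((sq ^^ k) x) \<le> 2 * (2 ^ k * l1 n x)"
    "\<psi> ((sq ^^ k) x) = \<psi> x [^] (2 ^ k :: nat)"
proof -
  define u where "u = 2 ^ k * l1 n x"
  have "u \<ge> 0" "u < r / 2" using assms by (auto simp: u_def)
  then have "C * u \<le> 1 / 16" using mult_left_mono[of "2 * u" r C] pos by auto
  then have "u * (1 + 2 * (C * u)) \<le> u * 2" using \<open>u \<ge> 0\<close> by (intro mult_left_mono) auto
  then show "(sq ^^ k) x \<in> l1_ball n 0 r" "l1 n ((sq ^^ k) x) \<le> 2 * (2 ^ k * l1 n x)"
    "\<psi> ((sq ^^ k) x) = \<psi> x [^] (2 ^ k :: nat)"
    using sq_iterate[OF assms] unfolding u_def[symmetric] by auto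
qed

text \<open>The relative distortion after \<open>k\<close> squarings is at most \<open>4 * C\<close>
  times the current scale \<open>2 ^ k * w\<close>, so the bound may double with each step. In the
  upper estimate the product of the factors \<open>1 + 2 * (C * u)\<close> and
  \<open>1 + 4 * (C * u)\<close> fits under it because \<open>C * u\<close> is at most
  \<open>1 / 32\<close>. The lower estimate is kept for the injectivity of the limit.\<close>

lemma sq_iterate_biLipschitz:
  assumes "x \<in> vecs n" "y \<in> vecs n" "l1 n x \<le> w" "l1 n y \<le> w" "2 ^ k * w < r / 2"
  shows "l1 n ((sq ^^ k) x - (sq ^^ k) y) \<le> 2 ^ k * l1 n (x - y) * (1 + 4 * (C * (2 ^ k * w)))
    \<and> 2 ^ k * l1 n (x - y) * (1 - 4 * (C * (2 ^ k * w))) \<le> l1 n ((sq ^^ k) x - (sq ^^ k) y)"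
  using assms(5)
proof (induction k)
  case 0
  have "w \<ge> 0" using assms(3) l1_nonneg[of n x] by linarith
  then have "d \<le> d * (1 + 4 * (C * w)) \<and> d * (1 - 4 * (C * w)) \<le> d" if "d \<ge> 0" for d
    using pos that by (simp add: distrib_left right_diff_distrib)
  then show ?case by (simp only: funpow_0 power_0 mult_1 l1_nonneg)
next
  case (Suc k)
  define u where "u = 2 ^ k * w"
  define s where "s = 2 ^ k * l1 n (x - y)"
  define d where "d = l1 n ((sq ^^ k) x - (sq ^^ k) y)"
  define d' where "d' = l1 n (sq ((sq ^^ k) x) - sq ((sq ^^ k) y))"
  have "w \<ge> 0" using assms(3) l1_nonneg[of n x] by linarith
  then have u: "u \<ge> 0" "2 * u < r / 2" using Suc.prems by (simp_all add: u_def mult_ac)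
  then have Cu: "C * u \<le> 1 / 32" "C * u \<ge> 0"
    using mult_left_mono[of "4 * u" r C] pos by auto
  have s0: "s \<ge> 0" and d0: "d \<ge> 0" by (simp_all add: s_def d_def)
  have IH: "d \<le> s * (1 + 4 * (C * u))" "s * (1 - 4 * (C * u)) \<le> d"
    using Suc.IH u unfolding u_def d_def s_def by linarith+
  have ux: "2 ^ k * l1 n x \<le> u" "2 ^ k * l1 n y \<le> u" using assms(3,4) by (auto simp: u_def)
  then have "2 ^ k * l1 n x < r / 2" "2 ^ k * l1 n y < r / 2" using u by linarith+
  note bx = sq_iterate_ball[OF assms(1) this(1)] and by' = sq_iterate_ball[OF assms(2) this(2)]
  have "l1 n (sq ((sq ^^ k) x) - sq ((sq ^^ k) y) - 2 *\<^sub>R ((sq ^^ k) x - (sq ^^ k) y))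
      \<le> C * (l1 n ((sq ^^ k) x) + l1 n ((sq ^^ k) y)) * d"
    using sq_diff[OF bx(1) by'(1)] by (simp add: d_def)
  also have "\<dots> \<le> C * (4 * u) * d"
    using pos d0 bx(2) by'(2) ux by (intro mult_right_mono mult_left_mono) auto
  finally have e: "l1 n (sq ((sq ^^ k) x) - sq ((sq ^^ k) y) - 2 *\<^sub>R ((sq ^^ k) x - (sq ^^ k) y)) \<le> 4 * (C * u) * d"
    by (simp add: mult_ac)
  let ?v = "sq ((sq ^^ k) x) - sq ((sq ^^ k) y)" and ?z = "2 *\<^sub>R ((sq ^^ k) x - (sq ^^ k) y)"
  have z: "l1 n ?z = 2 * d" by (simp add: d_def)
  have "d' \<le> 2 * d + 4 * (C * u) * d"
    using l1_triangle[of n "?v - ?z" ?z] e z by (simp add: d'_def)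
  also have "\<dots> = 2 * (1 + 2 * (C * u)) * d" by (simp add: algebra_simps)
  also have "\<dots> \<le> 2 * (1 + 2 * (C * u)) * (s * (1 + 4 * (C * u)))"
    using IH Cu by (intro mult_left_mono) auto
  also have "\<dots> = 2 * s * ((1 + 2 * (C * u)) * (1 + 4 * (C * u)))" by (simp add: algebra_simps)
  also have "\<dots> \<le> 2 * s * (1 + 8 * (C * u))"
  proof (rule mult_left_mono)
    have "(C * u) * (C * u) \<le> 1/32 * (C * u)" using Cu by (intro mult_right_mono) auto
    then show "(1 + 2 * (C * u)) * (1 + 4 * (C * u)) \<le> 1 + 8 * (C * u)"
      using Cu by (simp add: algebra_simps)
  qed (use s0 in auto)
  finally have up: "d' \<le> 2 * s * (1 + 8 * (C * u))" .
  have "2 * s * (1 - 8 * (C * u)) \<le> 2 * s * ((1 - 2 * (C * u)) * (1 - 4 * (C * u)))"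
  proof (rule mult_left_mono)
    have "0 \<le> (C * u) * (C * u)" using Cu by simp
    then show "1 - 8 * (C * u) \<le> (1 - 2 * (C * u)) * (1 - 4 * (C * u))"
      using Cu by (simp add: algebra_simps)
  qed (use s0 in auto)
  also have "\<dots> = 2 * (1 - 2 * (C * u)) * (s * (1 - 4 * (C * u)))" by (simp add: algebra_simps)
  also have "\<dots> \<le> 2 * (1 - 2 * (C * u)) * d"
    using IH Cu by (intro mult_left_mono) auto
  also have "\<dots> = 2 * d - 4 * (C * u) * d" by (simp add: algebra_simps)
  also have "\<dots> \<le> d'"
    using l1_triangle_diff[of n ?z 0 ?v] e z by (simp add: d'_def l1_minus_commute[of n ?z])
  finally have low: "2 * s * (1 - 8 * (C * u)) \<le> d'" .
  have "d' \<le> 2 ^ Suc k * l1 n (x - y) * (1 + 4 * (C * (2 ^ Suc k * w))) \<and>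
      2 ^ Suc k * l1 n (x - y) * (1 - 4 * (C * (2 ^ Suc k * w))) \<le> d'"
    using up low by (simp add: s_def u_def mult_ac)
  then show ?case unfolding d'_def funpow.simps o_apply .
qed

lemma sq_iterate_Lipschitz:
  assumes "x \<in> vecs n" "y \<in> vecs n" "l1 n x \<le> w" "l1 n y \<le> w" "2 ^ k * w < r / 2"
  shows "l1 n ((sq ^^ k) x - (sq ^^ k) y) \<le> 2 * (2 ^ k * l1 n (x - y))"
    and "2 ^ k * l1 n (x - y) / 2 \<le> l1 n ((sq ^^ k) x - (sq ^^ k) y)"
proof -
  define s where "s = 2 ^ k * l1 n (x - y)"
  have "C * (2 ^ k * w) \<le> 1 / 16" using mult_left_mono[of "2 * (2 ^ k * w)" r C] assms(5) pos by auto
  moreover have "C * (2 ^ k * w) \<ge> 0"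
  proof -
    have "w \<ge> 0" using assms(3) l1_nonneg[of n x] by linarith
    then show ?thesis using pos by simp
  qed
  ultimately have "s * (1 + 4 * (C * (2 ^ k * w))) \<le> s * 2" "s * (1 / 2) \<le> s * (1 - 4 * (C * (2 ^ k * w)))"
    by (intro mult_left_mono; simp add: s_def)+
  then show "l1 n ((sq ^^ k) x - (sq ^^ k) y) \<le> 2 * (2 ^ k * l1 n (x - y))"
    "2 ^ k * l1 n (x - y) / 2 \<le> l1 n ((sq ^^ k) x - (sq ^^ k) y)"
    using sq_iterate_biLipschitz[OF assms] unfolding s_def[symmetric] by auto
qed

text \<open>The \<open>2 ^ k\<close>-th power of \<open>v / 2 ^ k\<close>, computed in the chart.\<close>

definition approx_exp :: "nat \<Rightarrow> (nat \<Rightarrow> real) \<Rightarrow> (nat \<Rightarrow> real)" where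
  "approx_exp k v = (sq ^^ k) ((1 / 2 ^ k) *\<^sub>R v)"

lemma approx_exp_ball:
  assumes "v \<in> l1_ball n 0 (r / 2)"
  shows "approx_exp k v \<in> l1_ball n 0 r" "\<psi> (approx_exp k v) = \<psi> ((1 / 2 ^ k) *\<^sub>R v) [^] (2 ^ k :: nat)"
    "l1 n (approx_exp k v) \<le> 2 * l1 n v"
  using assms sq_iterate_ball[of "(1 / 2 ^ k) *\<^sub>R v" k] by (auto simp: approx_exp_def in_l1_ball_0)

lemma approx_exp_Lipschitz:
  assumes "v \<in> l1_ball n 0 (r / 2)" "w \<in> l1_ball n 0 (r / 2)"
  shows "l1 n (approx_exp k v - approx_exp k w) \<le> 2 * l1 n (v - w)"
    "l1 n (v - w) / 2 \<le> l1 n (approx_exp k v - approx_exp k w)"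
proof -
  have d: "l1 n ((1 / 2 ^ k) *\<^sub>R v - (1 / 2 ^ k) *\<^sub>R w) = l1 n (v - w) / 2 ^ k"
    by (simp flip: scaleR_diff_right)
  show "l1 n (approx_exp k v - approx_exp k w) \<le> 2 * l1 n (v - w)"
    "l1 n (v - w) / 2 \<le> l1 n (approx_exp k v - approx_exp k w)"
    using sq_iterate_Lipschitz[of "(1 / 2 ^ k) *\<^sub>R v" "(1 / 2 ^ k) *\<^sub>R w" "max (l1 n v) (l1 n w) / 2 ^ k" k] assms
    unfolding approx_exp_def d by (auto simp: in_l1_ball_0 divide_right_mono)
qed

text \<open>Both sides are \<open>k\<close> squarings, started at the square of
  \<open>v / 2 ^ (k + 1)\<close> and at \<open>v / 2 ^ k\<close>. The starting points differ by a
  quantity of order \<open>4 ^ (- k)\<close>, and the squarings magnify it by at most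
  \<open>2 * 2 ^ k\<close>, which leaves a summable error.\<close>

lemma approx_exp_step:
  assumes v: "v \<in> l1_ball n 0 (r / 4)"
  shows "l1 n (approx_exp (Suc k) v - approx_exp k v) \<le> r / 2 ^ k"
proof -
  define L where "L = l1 n v"
  define x where "x = (1 / 2 ^ Suc k) *\<^sub>R v"
  define y where "y = (1 / 2 ^ k) *\<^sub>R v"
  have L: "0 \<le> L" "L < r / 4" "v \<in> vecs n" using v by (auto simp: L_def in_l1_ball_0)
  have p2: "(2::real) ^ k \<ge> 1" by simp
  have lx: "l1 n x = L / 2 ^ Suc k" "l1 n y = L / 2 ^ k" by (simp_all add: x_def y_def L_def)
  have "L / 2 ^ Suc k \<le> L / 1" using L p2 by (intro divide_left_mono) (auto intro: order.trans[OF p2])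
  then have xr: "x \<in> l1_ball n 0 r" using L pos by (simp add: in_l1_ball_0 lx) (simp add: x_def)
  have yx: "y = 2 *\<^sub>R x" by (simp add: x_def y_def)
  have sqx: "l1 n (sq x - y) \<le> C * (L / 2 ^ Suc k)\<^sup>2" using sq_approx[OF xr] by (simp add: yx lx)
  have "C * (L / 2 ^ Suc k)\<^sup>2 \<le> (C * r) * (L / 2 ^ Suc k)"
    using pos L \<open>L / 2 ^ Suc k \<le> L / 1\<close> unfolding power2_eq_square mult.assoc[symmetric]
    by (intro mult_right_mono mult_left_mono) auto
  also have "\<dots> \<le> 1 * (L / 2 ^ Suc k)" using pos L by (intro mult_right_mono) auto
  finally have "C * (L / 2 ^ Suc k)\<^sup>2 \<le> L / 2 ^ Suc k" by simp
  moreover have "L / 2 ^ Suc k \<le> L / 2 ^ k" using L by (simp add: field_simps)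
  ultimately have sqx1: "l1 n (sq x - y) \<le> L / 2 ^ k" using sqx by linarith
  then have "l1 n (sq x) \<le> 2 * L / 2 ^ k"
    using l1_triangle[of n "sq x - y" y] lx by simp
  moreover have "l1 n y \<le> 2 * L / 2 ^ k" using L by (simp add: lx divide_right_mono)
  moreover have "sq x \<in> vecs n" unfolding sq_def by (rule \<mu>_vecs[OF xr xr])
  moreover have "y \<in> vecs n" using L by (simp add: y_def)
  ultimately have "l1 n ((sq ^^ k) (sq x) - (sq ^^ k) y) \<le> 2 * (2 ^ k * l1 n (sq x - y))"
    using L by (intro sq_iterate_Lipschitz[where w = "2 * L / 2 ^ k"]) auto
  also have "\<dots> \<le> 2 * (2 ^ k * (C * (L / 2 ^ Suc k)\<^sup>2))" using sqx by simp
  also have "\<dots> = C * L * L / (2 * 2 ^ k)" by (simp add: power2_eq_square field_simps)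
  also have "\<dots> \<le> (C * r) * r / (2 * 2 ^ k)"
    using L pos by (intro divide_right_mono mult_mono mult_left_mono) auto
  also have "\<dots> \<le> 1 * r / (2 * 2 ^ k)" using pos by (intro divide_right_mono mult_right_mono) auto
  also have "\<dots> \<le> r / 2 ^ k" using pos by (simp add: field_simps)
  finally show ?thesis by (simp add: approx_exp_def funpow_swap1 x_def y_def)
qed

definition coord_exp :: "(nat \<Rightarrow> real) \<Rightarrow> (nat \<Rightarrow> real)" where
  "coord_exp v i = lim (\<lambda>k. approx_exp k v i)"

lemma approx_exp_tendsto:
  assumes v: "v \<in> l1_ball n 0 (r / 4)"
  shows "(\<lambda>k. approx_exp k v i) \<longlonglongrightarrow> coord_exp v i"
proof -
  have vr: "v \<in> l1_ball n 0 (r / 2)" using v pos by (simp add: in_l1_ball_0)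
  have "convergent (\<lambda>k. approx_exp k v i)"
  proof (cases "i < n")
    case False
    then have "approx_exp k v i = 0" for k
      using approx_exp_ball(1)[OF vr, of k] by (simp add: in_l1_ball_0 vecs_def)
    then show ?thesis by (simp add: convergent_const)
  next
    case True
    have "summable (\<lambda>k. r * (1 / 2) ^ k)" by (intro summable_mult summable_geometric) simp
    then have "summable (\<lambda>k. approx_exp (Suc k) v i - approx_exp k v i)"
    proof (rule summable_comparison_test')
      fix k
      show "norm (approx_exp (Suc k) v i - approx_exp k v i) \<le> r * (1 / 2) ^ k"
        using abs_le_l1[OF True, of "approx_exp (Suc k) v - approx_exp k v"] approx_exp_step[OF v, of k]
        by (simp add: power_one_over)
    qed
    then have "convergent (\<lambda>m. (\<Sum>k<m. approx_exp (Suc k) v i - approx_exp k v i))"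
      by (simp add: summable_iff_convergent)
    then have "convergent (\<lambda>m. approx_exp m v i - approx_exp 0 v i)"
      by (simp only: sum_lessThan_telescope[of "\<lambda>k. approx_exp k v i"])
    then show ?thesis by (simp add: convergent_diff_const_right_iff)
  qed
  then show ?thesis by (simp add: coord_exp_def convergent_LIMSEQ_iff)
qed

lemma l1_tendsto:
  assumes "\<And>i. i < n \<Longrightarrow> (\<lambda>k. f k i) \<longlonglongrightarrow> g i"
  shows "(\<lambda>k. l1 n (f k)) \<longlonglongrightarrow> l1 n g"
  unfolding l1_def using assms by (intro tendsto_sum tendsto_rabs) auto

lemma coord_exp_ball:
  assumes v: "v \<in> l1_ball n 0 (r / 4)"
  shows "coord_exp v \<in> l1_ball n 0 r"
proof -
  have vr: "v \<in> l1_ball n 0 (r / 2)" using v pos by (simp add: in_l1_ball_0)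
  have "l1 n (coord_exp v) \<le> 2 * l1 n v"
    by (rule LIMSEQ_le_const2[OF l1_tendsto[OF approx_exp_tendsto[OF v]]])
      (use approx_exp_ball(3)[OF vr] in auto)
  moreover have "coord_exp v \<in> vecs n"
  proof -
    have "coord_exp v i = 0" if "i \<ge> n" for i
    proof -
      have "approx_exp k v i = 0" for k
        using approx_exp_ball(1)[OF vr, of k] that by (simp add: in_l1_ball_0 vecs_def)
      then show ?thesis by (simp add: coord_exp_def)
    qed
    then show ?thesis by (simp add: vecs_def)
  qed
  ultimately show ?thesis using v pos by (simp add: in_l1_ball_0)
qed

text \<open>Both constants are independent of \<open>k\<close> and pass to the limit; the lower one
  makes the limit injective, as invariance of domain requires.\<close>

lemma coord_exp_Lipschitz:
  assumes v: "v \<in> l1_ball n 0 (r / 4)" and w: "w \<in> l1_ball n 0 (r / 4)"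
  shows "l1 n (coord_exp v - coord_exp w) \<le> 2 * l1 n (v - w)"
    "l1 n (v - w) / 2 \<le> l1 n (coord_exp v - coord_exp w)"
proof -
  have vr: "v \<in> l1_ball n 0 (r / 2)" "w \<in> l1_ball n 0 (r / 2)" using v w pos by (simp_all add: in_l1_ball_0)
  have lim: "(\<lambda>k. l1 n (approx_exp k v - approx_exp k w)) \<longlonglongrightarrow> l1 n (coord_exp v - coord_exp w)"
    by (rule l1_tendsto) (simp add: tendsto_diff approx_exp_tendsto v w)
  show "l1 n (coord_exp v - coord_exp w) \<le> 2 * l1 n (v - w)"
    by (rule LIMSEQ_le_const2[OF lim]) (use approx_exp_Lipschitz(1)[OF vr] in auto)
  show "l1 n (v - w) / 2 \<le> l1 n (coord_exp v - coord_exp w)"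
    by (rule LIMSEQ_le_const[OF lim]) (use approx_exp_Lipschitz(2)[OF vr] in auto)
qed

text \<open>Commutativity turns the product of two \<open>2 ^ k\<close>-th powers into the power of
  one product, with coordinates \<open>\<mu> a b\<close>. This differs from \<open>a + b\<close> by
  a term of order \<open>4 ^ (- k)\<close>, which \<open>k\<close> squarings magnify by at most
  \<open>2 * 2 ^ k\<close>.\<close>

lemma approx_exp_add:
  assumes v: "v \<in> l1_ball n 0 (r / 16)" and w: "w \<in> l1_ball n 0 (r / 16)"
  shows "l1 n (\<mu> (approx_exp k v) (approx_exp k w) - approx_exp k (v + w)) \<le> r / 2 ^ k"
proof -
  have vr: "v \<in> l1_ball n 0 (r / 2)" "w \<in> l1_ball n 0 (r / 2)" using v w pos by (simp_all add: in_l1_ball_0)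
  define a b where "a = (1 / 2 ^ k) *\<^sub>R v" and "b = (1 / 2 ^ k) *\<^sub>R w"
  have p2: "(2::real) ^ k \<ge> 1" by simp
  have la: "l1 n a = l1 n v / 2 ^ k" "l1 n b = l1 n w / 2 ^ k" by (simp_all add: a_def b_def)
  have le: "l1 n a \<le> l1 n v" "l1 n b \<le> l1 n w"
    using divide_left_mono[OF p2, of "l1 n v"] divide_left_mono[OF p2, of "l1 n w"] by (simp_all add: la)
  have ab: "a \<in> l1_ball n 0 r" "b \<in> l1_ball n 0 r"
    using le v w pos by (auto simp: in_l1_ball_0) (auto simp: a_def b_def)
  have c: "l1 n (\<mu> a b - (a + b)) \<le> C * l1 n a * l1 n b" by (rule \<mu>_approx[OF ab])
  have "C * l1 n a * l1 n b \<le> 1 * l1 n b" using C_l1_le[OF ab(1)] by (intro mult_right_mono) auto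
  then have lc: "l1 n (\<mu> a b) \<le> 2 * (l1 n a + l1 n b)"
  proof -
    have "l1 n (\<mu> a b - (a + b)) \<le> l1 n b" using order_trans[OF c \<open>_ \<le> 1 * l1 n b\<close>] by simp
    then have "l1 n (\<mu> a b) \<le> l1 n b + (l1 n a + l1 n b)"
      using l1_triangle[of n "\<mu> a b - (a + b)" "a + b", unfolded diff_add_cancel]
        add_mono[OF _ l1_triangle[of n a b]] order_trans by blast
    moreover have "0 \<le> l1 n a" by simp
    ultimately show ?thesis by argo
  qed
  \<comment> \<open>A common bound for both starting points \<open>\<mu> a b\<close> and
    \<open>a + b\<close>, as \<open>sq_iterate_Lipschitz\<close> asks for.\<close>
  define W where "W = 2 * (l1 n v + l1 n w) / 2 ^ k"
  have lcW: "l1 n (\<mu> a b) \<le> W" using lc by (simp add: W_def la field_simps)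
  have labW: "l1 n (a + b) \<le> W"
    using order.trans[OF l1_triangle[of n a b], of W] le by (simp add: W_def la field_simps add_nonneg_nonneg)
  have W: "2 ^ k * W < r / 2" using v w pos by (simp add: W_def in_l1_ball_0)
  have "2 ^ k * l1 n (\<mu> a b) \<le> 2 ^ k * W" using lcW by simp
  then have kc: "2 ^ k * l1 n (\<mu> a b) < r / 2" using W by linarith
  note cc = sq_iterate_ball[OF \<mu>_vecs[OF ab] kc]
  \<comment> \<open>The equality is computed in the group and pulled back to coordinates by
    injectivity of \<open>\<psi>\<close>.\<close>
  have eq: "\<mu> (approx_exp k v) (approx_exp k w) = (sq ^^ k) (\<mu> a b)"
  proof (rule inj_onD[OF \<psi>_inj])
    have "\<psi> (\<mu> (approx_exp k v) (approx_exp k w)) = \<psi> (approx_exp k v) \<otimes> \<psi> (approx_exp k w)"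
      by (intro \<psi>_\<mu> approx_exp_ball vr)
    also have "\<dots> = \<psi> a [^] (2 ^ k :: nat) \<otimes> \<psi> b [^] (2 ^ k :: nat)"
      using approx_exp_ball(2) vr by (simp add: a_def b_def)
    also have "\<dots> = (\<psi> a \<otimes> \<psi> b) [^] (2 ^ k :: nat)"
      using pow_mult_distrib[of "\<psi> a" "\<psi> b" "2 ^ k"] comm \<psi>_carrier small_ball ab by simp
    also have "\<dots> = \<psi> ((sq ^^ k) (\<mu> a b))" using cc(3) \<psi>_\<mu>[OF ab] by simp
    finally show "\<psi> (\<mu> (approx_exp k v) (approx_exp k w)) = \<psi> ((sq ^^ k) (\<mu> a b))" .
  qed (use cc small_ball in \<open>auto intro!: \<mu>_in approx_exp_ball vr\<close>)
  have "l1 n ((sq ^^ k) (\<mu> a b) - (sq ^^ k) (a + b)) \<le> 2 * (2 ^ k * l1 n (\<mu> a b - (a + b)))"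
    using ab by (intro sq_iterate_Lipschitz[OF _ _ lcW labW W] \<mu>_vecs) (auto simp: in_l1_ball_0)
  also have "\<dots> \<le> 2 * (2 ^ k * (C * l1 n a * l1 n b))" using c by simp
  also have "\<dots> = 2 * (C * l1 n v) * l1 n w / 2 ^ k" by (simp add: la)
  also have "\<dots> \<le> 2 * 1 * (r / 2) / 2 ^ k"
  proof -
    have "v \<in> l1_ball n 0 r" using v pos by (simp add: in_l1_ball_0)
    from C_l1_le[OF this] show ?thesis using vr pos
      by (intro divide_right_mono mult_mono) (auto simp: in_l1_ball_0)
  qed
  finally show ?thesis unfolding eq by (simp add: approx_exp_def a_def b_def scaleR_add_right)
qed

lemma coord_exp_add:
  assumes v: "v \<in> l1_ball n 0 (r / 16)" and w: "w \<in> l1_ball n 0 (r / 16)"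
  shows "coord_exp (v + w) = \<mu> (coord_exp v) (coord_exp w)"
proof -
  have vr: "v \<in> l1_ball n 0 (r / 4)" "w \<in> l1_ball n 0 (r / 4)" "v \<in> l1_ball n 0 (r / 2)" "w \<in> l1_ball n 0 (r / 2)"
    using v w pos by (simp_all add: in_l1_ball_0)
  have vw: "v + w \<in> l1_ball n 0 (r / 4)"
    using v w pos l1_triangle[of n v w] by (simp add: in_l1_ball_0)
  let ?d = "\<lambda>x k. l1 n (approx_exp k x - coord_exp x)"
  have lim: "?d x \<longlonglongrightarrow> 0" if "x \<in> l1_ball n 0 (r / 4)" for x
  proof -
    have "?d x \<longlonglongrightarrow> l1 n (coord_exp x - coord_exp x)"
      unfolding fun_diff_def by (intro l1_tendsto tendsto_diff approx_exp_tendsto that tendsto_const)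
    then show ?thesis by simp
  qed
  have "l1 n (coord_exp (v + w) - \<mu> (coord_exp v) (coord_exp w)) \<le> ?d (v + w) k + r * (1 / 2) ^ k + (2 * ?d v k + 2 * ?d w k)" for k
  proof -
    have "l1 n (\<mu> (approx_exp k v) (approx_exp k w) - \<mu> (coord_exp v) (coord_exp w)) \<le> 2 * ?d v k + 2 * ?d w k"
      by (intro \<mu>_Lipschitz approx_exp_ball coord_exp_ball vr)
    moreover note approx_exp_add[OF v w, of k]
    moreover note l1_triangle_diff[of n "coord_exp (v + w)" "\<mu> (coord_exp v) (coord_exp w)" "approx_exp k (v + w)"]
    moreover note l1_triangle_diff[of n "approx_exp k (v + w)" "\<mu> (coord_exp v) (coord_exp w)" "\<mu> (approx_exp k v) (approx_exp k w)"]
    ultimately show ?thesis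
      by (simp add: power_one_over l1_minus_commute[of n "approx_exp k (v + w)" "\<mu> (approx_exp k v) (approx_exp k w)"]
        l1_minus_commute[of n "coord_exp (v + w)" "approx_exp k (v + w)"])
  qed
  moreover have "(\<lambda>k. ?d (v + w) k + r * (1 / 2) ^ k + (2 * ?d v k + 2 * ?d w k)) \<longlonglongrightarrow> 0 + r * 0 + (2 * 0 + 2 * 0)"
    by (intro tendsto_intros lim vw vr LIMSEQ_power_zero) simp
  ultimately have "l1 n (coord_exp (v + w) - \<mu> (coord_exp v) (coord_exp w)) \<le> 0"
    using LIMSEQ_le_const[where a = "l1 n (coord_exp (v + w) - \<mu> (coord_exp v) (coord_exp w))"] by fastforce
  then have "l1 n (coord_exp (v + w) - \<mu> (coord_exp v) (coord_exp w)) = 0"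
    by (meson l1_nonneg order_antisym)
  moreover have "coord_exp (v + w) - \<mu> (coord_exp v) (coord_exp w) \<in> vecs n"
    using coord_exp_ball[OF vw] \<mu>_vecs[OF coord_exp_ball coord_exp_ball, OF vr(1,2)] by (auto simp: in_l1_ball_0)
  ultimately show ?thesis using l1_eq_0 by fastforce
qed

text \<open>Openness comes from invariance of domain, applied to the continuous injective map
  \<open>coord_exp\<close>. The radius \<open>r / 16\<close> is the one for which
  \<open>coord_exp_add\<close> controls sums.\<close>

theorem local_exponential:
  "\<exists>e \<rho>. \<rho> > 0 \<and> continuous_map (subtopology (Euclidean_space n) (l1_ball n 0 \<rho>)) X e \<and>
    inj_on e (l1_ball n 0 \<rho>) \<and>
    (\<forall>S. openin (Euclidean_space n) S \<and> S \<subseteq> l1_ball n 0 \<rho> \<longrightarrow> openin X (e ` S)) \<and>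
    (\<forall>v\<in>l1_ball n 0 \<rho>. \<forall>w\<in>l1_ball n 0 \<rho>. e (v + w) = e v \<otimes> e w)"
proof (intro exI conjI allI ballI impI)
  let ?B = "l1_ball n 0 (r / 16)"
  let ?e = "\<psi> \<circ> coord_exp"
  show "r / 16 > 0" using pos by simp
  have small: "v \<in> l1_ball n 0 (r / 4)" if "v \<in> ?B" for v using that pos by (simp add: in_l1_ball_0)
  have cont: "continuous_map (subtopology (Euclidean_space n) ?B) (Euclidean_space n) coord_exp"
    using coord_exp_Lipschitz(1)[OF small small] coord_exp_ball[OF small]
    by (intro continuous_map_Euclidean_Lipschitz[where K = 2]) (auto simp: in_l1_ball_0)
  have into: "coord_exp v \<in> l1_ball n 0 \<delta>" if "v \<in> ?B" for v
    using coord_exp_ball[OF small[OF that]] small_ball by blast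
  then have "continuous_map (subtopology (Euclidean_space n) ?B) (subtopology (Euclidean_space n) (l1_ball n 0 \<delta>)) coord_exp"
    using cont by (auto simp: continuous_map_in_subtopology)
  from continuous_map_compose[OF this \<psi>_cont]
  show "continuous_map (subtopology (Euclidean_space n) ?B) X ?e" .
  have inj: "inj_on coord_exp ?B"
  proof (rule inj_onI)
    fix v w assume vw: "v \<in> ?B" "w \<in> ?B" "coord_exp v = coord_exp w"
    then have "l1 n (v - w) \<le> 0" using coord_exp_Lipschitz(2)[OF small small, of v w] by simp
    then have "l1 n (v - w) = 0" by (meson l1_nonneg order_antisym)
    then show "v = w" using l1_eq_0[of "v - w" n] vw by (auto simp: in_l1_ball_0)
  qed
  show "inj_on ?e ?B"
    using inj \<psi>_inj into by (auto intro!: comp_inj_on inj_on_subset[OF \<psi>_inj])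
  show "openin X (?e ` S)" if S: "openin (Euclidean_space n) S \<and> S \<subseteq> ?B" for S
  proof -
    have "openin (Euclidean_space n) (coord_exp ` S)"
      using S inj cont
      by (intro invariance_of_domain_Euclidean_space)
        (auto intro: inj_on_subset continuous_map_from_subtopology_mono)
    moreover have "coord_exp ` S \<subseteq> l1_ball n 0 \<delta>" using S into by blast
    ultimately show ?thesis using \<psi>_open by (simp only: image_comp[symmetric])
  qed
  show "?e (v + w) = ?e v \<otimes> ?e w" if "v \<in> ?B" "w \<in> ?B" for v w
    using coord_exp_add[OF that] \<psi>_\<mu> coord_exp_ball small that by simp
qed

end


text \<open>After this locale is established the original atlas no longer appears; the Hausdorff
  property and second countability are passed on separately, to \<open>lie_group_torus\<close>. The
  last axiom says that the kernel is discrete.\<close>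

locale exponential_cover = topological_group G X for G (structure) and X +
  fixes n :: nat and E :: "(nat \<Rightarrow> real) \<Rightarrow> 'a"
  assumes comm: "a \<in> carrier G \<Longrightarrow> b \<in> carrier G \<Longrightarrow> a \<otimes> b = b \<otimes> a"
    and E_cont: "continuous_map (Euclidean_space n) X E"
    and E_add: "x \<in> vecs n \<Longrightarrow> y \<in> vecs n \<Longrightarrow> E (x + y) = E x \<otimes> E y"
    and E_surj: "E ` vecs n = carrier G"
    and E_open: "openin (Euclidean_space n) S \<Longrightarrow> openin X (E ` S)"
    and E_discrete: "\<exists>\<epsilon>>0. \<forall>x\<in>vecs n. l1 n x < \<epsilon> \<longrightarrow> E x = \<one> \<longrightarrow> x = 0"

section \<open>From a local to a global homomorphism\<close>

lemma (in topological_group) continuous_map_mult: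
  assumes "continuous_map Y X f" "continuous_map Y X g"
  shows "continuous_map Y X (\<lambda>y. f y \<otimes> g y)"
proof -
  have "continuous_map Y (prod_topology X X) (\<lambda>y. (f y, g y))"
    using assms by (simp add: continuous_map_pairedI)
  from continuous_map_compose[OF this continuous_mult] show ?thesis by (simp add: o_def)
qed

lemma (in topological_group) continuous_map_pow:
  assumes "continuous_map Y X f"
  shows "continuous_map Y X (\<lambda>y. f y [^] (k::nat))"
proof (induction k)
  case 0
  then show ?case by (simp add: topspace_eq)
next
  case (Suc k)
  then show ?case by (simp add: continuous_map_mult assms)
qed

lemma (in topological_group) openin_left_translate:
  assumes a: "a \<in> carrier G" and S: "openin X S"
  shows "openin X ((\<lambda>x. a \<otimes> x) ` S)"
proof -
  have SG: "S \<subseteq> carrier G" using openin_subset[OF S] by (simp add: topspace_eq)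
  have "continuous_map X X (\<lambda>x. inv a \<otimes> x)"
    using a by (intro continuous_map_mult) (auto simp: topspace_eq)
  from openin_continuous_map_preimage[OF this S]
  have "openin X {x \<in> carrier G. inv a \<otimes> x \<in> S}" by (simp add: topspace_eq)
  moreover have "{x \<in> carrier G. inv a \<otimes> x \<in> S} = (\<lambda>x. a \<otimes> x) ` S"
  proof safe
    fix x assume "x \<in> carrier G" "inv a \<otimes> x \<in> S"
    then show "x \<in> (\<lambda>x. a \<otimes> x) ` S"
      using a by (intro image_eqI[of _ _ "inv a \<otimes> x"]) (simp_all flip: m_assoc)
  next
    fix x assume "x \<in> S"
    then show "a \<otimes> x \<in> carrier G" "inv a \<otimes> (a \<otimes> x) \<in> S"
      using a SG by (auto simp flip: m_assoc)
  qed
  ultimately show ?thesis by simp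
qed

text \<open>The complement is a union of cosets, which are open, so an open subgroup is also
  closed.\<close>

lemma (in topological_group) open_subgroup_eq_carrier:
  assumes conn: "connected_space X" and H: "subgroup H G" and o: "openin X H"
  shows "H = carrier G"
proof -
  have HG: "H \<subseteq> carrier G" using H by (rule subgroup.subset)
  have "openin X (carrier G - H)"
  proof (subst openin_subopen, intro ballI)
    fix y assume y: "y \<in> carrier G - H"
    have "(\<lambda>x. y \<otimes> x) ` H \<subseteq> carrier G - H"
    proof
      fix z assume "z \<in> (\<lambda>x. y \<otimes> x) ` H"
      then obtain h where h: "h \<in> H" "z = y \<otimes> h" by blast
      have "z \<notin> H"
      proof
        assume "z \<in> H"
        then have "z \<otimes> inv h \<in> H" using h H by (simp add: subgroup.m_closed subgroup.m_inv_closed)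
        moreover have "z \<otimes> inv h = y" using h y HG by (auto simp: m_assoc)
        ultimately show False using y by simp
      qed
      then show "z \<in> carrier G - H" using h y HG by auto
    qed
    moreover have "y \<in> (\<lambda>x. y \<otimes> x) ` H"
      using y subgroup.one_closed[OF H] by (intro image_eqI[of _ _ \<one>]) auto
    moreover have "openin X ((\<lambda>x. y \<otimes> x) ` H)" using y o by (intro openin_left_translate) auto
    ultimately show "\<exists>T. openin X T \<and> y \<in> T \<and> T \<subseteq> carrier G - H" by blast
  qed
  then have "closedin X H" using HG by (simp add: closedin_def topspace_eq)
  then have "H = {} \<or> H = topspace X" using conn o by (simp add: connected_space_clopen_in)
  then show ?thesis using subgroup.one_closed[OF H] by (auto simp: topspace_eq)
qed

text \<open>Every vector becomes short after enough halvings, so \<open>E v\<close> can be the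
  \<open>2 ^ k\<close>-th power of \<open>e\<close> at \<open>v / 2 ^ k\<close>; additivity of
  \<open>e\<close> makes the value independent of \<open>k\<close>. The image of \<open>E\<close> is
  an open subgroup, hence everything by connectedness, and injectivity of \<open>e\<close> makes the
  kernel discrete.\<close>

lemma (in topological_group) extend_local_exponential:
  fixes e :: "(nat \<Rightarrow> real) \<Rightarrow> 'a"
  assumes comm: "\<And>a b. a \<in> carrier G \<Longrightarrow> b \<in> carrier G \<Longrightarrow> a \<otimes> b = b \<otimes> a"
    and conn: "connected_space X" and \<rho>: "\<rho> > 0"
    and cont: "continuous_map (subtopology (Euclidean_space n) (l1_ball n 0 \<rho>)) X e"
    and inj: "inj_on e (l1_ball n 0 \<rho>)"
    and opn: "\<And>S. openin (Euclidean_space n) S \<Longrightarrow> S \<subseteq> l1_ball n 0 \<rho> \<Longrightarrow> openin X (e ` S)"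
    and add: "\<And>v w. v \<in> l1_ball n 0 \<rho> \<Longrightarrow> w \<in> l1_ball n 0 \<rho> \<Longrightarrow> e (v + w) = e v \<otimes> e w"
  shows "\<exists>E. exponential_cover G X n E"
proof -
  have eG: "e v \<in> carrier G" if "v \<in> l1_ball n 0 \<rho>" for v
    using continuous_map_funspace[OF cont] that by (auto simp: topspace_eq in_l1_ball_0)
  define h where "h k v = e ((1 / 2 ^ k) *\<^sub>R v) [^] (2 ^ k :: nat)" for k :: nat and v
  have in_iff: "(1 / 2 ^ k) *\<^sub>R v \<in> l1_ball n 0 \<rho> \<longleftrightarrow> l1 n v < 2 ^ k * \<rho>" if "v \<in> vecs n" for k v
    using that by (simp add: in_l1_ball_0 field_simps)
  have h_Suc: "h (Suc k) v = h k v" if v: "v \<in> vecs n" "l1 n v < 2 ^ k * \<rho>" for k v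
  proof -
    let ?w = "(1 / 2 ^ Suc k) *\<^sub>R v"
    have "2 ^ k * \<rho> \<le> 2 ^ Suc k * \<rho>" using \<rho> by simp
    then have "l1 n v < 2 ^ Suc k * \<rho>" using v(2) by linarith
    then have w: "?w \<in> l1_ball n 0 \<rho>" using in_iff[OF v(1), of "Suc k"] by blast
    have "?w + ?w = (1 / 2 ^ k) *\<^sub>R v" by (simp flip: scaleR_add_left)
    then have "e ((1 / 2 ^ k) *\<^sub>R v) = e ?w [^] (2::nat)"
      using add[OF w w] eG[OF w] by (simp add: numeral_2_eq_2)
    then show ?thesis using eG[OF w] by (simp add: h_def nat_pow_pow)
  qed
  have h_eq: "h (k + m) v = h k v" if v: "v \<in> vecs n" "l1 n v < 2 ^ k * \<rho>" for k m v
  proof (induction m)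
    case (Suc m)
    have "2 ^ k * \<rho> \<le> 2 ^ (k + m) * \<rho>" using \<rho> by (intro mult_right_mono power_increasing) auto
    then show ?case using h_Suc[OF v(1), of "k + m"] v(2) Suc by simp
  qed simp
  have big: "\<exists>k. t < 2 ^ k * \<rho>" for t
    using real_arch_pow[of 2 "t / \<rho>"] \<rho> by (auto simp: pos_divide_less_eq)
  define E where "E v = h (SOME k. l1 n v < 2 ^ k * \<rho>) v" for v
  have E: "E v = h k v" if v: "v \<in> vecs n" "l1 n v < 2 ^ k * \<rho>" for k v
  proof -
    define j where "j = (SOME k. l1 n v < 2 ^ k * \<rho>)"
    have j: "l1 n v < 2 ^ j * \<rho>" unfolding j_def by (rule someI[of _ k]) (rule v)
    have "h j v = h k v"
      using h_eq[OF v(1) j, of "k - j"] h_eq[OF v, of "j - k"] by (cases "j \<le> k") auto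
    then show ?thesis by (simp add: E_def j_def)
  qed
  have E_e: "E v = e v" if "v \<in> l1_ball n 0 \<rho>" for v
    using E[of v 0] that eG[OF that] by (simp add: h_def in_l1_ball_0)
  have EG: "E v \<in> carrier G" if "v \<in> vecs n" for v
  proof -
    obtain k where k: "l1 n v < 2 ^ k * \<rho>" using big by blast
    then show ?thesis using E[OF that k] eG in_iff[OF that, of k] by (simp add: h_def)
  qed
  have E_add: "E (v + w) = E v \<otimes> E w" if v: "v \<in> vecs n" and w: "w \<in> vecs n" for v w
  proof -
    \<comment> \<open>One exponent that serves \<open>v\<close>, \<open>w\<close> and
      \<open>v + w\<close> together.\<close>
    obtain k where k: "l1 n v + l1 n w < 2 ^ k * \<rho>" using big by blast
    have kk: "l1 n v < 2 ^ k * \<rho>" "l1 n w < 2 ^ k * \<rho>" "l1 n (v + w) < 2 ^ k * \<rho>"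
      using k l1_nonneg[of n v] l1_nonneg[of n w] l1_triangle[of n v w] by linarith+
    have in_B: "(1 / 2 ^ k) *\<^sub>R v \<in> l1_ball n 0 \<rho>" "(1 / 2 ^ k) *\<^sub>R w \<in> l1_ball n 0 \<rho>"
      using in_iff v w kk by auto
    have "E (v + w) = (e ((1 / 2 ^ k) *\<^sub>R v) \<otimes> e ((1 / 2 ^ k) *\<^sub>R w)) [^] (2 ^ k :: nat)"
      using E[of "v + w" k] v w kk add[OF in_B] by (simp add: h_def scaleR_add_right)
    also have "\<dots> = h k v \<otimes> h k w"
      using pow_mult_distrib[of "e ((1 / 2 ^ k) *\<^sub>R v)" "e ((1 / 2 ^ k) *\<^sub>R w)"] eG in_B comm
      by (simp add: h_def)
    finally show ?thesis using E v w kk by simp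
  qed
  have E0: "E 0 = \<one>"
  proof -
    have "E 0 \<otimes> E 0 = E 0 \<otimes> \<one>" using E_add[of 0 0] EG[of 0] by simp
    then show ?thesis using EG[of 0] by (simp del: r_one)
  qed
  have hcont: "continuous_map (subtopology (Euclidean_space n) (l1_ball n 0 (2 ^ k * \<rho>))) X (h k)" for k
  proof -
    have "continuous_map (subtopology (Euclidean_space n) (l1_ball n 0 (2 ^ k * \<rho>))) (Euclidean_space n) (\<lambda>v. (1 / 2 ^ k) *\<^sub>R v)"
      by (rule continuous_map_Euclidean_Lipschitz[where K = "1 / 2 ^ k"])
        (auto simp: in_l1_ball_0 simp flip: scaleR_diff_right)
    then have "continuous_map (subtopology (Euclidean_space n) (l1_ball n 0 (2 ^ k * \<rho>)))
        (subtopology (Euclidean_space n) (l1_ball n 0 \<rho>)) (\<lambda>v. (1 / 2 ^ k) *\<^sub>R v)"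
      using in_iff by (auto simp: continuous_map_in_subtopology in_l1_ball_0[of _ n "2 ^ k * \<rho>"])
    from continuous_map_compose[OF this cont]
    have "continuous_map (subtopology (Euclidean_space n) (l1_ball n 0 (2 ^ k * \<rho>))) X (\<lambda>v. e ((1 / 2 ^ k) *\<^sub>R v))"
      by (simp add: o_def)
    then show ?thesis unfolding h_def[abs_def] by (rule continuous_map_pow)
  qed
  have E_cont: "continuous_map (Euclidean_space n) X E"
    unfolding continuous_map_def
  proof (intro conjI allI impI)
    show "E \<in> topspace (Euclidean_space n) \<rightarrow> topspace X" using EG by (auto simp: topspace_eq)
    fix W assume W: "openin X W"
    show "openin (Euclidean_space n) {x \<in> topspace (Euclidean_space n). E x \<in> W}"
    proof (subst openin_subopen, intro ballI)
      fix v assume "v \<in> {x \<in> topspace (Euclidean_space n). E x \<in> W}"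
      then have v: "v \<in> vecs n" "E v \<in> W" by auto
      obtain k where k: "l1 n v < 2 ^ k * \<rho>" using big by blast
      let ?B = "l1_ball n 0 (2 ^ k * \<rho>)"
      have "openin (subtopology (Euclidean_space n) ?B) {x \<in> topspace (subtopology (Euclidean_space n) ?B). h k x \<in> W}"
        by (rule openin_continuous_map_preimage[OF hcont W])
      then have "openin (Euclidean_space n) {x \<in> topspace (subtopology (Euclidean_space n) ?B). h k x \<in> W}"
        using openin_l1_ball openin_trans_full by blast
      moreover have "{x \<in> topspace (subtopology (Euclidean_space n) ?B). h k x \<in> W} = {x \<in> ?B. E x \<in> W}"
        using E by (auto simp: in_l1_ball_0)
      ultimately show "\<exists>T. openin (Euclidean_space n) T \<and> v \<in> T \<and> T \<subseteq> {x \<in> topspace (Euclidean_space n). E x \<in> W}"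
        using v k by (intro exI[of _ "{x \<in> ?B. E x \<in> W}"]) (auto simp: in_l1_ball_0)
    qed
  qed
  have E_open: "openin X (E ` S)" if S: "openin (Euclidean_space n) S" for S
  proof (subst openin_subopen, intro ballI)
    fix y assume "y \<in> E ` S"
    then obtain v where v: "v \<in> S" "y = E v" by blast
    have vv: "v \<in> vecs n" using v S openin_subset by fastforce
    obtain d where d: "d > 0" "l1_ball n v d \<subseteq> S" using S v openin_Euclidean_iff by blast
    let ?B = "l1_ball n 0 (min d \<rho>)"
    have sub: "?B \<subseteq> l1_ball n 0 \<rho>" by (auto simp: in_l1_ball_0)
    \<comment> \<open>Near \<open>v\<close> the map \<open>E\<close> is the translate by
      \<open>E v\<close> of the open map \<open>e\<close> near 0.\<close>
    have "openin X ((\<lambda>x. E v \<otimes> x) ` (e ` ?B))"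
      by (intro openin_left_translate EG vv opn openin_l1_ball sub)
    moreover have "(\<lambda>x. E v \<otimes> x) ` (e ` ?B) \<subseteq> E ` S"
    proof clarify
      fix w assume w: "w \<in> ?B"
      then have "E v \<otimes> e w = E (v + w)" using E_add[OF vv, of w] E_e[of w] sub by (auto simp: in_l1_ball_0)
      moreover have "v + w \<in> S" using w vv d by (auto simp: l1_ball_def)
      ultimately show "E v \<otimes> e w \<in> E ` S" by simp
    qed
    moreover have "y \<in> (\<lambda>x. E v \<otimes> x) ` (e ` ?B)"
    proof (intro image_eqI)
      show "y = E v \<otimes> E 0" using v E0 EG[OF vv] by simp
      show "E 0 = e 0" by (rule E_e) (use \<rho> in \<open>simp add: in_l1_ball_0\<close>)
      show "0 \<in> ?B" using d \<rho> by (simp add: in_l1_ball_0)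
    qed
    ultimately show "\<exists>T. openin X T \<and> y \<in> T \<and> T \<subseteq> E ` S" by blast
  qed
  have "subgroup (E ` vecs n) G"
  proof (rule subgroupI)
    show "inv a \<in> E ` vecs n" if a: "a \<in> E ` vecs n" for a
    proof -
      obtain v where v: "v \<in> vecs n" "a = E v" using a by auto
      have "E (- v) \<otimes> E v = \<one>" using E_add[of "- v" v] v E0 by simp
      then have "inv a = E (- v)" using v EG by (intro inv_equality) auto
      then show ?thesis using v by simp
    qed
    show "a \<otimes> b \<in> E ` vecs n" if ab: "a \<in> E ` vecs n" "b \<in> E ` vecs n" for a b
    proof -
      obtain v w where "v \<in> vecs n" "w \<in> vecs n" "a = E v" "b = E w" using ab by auto
      then show ?thesis using E_add[of v w] by (intro image_eqI[of _ E "v + w"]) auto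
    qed
  qed (use EG vecs_0[of n] in \<open>auto simp del: vecs_0\<close>)
  moreover have "openin X (E ` vecs n)" using E_open[OF openin_topspace[of "Euclidean_space n"]] by simp
  ultimately have E_surj: "E ` vecs n = carrier G" using open_subgroup_eq_carrier[OF conn] by blast
  have "x = 0" if "x \<in> vecs n" "l1 n x < \<rho>" "E x = \<one>" for x
    using inj
  proof (rule inj_onD)
    show "e x = e 0" using that E_e[of x] E_e[of 0] E0 \<rho> by (simp add: in_l1_ball_0)
  qed (use that \<rho> in \<open>auto simp: in_l1_ball_0\<close>)
  then have "exponential_cover G X n E"
    by unfold_locales (use comm E_cont E_add E_surj E_open \<rho> in auto)
  then show ?thesis by blast
qed

theorem (in lie_group) exists_exponential_cover:
  assumes "comm_group G" "connected_space X"
  shows "\<exists>E. exponential_cover G X n E"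
proof -
  obtain \<psi> \<mu> \<delta> r C where "local_coordinates G X n \<psi> \<mu> \<delta> r C"
    using exists_local_coordinates[OF assms(1)] by blast
  then interpret L: local_coordinates G X n \<psi> \<mu> \<delta> r C .
  from L.local_exponential show ?thesis
    by (elim exE conjE) (rule extend_local_exponential[OF L.comm assms(2)], assumption+, auto)
qed


section \<open>The kernel of the exponential map\<close>

context exponential_cover
begin

definition ker :: "(nat \<Rightarrow> real) set" where
  "ker = {x \<in> vecs n. E x = \<one>}"

lemma E_carrier: "x \<in> vecs n \<Longrightarrow> E x \<in> carrier G"
  using E_surj by blast

lemma E_0: "E 0 = \<one>"
proof -
  have "E 0 \<otimes> E 0 = E 0 \<otimes> \<one>" using E_add[of 0 0] E_carrier[of 0] by simp
  then show ?thesis using E_carrier[of 0] by (simp del: r_one)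
qed

lemma E_minus: "x \<in> vecs n \<Longrightarrow> E (- x) = inv (E x)"
  using E_add[of "- x" x] E_0 E_carrier by (intro inv_equality[symmetric]) auto

lemma E_diff: "x \<in> vecs n \<Longrightarrow> y \<in> vecs n \<Longrightarrow> E (x - y) = E x \<otimes> inv (E y)"
  using E_add[of x "- y"] E_minus[of y] by simp

lemma E_eq_iff: "x \<in> vecs n \<Longrightarrow> y \<in> vecs n \<Longrightarrow> E x = E y \<longleftrightarrow> x - y \<in> ker"
  using inv_equality[of "E x" "inv (E y)"] E_carrier[of x] E_carrier[of y] by (auto simp: ker_def E_diff)

lemma ker_vecs: "x \<in> ker \<Longrightarrow> x \<in> vecs n"
  by (simp add: ker_def)

lemma additive_subgroup_ker: "additive_subgroup ker"
  by (auto simp: additive_subgroup_def ker_def E_0 E_diff)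

lemma E_scaleR_nat: "x \<in> vecs n \<Longrightarrow> E (of_nat k *\<^sub>R x) = E x [^] k"
  by (induction k) (auto simp: E_0 E_add scaleR_add_left E_carrier comm)

end

section \<open>Unit vectors, the normalized kernel and the size of independent sets\<close>

definition unit_vec :: "nat \<Rightarrow> nat \<Rightarrow> real" where
  "unit_vec i = (\<lambda>j. if j = i then 1 else 0)"

text \<open>The number \<open>b\<close> is the rank of the kernel. The kernel contains all integral
  points of \<open>vecs b\<close> and may be larger, since a basis chosen inside it spans it over
  the reals but perhaps not over the integers.\<close>

locale normalized_cover = exponential_cover +
  fixes b :: nat
  assumes b_le: "b \<le> n"
    and unit_vec_ker: "i < b \<Longrightarrow> unit_vec i \<in> ker"
    and ker_coords: "x \<in> ker \<Longrightarrow> b \<le> i \<Longrightarrow> x i = 0"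

lemma unit_vec_vecs: "i < n \<Longrightarrow> unit_vec i \<in> vecs n"
  by (auto simp: unit_vec_def vecs_def)

lemma vecs_expand: "x \<in> vecs n \<Longrightarrow> x = (\<Sum>i<n. x i *\<^sub>R unit_vec i)"
  by (auto simp: fun_eq_iff sum_fun_apply unit_vec_def vecs_def if_distrib[of "\<lambda>t. _ * t"] not_less cong: if_cong)

lemma inj_unit_vec: "inj unit_vec"
  by (rule injI) (metis unit_vec_def zero_neq_one)

lemma independent_unit_vecs: "independent (unit_vec ` {..<n})"
proof (rule independent_if_scalars_zero)
  fix f x assume s: "(\<Sum>x\<in>unit_vec ` {..<n}. f x *\<^sub>R x) = 0" and x: "x \<in> unit_vec ` {..<n}"
  then obtain j where j: "j < n" "x = unit_vec j" by auto
  have "(\<Sum>i<n. f (unit_vec i) *\<^sub>R unit_vec i) = 0"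
    using s inj_unit_vec by (subst (asm) sum.reindex) (auto intro: inj_on_subset)
  then have "(\<Sum>i<n. f (unit_vec i) *\<^sub>R unit_vec i) j = 0" by simp
  then show "f x = 0" using j
    by (simp add: sum_fun_apply unit_vec_def if_distrib[of "\<lambda>t. _ * t"] cong: if_cong)
qed auto

lemma span_unit_vecs: "span (unit_vec ` {..<n}) = vecs n"
proof
  show "span (unit_vec ` {..<n}) \<subseteq> vecs n"
    by (rule span_minimal) (auto intro: unit_vec_vecs subspace_vecs)
  show "vecs n \<subseteq> span (unit_vec ` {..<n})"
  proof
    fix x assume "x \<in> vecs n"
    then have "x = (\<Sum>i<n. x i *\<^sub>R unit_vec i)" by (rule vecs_expand)
    also have "\<dots> \<in> span (unit_vec ` {..<n})" by (intro span_sum span_scale span_base) auto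
    finally show "x \<in> span (unit_vec ` {..<n})" .
  qed
qed

lemma independent_vecs_card:
  assumes "independent S" "S \<subseteq> vecs n"
  shows "finite S" "card S \<le> n"
proof -
  have "finite S \<and> card S \<le> card (unit_vec ` {..<n})"
    using assms by (intro independent_span_bound) (auto simp: span_unit_vecs)
  then show "finite S" "card S \<le> n" using card_image_le[of "{..<n}" unit_vec] by auto
qed

lemma basis_vecs_card:
  assumes "independent S" "S \<subseteq> vecs n" "vecs n \<subseteq> span S"
  shows "card S = n"
proof -
  have "card (unit_vec ` {..<n}) \<le> card S"
    using independent_span_bound[OF independent_vecs_card(1)[OF assms(1,2)] independent_unit_vecs[of n]]
      assms(3) unit_vec_vecs by auto
  moreover have "card (unit_vec ` {..<n}) = n"
    using inj_unit_vec by (simp add: card_image inj_on_subset)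
  ultimately show ?thesis using independent_vecs_card[OF assms(1,2)] by simp
qed

text \<open>
  Change of coordinates: a basis of the span of the kernel, chosen inside the kernel, becomes the
  first \<open>b\<close> unit vectors.
\<close>

theorem (in exponential_cover) exists_normalized_cover:
  "\<exists>F b. normalized_cover G X n F b"
proof -
  obtain B where B: "B \<subseteq> ker" "independent B" "ker \<subseteq> span B"
    using maximal_independent_subset by blast
  have Bv: "B \<subseteq> vecs n" using B(1) ker_vecs by blast
  obtain B' where B': "B \<subseteq> B'" "B' \<subseteq> vecs n" "independent B'" "vecs n \<subseteq> span B'"
    using maximal_independent_subset_extend[OF Bv B(2)] by blast
  have fB': "finite B'" and cB': "card B' = n"
    using independent_vecs_card basis_vecs_card B' by auto
  define b where "b = card B"
  have fB: "finite B" using fB' B'(1) finite_subset by blast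
  have bn: "b \<le> n" using card_mono[OF fB' B'(1)] by (simp add: b_def cB')
  obtain \<beta>1 where \<beta>1: "bij_betw \<beta>1 {..<b} B"
    using fB by (metis b_def ex_bij_betw_nat_finite lessThan_atLeast0)
  obtain \<beta>2 where \<beta>2: "bij_betw \<beta>2 {b..<n} (B' - B)"
  proof -
    have "card (B' - B) = card {b..<n}" using fB B'(1) by (simp add: card_Diff_subset b_def cB')
    then show ?thesis using that finite_same_card_bij[of "{b..<n}" "B' - B"] fB' by auto
  qed
  \<comment> \<open>The first \<open>b\<close> positions enumerate \<open>B\<close>, so that vectors
    of \<open>span B\<close> are those without coordinates beyond \<open>b\<close>.\<close>
  define \<beta> where "\<beta> i = (if i < b then \<beta>1 i else \<beta>2 i)" for i
  have \<beta>B: "bij_betw \<beta> {..<b} B"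
    using \<beta>1 by (rule iffD1[OF bij_betw_cong, rotated]) (simp add: \<beta>_def)
  have \<beta>R: "bij_betw \<beta> {b..<n} (B' - B)"
    using \<beta>2 by (rule iffD1[OF bij_betw_cong, rotated]) (simp add: \<beta>_def)
  have "bij_betw \<beta> ({..<b} \<union> {b..<n}) (B \<union> (B' - B))"
    by (rule bij_betw_combine[OF \<beta>B \<beta>R]) auto
  moreover have "{..<b} \<union> {b..<n} = {..<n}" "B \<union> (B' - B) = B'" using bn B'(1) by auto
  ultimately have \<beta>: "bij_betw \<beta> {..<n} B'" by simp
  have \<beta>v: "\<beta> i \<in> vecs n" if "i < n" for i using bij_betwE[OF \<beta>] that B'(2) by auto
  define L where "L x = (\<Sum>i<n. x i *\<^sub>R \<beta> i)" for x :: "nat \<Rightarrow> real"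
  have Lv: "L x \<in> vecs n" for x
    unfolding L_def using \<beta>v by (intro subspace_sum[OF subspace_vecs]) auto
  have L_add: "L (x + y) = L x + L y" and L_diff: "L (x - y) = L x - L y" for x y
    by (simp_all add: L_def scaleR_add_left scaleR_diff_left sum.distrib sum_subtractf)
  have L0: "L 0 = 0" by (simp add: L_def)
  have L_zero: "x i = 0" if "L x = 0" "i < n" for x i
  proof -
    have "(\<Sum>v\<in>B'. x (the_inv_into {..<n} \<beta> v) *\<^sub>R v) = L x"
      unfolding L_def using \<beta>
      by (intro sum.reindex_bij_betw[OF \<beta>, symmetric, THEN trans] sum.cong) (auto simp: the_inv_into_f_f bij_betw_def)
    then have "x (the_inv_into {..<n} \<beta> (\<beta> i)) = 0"
      using that B'(3) fB' bij_betwE[OF \<beta>] by (intro independentD[OF B'(3) fB' order_refl]) auto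
    then show ?thesis using \<beta> that by (simp add: the_inv_into_f_f bij_betw_def)
  qed
  have L_inj: "inj_on L (vecs n)"
  proof (rule inj_onI)
    fix x y assume xy: "x \<in> vecs n" "y \<in> vecs n" "L x = L y"
    then have "(x - y) i = 0" for i
      using L_zero[of "x - y" i] by (cases "i < n") (auto simp: L_diff vecs_def)
    then show "x = y" by (simp add: fun_eq_iff)
  qed
  \<comment> \<open>The second conjunct is what later gives \<open>ker_coords\<close>, because the
    kernel lies in \<open>span B\<close>.\<close>
  have L_surj: "\<exists>x\<in>vecs n. L x = y \<and> (y \<in> span B \<longrightarrow> (\<forall>i\<ge>b. x i = 0))" if y: "y \<in> vecs n" for y
  proof -
    have *: "\<exists>u. y = (\<Sum>v\<in>B''. u v *\<^sub>R v)" if "finite B''" "y \<in> span B''" for B''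
      using that span_finite by auto
    have "\<exists>u. y = (\<Sum>v\<in>B'. u v *\<^sub>R v) \<and> (y \<in> span B \<longrightarrow> (\<forall>v\<in>B' - B. u v = 0))"
    proof (cases "y \<in> span B")
      case True
      then obtain u where u: "y = (\<Sum>v\<in>B. u v *\<^sub>R v)" using *[OF fB] by blast
      have "y = (\<Sum>v\<in>B'. (if v \<in> B then u v else 0) *\<^sub>R v)"
        unfolding u using B'(1) fB' by (intro sum.mono_neutral_cong_left) auto
      then show ?thesis by (intro exI[of _ "\<lambda>v. if v \<in> B then u v else 0"]) auto
    next
      case False
      then show ?thesis using *[OF fB'] B'(4) y by blast
    qed
    then obtain u where u: "y = (\<Sum>v\<in>B'. u v *\<^sub>R v)" "y \<in> span B \<Longrightarrow> \<forall>v\<in>B' - B. u v = 0" by blast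
    define x where "x i = (if i < n then u (\<beta> i) else 0)" for i
    have "L x = (\<Sum>i<n. u (\<beta> i) *\<^sub>R \<beta> i)" by (simp add: L_def x_def)
    also have "\<dots> = y" unfolding u(1) by (rule sum.reindex_bij_betw[OF \<beta>])
    finally have "L x = y" .
    moreover have "x i = 0" if "y \<in> span B" "i \<ge> b" for i
      using u(2)[OF that(1)] bij_betwE[OF \<beta>R] that(2) by (auto simp: x_def)
    ultimately show ?thesis by (intro bexI[of _ x]) (auto simp: x_def vecs_def)
  qed
  \<comment> \<open>An upper bound for the operator norm of \<open>L\<close> in the 1-norm; it is 0
    when \<open>n = 0\<close>, hence the division by \<open>K + 1\<close> below.\<close>
  define K where "K = (\<Sum>i<n. l1 n (\<beta> i))"
  have K: "K \<ge> 0" by (simp add: K_def sum_nonneg)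
  have L_le: "l1 n (L x) \<le> K * l1 n x" for x
  proof -
    have "l1 n (\<Sum>i\<in>I. x i *\<^sub>R \<beta> i) \<le> (\<Sum>i\<in>I. \<bar>x i\<bar> * l1 n (\<beta> i))" if "finite I" for I
      using that
    proof (induction I rule: finite_induct)
      case empty
      show ?case by (simp only: sum.empty l1_0 order_refl)
    next
      case (insert i I)
      have "l1 n (x i *\<^sub>R \<beta> i + (\<Sum>i\<in>I. x i *\<^sub>R \<beta> i)) \<le> l1 n (x i *\<^sub>R \<beta> i) + l1 n (\<Sum>i\<in>I. x i *\<^sub>R \<beta> i)"
        by (rule l1_triangle)
      then show ?case unfolding sum.insert[OF insert.hyps] using insert.IH by (simp only: l1_scaleR)
    qed
    then have "l1 n (L x) \<le> (\<Sum>i<n. \<bar>x i\<bar> * l1 n (\<beta> i))" by (simp add: L_def)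
    also have "\<dots> \<le> (\<Sum>i<n. l1 n x * l1 n (\<beta> i))"
      by (intro sum_mono mult_right_mono abs_le_l1) auto
    finally show ?thesis by (simp add: K_def sum_distrib_left mult.commute)
  qed
  have L_cont: "continuous_map (subtopology (Euclidean_space n) U) (Euclidean_space n) L" if "U \<subseteq> vecs n" for U
    using that Lv L_le by (intro continuous_map_Euclidean_Lipschitz[where K = K]) (auto simp flip: L_diff)
  have L_cont': "continuous_map (Euclidean_space n) (Euclidean_space n) L"
    using L_cont[OF order_refl] by (metis subtopology_topspace topspace_Euclidean)
  have ex: "exponential_cover G X n (E \<circ> L)"
  proof unfold_locales
    show "continuous_map (Euclidean_space n) X (E \<circ> L)"
      using L_cont' E_cont by (rule continuous_map_compose)
    show "(E \<circ> L) (x + y) = (E \<circ> L) x \<otimes> (E \<circ> L) y" for x y by (simp add: L_add E_add Lv)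
    show "(E \<circ> L) ` vecs n = carrier G"
    proof -
      have "L ` vecs n = vecs n" using L_surj Lv by (auto simp: image_iff)
      then show ?thesis using E_surj by (simp only: image_comp[symmetric])
    qed
    show "openin X ((E \<circ> L) ` S)" if S: "openin (Euclidean_space n) S" for S
    proof -
      have Sv: "S \<subseteq> vecs n" using openin_subset[OF S] by simp
      \<comment> \<open>Openness of the linear bijection is read off from invariance of
        domain.\<close>
      have "openin (Euclidean_space n) (L ` S)"
        by (rule invariance_of_domain_Euclidean_space[OF S L_cont[OF Sv] inj_on_subset[OF L_inj Sv]])
      then show ?thesis using E_open by (simp only: image_comp[symmetric])
    qed
    obtain \<epsilon> where \<epsilon>: "\<epsilon> > 0" "\<And>x. x \<in> vecs n \<Longrightarrow> l1 n x < \<epsilon> \<Longrightarrow> E x = \<one> \<Longrightarrow> x = 0"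
      using E_discrete by blast
    have "x = 0" if x: "x \<in> vecs n" "l1 n x < \<epsilon> / (K + 1)" "(E \<circ> L) x = \<one>" for x
    proof -
      have "l1 n (L x) \<le> (K + 1) * l1 n x"
        by (rule order_trans[OF L_le]) (auto intro: mult_right_mono)
      also have "\<dots> < \<epsilon>" using x(2) K by (simp add: field_simps)
      finally have "L x = 0" using \<epsilon>(2)[OF Lv] x(3) by simp
      then show "x = 0" using inj_onD[OF L_inj, of x 0] x(1) L0 by simp
    qed
    moreover have "\<epsilon> / (K + 1) > 0" using \<epsilon>(1) K by simp
    ultimately show "\<exists>\<epsilon>>0. \<forall>x\<in>vecs n. l1 n x < \<epsilon> \<longrightarrow> (E \<circ> L) x = \<one> \<longrightarrow> x = 0" by blast
  qed (use comm in auto)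
  interpret N: exponential_cover G X n "E \<circ> L" by (rule ex)
  have L_ker: "x \<in> N.ker \<longleftrightarrow> x \<in> vecs n \<and> L x \<in> ker" for x
    by (auto simp: N.ker_def ker_def Lv)
  have "normalized_cover G X n (E \<circ> L) b"
  proof unfold_locales
    show "b \<le> n" by (rule bn)
    show "unit_vec i \<in> N.ker" if "i < b" for i
    proof -
      have "L (unit_vec i) = (\<Sum>k<n. if k = i then \<beta> k else 0)"
        unfolding L_def by (intro sum.cong) (auto simp: unit_vec_def)
      also have "\<dots> = \<beta> i" using that bn by simp
      finally have "L (unit_vec i) \<in> ker" using bij_betwE[OF \<beta>B] that B(1) by auto
      then show ?thesis using unit_vec_vecs[of i n] that bn by (simp add: L_ker)
    qed
    show "x i = 0" if "x \<in> N.ker" "b \<le> i" for x i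
    proof -
      have x: "x \<in> vecs n" "L x \<in> ker" using that L_ker by auto
      then obtain z where "z \<in> vecs n" "L z = L x" "\<forall>i\<ge>b. z i = 0"
        using L_surj[OF Lv, of x] B(3) by blast
      moreover from this have "z = x" using inj_onD[OF L_inj] x(1) by blast
      ultimately show ?thesis using that(2) by blast
    qed
  qed
  then show ?thesis by blast
qed


section \<open>Dimension of charts\<close>

lemma vecs_mono: "m \<le> n \<Longrightarrow> vecs m \<subseteq> vecs n"
  by (auto simp: vecs_def)

lemma l1_vecs_eq: "x \<in> vecs m \<Longrightarrow> m \<le> n \<Longrightarrow> l1 n x = l1 m x"
  unfolding l1_def by (rule sum.mono_neutral_right) (auto simp: vecs_def)

lemma continuous_map_Euclidean_mono:
  assumes "m \<le> n" "continuous_map Y (Euclidean_space m) f"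
  shows "continuous_map Y (Euclidean_space n) f"
proof (rule continuous_map_into_Euclidean)
  show "f x \<in> vecs n" if "x \<in> topspace Y" for x
    using that continuous_map_funspace[OF assms(2)] vecs_mono[OF assms(1)] by auto
  show "continuous_map Y euclideanreal (\<lambda>x. f x i)" for i
    using continuous_map_compose[OF assms(2) continuous_map_Euclidean_coord[of m i]] by (simp add: o_def)
qed

text \<open>Around a point of an open set there is room for a small step in direction
  \<open>unit_vec b\<close>, and this step leaves \<open>vecs b\<close>.\<close>

lemma not_open_in_larger_Euclidean:
  assumes "b < d" "openin (Euclidean_space d) S" "S \<subseteq> vecs b"
  shows "S = {}"
proof (rule ccontr)
  assume "S \<noteq> {}"
  then obtain x where x: "x \<in> S" by blast
  then obtain e where e: "e > 0" "l1_ball d x e \<subseteq> S" using assms(2) openin_Euclidean_iff by blast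
  have xv: "x \<in> vecs b" using x assms(3) by blast
  let ?y = "x + (e / 2) *\<^sub>R unit_vec b"
  have "l1 d (unit_vec b) = 1" using assms(1) by (simp add: l1_def unit_vec_def if_distrib cong: if_cong)
  then have "?y \<in> l1_ball d x e"
    using e(1) xv vecs_mono[of b d] unit_vec_vecs[of b d] assms(1) by (auto simp: l1_ball_def)
  then have "?y \<in> vecs b" using e(2) assms(3) by blast
  then have "?y b = 0" by (simp add: vecs_def)
  then show False using xv e(1) by (simp add: vecs_def unit_vec_def)
qed

text \<open>If \<open>b < d\<close>, the transition map, viewed with values in the larger space,
  would have an open image by invariance of domain; but this image is nonempty and lies in
  \<open>vecs b\<close>.\<close>

lemma chart_dimension_le:
  assumes U: "is_chart X d (U, \<phi>)" and V: "is_chart X b (V, \<psi>)" and ne: "U \<inter> V \<noteq> {}"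
  shows "d \<le> b"
proof (rule ccontr)
  assume "\<not> d \<le> b"
  then have bd: "b < d" by simp
  have U': "openin X U" "openin (Euclidean_space d) (\<phi> ` U)"
    "homeomorphic_map (subtopology X U) (subtopology (Euclidean_space d) (\<phi> ` U)) \<phi>"
    using U by (auto simp: is_chart_def)
  have V': "openin X V" "openin (Euclidean_space b) (\<psi> ` V)"
    "homeomorphic_map (subtopology X V) (subtopology (Euclidean_space b) (\<psi> ` V)) \<psi>"
    using V by (auto simp: is_chart_def)
  have tU: "topspace (subtopology X U) = U" and tV: "topspace (subtopology X V) = V"
    using openin_subset[OF U'(1)] openin_subset[OF V'(1)] by auto
  obtain g where g: "homeomorphic_maps (subtopology X U) (subtopology (Euclidean_space d) (\<phi> ` U)) \<phi> g"
    using U'(3) homeomorphic_map_maps by blast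
  have g\<phi>: "g (\<phi> x) = x" if "x \<in> U" for x using g that unfolding homeomorphic_maps_def tU by auto
  have contg: "continuous_map (subtopology (Euclidean_space d) (\<phi> ` U)) (subtopology X U) g"
    using g by (simp add: homeomorphic_maps_def)
  have inj\<psi>: "inj_on \<psi> V" using V'(3) unfolding homeomorphic_eq_everything_map tV by blast
  have cont\<psi>: "continuous_map (subtopology X V) (Euclidean_space b) \<psi>"
    using homeomorphic_imp_continuous_map[OF V'(3)] continuous_map_into_fulltopology by blast
  define W where "W = \<phi> ` (U \<inter> V)"
  have "openin (subtopology X U) (U \<inter> V)" using U'(1) V'(1) by (auto simp: openin_subtopology)
  then have "openin (subtopology (Euclidean_space d) (\<phi> ` U)) W"
    using homeomorphic_imp_open_map[OF U'(3)] unfolding open_map_def W_def by blast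
  then have W: "openin (Euclidean_space d) W" using U'(2) openin_trans_full by blast
  have gW: "g z \<in> U \<inter> V" if "z \<in> W" for z using that g\<phi> by (auto simp: W_def)
  have "continuous_map (subtopology (Euclidean_space d) W) X g"
    using continuous_map_into_fulltopology[OF continuous_map_from_subtopology_mono[OF contg]]
    unfolding W_def by (meson image_mono inf_le1)
  then have "continuous_map (subtopology (Euclidean_space d) W) (subtopology X V) g"
    using gW by (auto simp: continuous_map_in_subtopology)
  from continuous_map_compose[OF this cont\<psi>]
  have cb: "continuous_map (subtopology (Euclidean_space d) W) (Euclidean_space b) (\<psi> \<circ> g)" .
  have "inj_on (\<psi> \<circ> g) W"
  proof (rule comp_inj_on)
    show "inj_on g W" using g\<phi> by (auto simp: inj_on_def W_def)
    show "inj_on \<psi> (g ` W)" using gW by (intro inj_on_subset[OF inj\<psi>]) auto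
  qed
  then have "openin (Euclidean_space d) ((\<psi> \<circ> g) ` W)"
    using continuous_map_Euclidean_mono[OF _ cb] bd W by (intro invariance_of_domain_Euclidean_space) auto
  moreover have "(\<psi> \<circ> g) ` W \<subseteq> vecs b"
  proof -
    have "W \<subseteq> vecs d" using openin_subset[OF W] by simp
    then show ?thesis using continuous_map_image_subset_topspace[OF cb] by (simp add: Int_absorb1)
  qed
  ultimately have "(\<psi> \<circ> g) ` W = {}" using not_open_in_larger_Euclidean bd by blast
  then show False using ne by (simp add: W_def)
qed

text \<open>This justifies the definite description in \<open>lie_dim\<close>.\<close>

lemma lie_group_dimension_unique:
  assumes "lie_group G X d \<A>" "lie_group G X b \<B>"
  shows "d = b"
proof -
  interpret A: lie_group G X d \<A> by fact
  interpret B: lie_group G X b \<B> by fact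
  have "\<one>\<^bsub>G\<^esub> \<in> topspace X" by (simp add: A.topspace_eq)
  obtain U \<phi> where U: "(U, \<phi>) \<in> \<A>" "\<one>\<^bsub>G\<^esub> \<in> U"
    using \<open>\<one>\<^bsub>G\<^esub> \<in> topspace X\<close> unfolding A.cover by auto
  obtain V \<psi> where V: "(V, \<psi>) \<in> \<B>" "\<one>\<^bsub>G\<^esub> \<in> V"
    using \<open>\<one>\<^bsub>G\<^esub> \<in> topspace X\<close> unfolding B.cover by auto
  have "d \<le> b" "b \<le> d"
    using chart_dimension_le[OF A.charts[OF U(1)] B.charts[OF V(1)]]
      chart_dimension_le[OF B.charts[OF V(1)] A.charts[OF U(1)]] U(2) V(2) by blast+
  then show ?thesis by simp
qed


section \<open>Smoothness of affine maps\<close>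

lemma affine_coords_upd:
  fixes a :: "nat \<Rightarrow> real"
  assumes "i < N"
  shows "(\<Sum>j<N. a j * (x(i := t)) j) = a i * t + (\<Sum>j\<in>{..<N} - {i}. a j * x j)"
proof -
  have "(\<Sum>j<N. a j * (x(i := t)) j) = a i * (x(i := t)) i + (\<Sum>j\<in>{..<N} - {i}. a j * (x(i := t)) j)"
    using assms by (intro sum.remove) auto
  also have "(\<Sum>j\<in>{..<N} - {i}. a j * (x(i := t)) j) = (\<Sum>j\<in>{..<N} - {i}. a j * x j)"
    by (intro sum.cong) auto
  finally show ?thesis by simp
qed

lemma C_on_affine: "C_on k N W (\<lambda>x. (\<Sum>j<N. a j * x j) + c)"
proof -
  have cont: "continuous_map (subtopology (Euclidean_space N) W) euclideanreal (\<lambda>x. (\<Sum>j<N. a j * x j) + c)" for a c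
    by (intro continuous_map_from_subtopology continuous_intros continuous_map_Euclidean_coord) auto
  have der: "((\<lambda>t. (\<Sum>j<N. a j * (x(i := t)) j) + c) has_field_derivative a i) (at s)"
    if "i < N" for a :: "nat \<Rightarrow> real" and c i x s
    unfolding affine_coords_upd[OF that] by (auto intro!: derivative_eq_intros)
  \<comment> \<open>The derivative is a constant; it is written as an affine function again so that
    the induction on \<open>k\<close>, with \<open>a\<close> and \<open>c\<close> arbitrary, applies
    to it.\<close>
  have pd: "partial_deriv i (\<lambda>x. (\<Sum>j<N. a j * x j) + c) = (\<lambda>x. (\<Sum>j<N. 0 * x j) + a i)"
    if "i < N" for a :: "nat \<Rightarrow> real" and c i
    using DERIV_imp_deriv[OF der[OF that]] unfolding partial_deriv_def by simp
  show ?thesis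
  proof (induction k arbitrary: a c)
    case 0
    show ?case using cont by simp
  next
    case (Suc k)
    have "C_on k N W (partial_deriv i (\<lambda>x. (\<Sum>j<N. a j * x j) + c))" if "i < N" for i
      unfolding pd[OF that] by (rule Suc.IH)
    moreover have "(\<lambda>t. (\<Sum>j<N. a j * (x(i := t)) j) + c) field_differentiable at (x i)" if "i < N" for i x
      unfolding field_differentiable_def using der[OF that] by blast
    ultimately show ?case using cont unfolding C_on.simps by blast
  qed
qed

lemma eventually_coord_upd_in_open:
  assumes W: "openin (Euclidean_space N) W" and x: "x \<in> W" and i: "i < N"
  shows "\<forall>\<^sub>F t in nhds (x i). x(i := t) \<in> W"
proof -
  obtain e where e: "e > 0" "l1_ball N x e \<subseteq> W" using W x openin_Euclidean_iff by blast
  have xv: "x \<in> vecs N" using x W openin_subset by fastforce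
  have "x(i := t) \<in> W" if "dist t (x i) < e" for t
  proof -
    have "x(i := t) - x = (t - x i) *\<^sub>R unit_vec i" by (auto simp: unit_vec_def)
    moreover have "l1 N (unit_vec i) = 1"
      using i by (simp add: l1_def unit_vec_def if_distrib cong: if_cong)
    ultimately have "l1 N (x(i := t) - x) = \<bar>t - x i\<bar>" by (simp only: l1_scaleR mult_1_right)
    then have "x(i := t) \<in> l1_ball N x e"
      using that vecs_upd[OF xv i] unfolding l1_ball_def dist_real_def by (simp only: mem_Collect_eq)
    then show ?thesis using e by blast
  qed
  then show ?thesis unfolding eventually_nhds_metric using e(1) by blast
qed

text \<open>Partial derivatives depend on values near a point, and openness of \<open>W\<close>
  keeps small changes of one coordinate inside \<open>W\<close>.\<close>

lemma C_on_cong: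
  assumes W: "openin (Euclidean_space N) W"
    and "\<And>x. x \<in> W \<Longrightarrow> f x = g x" "C_on k N W f"
  shows "C_on k N W g"
proof -
  have cont: "continuous_map (subtopology (Euclidean_space N) W) euclideanreal g"
    if "\<And>x. x \<in> W \<Longrightarrow> f x = g x" "continuous_map (subtopology (Euclidean_space N) W) euclideanreal f" for f g
    using that by (intro continuous_map_eq[OF that(2)]) auto
  show ?thesis using assms(2,3)
  proof (induction k arbitrary: f g)
    case 0
    then show ?case using cont[of f g] by simp
  next
    case (Suc k)
    have eq: "\<And>x. x \<in> W \<Longrightarrow> f x = g x" by (rule Suc.prems(1))
    have ev: "\<forall>\<^sub>F t in nhds (x i). f (x(i := t)) = g (x(i := t))" if "x \<in> W" "i < N" for x i
      using eventually_coord_upd_in_open[OF W that] by (rule eventually_mono) (rule eq)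
    have C: "continuous_map (subtopology (Euclidean_space N) W) euclideanreal f"
      "\<And>i x. i < N \<Longrightarrow> x \<in> W \<Longrightarrow> (\<lambda>t. f (x(i := t))) field_differentiable at (x i)"
      "\<And>i. i < N \<Longrightarrow> C_on k N W (partial_deriv i f)"
      using Suc.prems(2) unfolding C_on.simps by blast+
    have pd: "partial_deriv i f x = partial_deriv i g x" if "x \<in> W" "i < N" for x i
      unfolding partial_deriv_def by (rule deriv_cong_ev[OF ev[OF that] refl])
    have "C_on k N W (partial_deriv i g)" if "i < N" for i
      by (rule Suc.IH[OF pd[OF _ that] C(3)[OF that]])
    moreover have "(\<lambda>t. g (x(i := t))) field_differentiable at (x i)" if "i < N" "x \<in> W" for x i
      using C(2)[OF that] DERIV_cong_ev[OF refl ev[OF that(2,1)] refl] unfolding field_differentiable_def by blast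
    ultimately show ?case
      using cont[OF eq C(1)] unfolding C_on.simps by blast
  qed
qed

lemma smooth_affine:
  assumes W: "openin (Euclidean_space N) W"
    and F: "\<And>x j. x \<in> W \<Longrightarrow> j < m \<Longrightarrow> F x j = (\<Sum>i<N. a j i * x i) + c j"
  shows "smooth_real_map_on N m W F"
  unfolding smooth_real_map_on_def
proof (intro allI impI)
  fix j k assume "j < m"
  then show "C_on k N W (\<lambda>x. F x j)"
    using F by (intro C_on_cong[OF W _ C_on_affine[of k N W "a j" "c j"]]) simp
qed


section \<open>The maximal torus\<close>

text \<open>A continuous open map is a homeomorphism onto its image wherever it is injective. The
  statement is about the inverse because the charts of the torus are local inverses of
  \<open>E\<close>.\<close>

lemma homeomorphic_map_local_inverse:
  assumes cont: "continuous_map A B f" and opn: "\<And>S. openin A S \<Longrightarrow> openin B (f ` S)"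
    and Q: "openin A Q" and inj: "inj_on f Q"
  shows "homeomorphic_map (subtopology B (f ` Q)) (subtopology A Q) (inv_into Q f)"
proof -
  have QA: "Q \<subseteq> topspace A" and QB: "f ` Q \<subseteq> topspace B"
    using openin_subset[OF Q] openin_subset[OF opn[OF Q]] by auto
  have "homeomorphic_maps (subtopology B (f ` Q)) (subtopology A Q) (inv_into Q f) f"
    unfolding homeomorphic_maps_def
  proof (intro conjI ballI)
    show "continuous_map (subtopology A Q) (subtopology B (f ` Q)) f"
      using cont by (auto simp: continuous_map_in_subtopology intro: continuous_map_from_subtopology)
    show "continuous_map (subtopology B (f ` Q)) (subtopology A Q) (inv_into Q f)"
      unfolding continuous_map_def
    proof (intro conjI allI impI)
      show "inv_into Q f \<in> topspace (subtopology B (f ` Q)) \<rightarrow> topspace (subtopology A Q)"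
        using QA by (auto simp: inj inv_into_f_f)
      fix S assume S: "openin (subtopology A Q) S"
      then have SQ: "S \<subseteq> Q" "openin A S" using openin_subset Q openin_trans_full by fastforce+
      have "{x \<in> topspace (subtopology B (f ` Q)). inv_into Q f x \<in> S} = f ` S"
        using SQ QB inj by (auto simp: inv_into_f_f image_iff)
      moreover have "openin (subtopology B (f ` Q)) (f ` S)"
        using opn[OF SQ(2)] SQ(1) by (auto simp: openin_subtopology intro!: exI[of _ "f ` S"])
      ultimately show "openin (subtopology B (f ` Q)) {x \<in> topspace (subtopology B (f ` Q)). inv_into Q f x \<in> S}"
        by simp
    qed
  qed (use inj in \<open>auto simp: inv_into_f_f f_inv_into_f\<close>)
  then show ?thesis by (rule homeomorphic_maps_imp_map)
qed

context normalized_cover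
begin

lemma vecs_b: "x \<in> vecs b \<Longrightarrow> x \<in> vecs n"
  using vecs_mono[OF b_le] by blast

lemma ker_vecs_b: "x \<in> ker \<Longrightarrow> x \<in> vecs b"
  using ker_coords by (simp add: vecs_def)

definition torus :: "'a set" where
  "torus = E ` vecs b"

text \<open>Two lifts of one element differ by a vector of the kernel, which lies in
  \<open>vecs b\<close>.\<close>

lemma E_in_torus_iff: "x \<in> vecs n \<Longrightarrow> E x \<in> torus \<longleftrightarrow> x \<in> vecs b"
proof
  assume x: "x \<in> vecs n" and "E x \<in> torus"
  then obtain z where z: "z \<in> vecs b" "E x = E z" by (auto simp: torus_def)
  then have "x - z \<in> vecs b" using E_eq_iff[of x z] x vecs_b ker_vecs_b by blast
  then show "x \<in> vecs b" using vecs_add[of "x - z" b z] z(1) by simp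
qed (simp add: torus_def)

lemma subgroup_torus: "subgroup torus G"
proof (rule subgroupI)
  show "torus \<subseteq> carrier G" using E_carrier vecs_b by (auto simp: torus_def)
  show "torus \<noteq> {}" using vecs_0[of b] by (auto simp: torus_def simp del: vecs_0)
  show "inv a \<in> torus" if a: "a \<in> torus" for a
  proof -
    obtain x where x: "x \<in> vecs b" "a = E x" using a by (auto simp: torus_def)
    then show ?thesis using E_minus[of x] vecs_b by (auto simp: torus_def intro!: image_eqI[of _ E "- x"])
  qed
  show "a \<otimes> c \<in> torus" if ac: "a \<in> torus" "c \<in> torus" for a c
  proof -
    obtain x y where "x \<in> vecs b" "a = E x" "y \<in> vecs b" "c = E y" using ac by (auto simp: torus_def)
    then show ?thesis using E_add[of x y] vecs_b by (auto simp: torus_def intro!: image_eqI[of _ E "x + y"])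
  qed
qed

lemma int_comb_in_ker:
  assumes "I \<subseteq> {..<b}"
  shows "(\<Sum>i\<in>I. of_int (m i) *\<^sub>R unit_vec i) \<in> ker"
proof -
  have "finite I" using assms finite_subset by blast
  then show ?thesis using assms
    by (induction I rule: finite_induct)
      (auto intro!: additive_subgroup_add[OF additive_subgroup_ker] additive_subgroup_of_int_scaleR[OF additive_subgroup_ker]
        additive_subgroup_zero[OF additive_subgroup_ker] unit_vec_ker)
qed

text \<open>Subtracting integer parts changes a vector by a kernel element. The closed cube is
  compact, which gives compactness of the torus.\<close>

lemma torus_eq_cube_image:
  "torus = E ` {x \<in> vecs b. \<forall>i<b. x i \<in> {0..1}}"
proof
  show "torus \<subseteq> E ` {x \<in> vecs b. \<forall>i<b. x i \<in> {0..1}}"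
  proof
    fix y assume "y \<in> torus"
    then obtain x where x: "x \<in> vecs b" "y = E x" by (auto simp: torus_def)
    define f where "f = (\<Sum>i<b. of_int \<lfloor>x i\<rfloor> *\<^sub>R unit_vec i)"
    have f: "f \<in> ker" unfolding f_def by (rule int_comb_in_ker) simp
    have fi: "f i = of_int \<lfloor>x i\<rfloor>" if "i < b" for i
      using that by (simp add: f_def sum_fun_apply unit_vec_def if_distrib[of "\<lambda>t. _ * t"] cong: if_cong)
    have xf: "x - f \<in> vecs b" using x(1) ker_vecs_b[OF f] by simp
    have "E (x - f) = E x" using E_eq_iff[of x "x - f"] f x(1) xf vecs_b by simp
    moreover have "(x - f) i \<in> {0..1}" if "i < b" for i
      using fi[OF that] by (simp add: le_diff_eq diff_le_eq) linarith
    ultimately show "y \<in> E ` {x \<in> vecs b. \<forall>i<b. x i \<in> {0..1}}" using x(2) xf by (intro image_eqI[of _ _ "x - f"]) auto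
  qed
qed (auto simp: torus_def)

lemma compactin_torus: "compactin X torus"
proof -
  let ?C = "{x \<in> vecs b. \<forall>i<b. x i \<in> {0..1::real}}"
  have C: "?C = Pi\<^sub>E UNIV (\<lambda>i. if i < b then {0..1} else {0})"
    by (auto simp: vecs_def PiE_iff Pi_iff split: if_splits)
  have "compactin (powertop_real UNIV) ?C" unfolding C by (auto simp: compactin_PiE)
  moreover have "?C \<subseteq> vecs n" using vecs_b by blast
  ultimately have "compactin (Euclidean_space n) ?C"
    by (simp add: Euclidean_space_def compactin_subtopology vecs_def)
  then show ?thesis unfolding torus_eq_cube_image using E_cont by (rule image_compactin)
qed

text \<open>
  The coordinates beyond \<open>b\<close> descend to the group and are unbounded on the powers of an element
  outside the torus.
\<close>

lemma compact_subgroup_subset_torus: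
  assumes L: "subgroup L G" "compactin X L"
  shows "L \<subseteq> torus"
proof
  fix y assume y: "y \<in> L"
  have LG: "L \<subseteq> carrier G" by (rule subgroup.subset[OF L(1)])
  then obtain x where x: "x \<in> vecs n" "y = E x" using y E_surj by blast
  have "x j = 0" if j: "b \<le> j" for j
  proof (rule ccontr)
    assume xj: "x j \<noteq> 0"
    \<comment> \<open>The images of the sets \<open>Q N\<close> form an increasing open cover of the
      group, so compactness puts \<open>L\<close> into a single one.\<close>
    define Q where "Q N = {z \<in> vecs n. \<bar>z j\<bar> < real N}" for N :: nat
    have Q: "openin X (E ` Q N)" for N
    proof (rule E_open)
      have "continuous_map (Euclidean_space n) euclideanreal (\<lambda>z. \<bar>z j\<bar>)"
        by (intro continuous_intros continuous_map_Euclidean_coord)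
      from openin_continuous_map_preimage[OF this, of "{..<real N}"]
      show "openin (Euclidean_space n) (Q N)" by (simp add: Q_def)
    qed
    have "L \<subseteq> \<Union>(range (\<lambda>N. E ` Q N))"
    proof
      fix u assume "u \<in> L"
      then obtain z where z: "z \<in> vecs n" "u = E z" using LG E_surj by blast
      obtain N :: nat where "\<bar>z j\<bar> < real N" using reals_Archimedean2 by blast
      then show "u \<in> \<Union>(range (\<lambda>N. E ` Q N))" using z by (auto simp: Q_def)
    qed
    then obtain \<F> where \<F>: "finite \<F>" "\<F> \<subseteq> range (\<lambda>N. E ` Q N)" "L \<subseteq> \<Union>\<F>"
      using compactinD[OF L(2), of "range (\<lambda>N. E ` Q N)"] Q by blast
    obtain I where I: "finite I" "\<F> = (\<lambda>N. E ` Q N) ` I"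
      using finite_subset_image[OF \<F>(1,2)] by blast
    define M where "M = Max (insert 0 I)"
    have LM: "L \<subseteq> E ` Q M"
    proof
      fix u assume "u \<in> L"
      then obtain N where N: "N \<in> I" "u \<in> E ` Q N" using \<F>(3) I(2) by blast
      have "N \<le> M" using N(1) I(1) by (simp add: M_def)
      then have "Q N \<subseteq> Q M" by (auto simp: Q_def)
      then show "u \<in> E ` Q M" using N(2) by blast
    qed
    obtain k :: nat where k: "real M < real k * \<bar>x j\<bar>"
      using reals_Archimedean3[of "\<bar>x j\<bar>"] xj by auto
    have "E (of_nat k *\<^sub>R x) = y [^] k" using E_scaleR_nat x by simp
    also have "\<dots> \<in> L"
    proof (induction k)
      case 0
      then show ?case using subgroup.one_closed[OF L(1)] by simp
    next
      case (Suc k)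
      then show ?case using subgroup.m_closed[OF L(1)] y by simp
    qed
    finally obtain z where z: "z \<in> Q M" "E (of_nat k *\<^sub>R x) = E z" using LM by blast
    then have "of_nat k *\<^sub>R x - z \<in> ker" using E_eq_iff[of "of_nat k *\<^sub>R x" z] x(1) by (simp add: Q_def)
    then have "z j = real k * x j" using ker_coords[OF _ j] by fastforce
    then show False using z(1) k by (simp add: Q_def abs_mult)
  qed
  then have "x \<in> vecs b" by (simp add: vecs_def)
  then show "y \<in> torus" using x(2) by (simp add: torus_def)
qed

theorem maximal_torus_eq: "maximal_torus G X = torus"
  unfolding maximal_torus_def
proof (rule the_equality)
  show "maximal_compact_subgroup G X torus"
    unfolding maximal_compact_subgroup_def
    using subgroup_torus compactin_torus compact_subgroup_subset_torus by blast
  fix K assume "maximal_compact_subgroup G X K"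
  then show "K = torus"
    unfolding maximal_compact_subgroup_def
    using subgroup_torus compactin_torus compact_subgroup_subset_torus by blast
qed

text \<open>The common radius of all charts of the torus. The factor 8 leaves room in
  \<open>smooth_lift\<close>, where a kernel element is the sum of two differences of norm below
  \<open>2 * rad\<close> and \<open>4 * rad\<close>.\<close>

definition rad :: real where
  "rad = (SOME \<rho>. \<rho> > 0 \<and> (\<forall>x\<in>ker. l1 b x < 8 * \<rho> \<longrightarrow> x = 0))"

lemma rad_pos: "rad > 0" and ker_small: "x \<in> ker \<Longrightarrow> l1 b x < 8 * rad \<Longrightarrow> x = 0"
proof -
  obtain \<epsilon> where \<epsilon>: "\<epsilon> > 0" "\<forall>x\<in>vecs n. l1 n x < \<epsilon> \<longrightarrow> E x = \<one> \<longrightarrow> x = 0" using E_discrete by blast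
  then have "\<epsilon> / 8 > 0 \<and> (\<forall>x\<in>ker. l1 b x < 8 * (\<epsilon> / 8) \<longrightarrow> x = 0)"
    using l1_vecs_eq[OF ker_vecs_b b_le] by (auto simp: ker_def)
  then have "rad > 0 \<and> (\<forall>x\<in>ker. l1 b x < 8 * rad \<longrightarrow> x = 0)"
    unfolding rad_def by (rule someI)
  then show "rad > 0" "x \<in> ker \<Longrightarrow> l1 b x < 8 * rad \<Longrightarrow> x = 0" by auto
qed

definition torus_chart :: "(nat \<Rightarrow> real) \<Rightarrow> 'a chart" where
  "torus_chart x = (E ` l1_ball b x rad, inv_into (l1_ball b x rad) E)"

abbreviation "torus_topology \<equiv> subtopology X torus"

lemma topspace_torus: "topspace torus_topology = torus"
  using subgroup.subset[OF subgroup_torus] by (auto simp: topspace_eq)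

lemma E_cont_torus: "continuous_map (Euclidean_space b) torus_topology E"
proof -
  have "continuous_map (Euclidean_space b) (Euclidean_space n) (\<lambda>x. x)"
    by (rule continuous_map_Euclidean_mono[OF b_le]) simp
  from continuous_map_compose[OF this E_cont]
  have "continuous_map (Euclidean_space b) X E" by (simp add: o_def)
  then show ?thesis by (auto simp: continuous_map_in_subtopology torus_def)
qed

text \<open>Truncation to the first \<open>b\<close> coordinates extends \<open>S\<close> to an open
  cylinder in \<open>vecs n\<close>, whose image is open in the group. Intersecting with the torus
  gives back the image of \<open>S\<close>, because every lift of a torus element lies in
  \<open>vecs b\<close>.\<close>

lemma E_open_torus:
  assumes S: "openin (Euclidean_space b) S"
  shows "openin torus_topology (E ` S)"
proof -
  define t where "t z = (\<lambda>i. if i < b then z i else 0)" for z :: "nat \<Rightarrow> real"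
  have Sv: "S \<subseteq> vecs b" using openin_subset[OF S] by simp
  have "continuous_map (Euclidean_space n) (Euclidean_space b) t"
    unfolding t_def[abs_def] by (simp add: continuous_map_componentwise_Euclidean_space continuous_map_Euclidean_coord)
  from openin_continuous_map_preimage[OF this S]
  have "openin X (E ` {z \<in> vecs n. t z \<in> S})" by (intro E_open) simp
  moreover have "E ` S = E ` {z \<in> vecs n. t z \<in> S} \<inter> torus"
  proof -
    have t: "t z = z" if "z \<in> vecs b" for z using that by (auto simp: t_def vecs_def fun_eq_iff)
    show ?thesis
    proof safe
      fix x assume "x \<in> S"
      then show "E x \<in> E ` {z \<in> vecs n. t z \<in> S}" "E x \<in> torus"
        using Sv vecs_b t by (auto simp: torus_def intro!: imageI)
    next
      fix z assume z: "z \<in> vecs n" "t z \<in> S" "E z \<in> torus"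
      then have "z \<in> S" using t E_in_torus_iff by metis
      then show "E z \<in> E ` S" by simp
    qed
  qed
  ultimately show ?thesis by (auto simp: openin_subtopology)
qed

lemma E_inj_chart: "inj_on E (l1_ball b x rad)"
proof (rule inj_onI)
  fix y z assume yz: "y \<in> l1_ball b x rad" "z \<in> l1_ball b x rad" "E y = E z"
  then have "y - z \<in> ker" using E_eq_iff vecs_b by (auto simp: l1_ball_def)
  moreover have "l1 b (y - z) < 8 * rad"
    using yz rad_pos l1_triangle_diff[of b y z x] by (auto simp: l1_ball_def l1_minus_commute[of b x z])
  ultimately show "y = z" using ker_small by fastforce
qed

lemma torus_chart_E:
  assumes "(U, \<phi>) = torus_chart x" "z \<in> l1_ball b x rad"
  shows "\<phi> (E z) = z" "inv_into U \<phi> z = E z"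
proof -
  have U: "U = E ` l1_ball b x rad" "\<phi> = inv_into (l1_ball b x rad) E" using assms(1) by (auto simp: torus_chart_def)
  show 1: "\<phi> (E z) = z" using assms(2) by (simp add: U inv_into_f_f[OF E_inj_chart])
  have "inj_on \<phi> U" unfolding U by (rule inj_on_inv_into) simp
  then have "inv_into U \<phi> (\<phi> (E z)) = E z" by (rule inv_into_f_f) (use assms(2) U in auto)
  then show "inv_into U \<phi> z = E z" by (simp only: 1)
qed

lemma is_chart_torus: "is_chart torus_topology b (torus_chart x)"
proof -
  have im: "inv_into (l1_ball b x rad) E ` E ` l1_ball b x rad = l1_ball b x rad"
    using E_inj_chart by (simp add: inv_into_image_cancel)
  show ?thesis
    unfolding torus_chart_def is_chart_def
    using homeomorphic_map_local_inverse[OF E_cont_torus E_open_torus openin_l1_ball E_inj_chart]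
    by (simp add: im E_open_torus openin_l1_ball)
qed

text \<open>
  In the coordinates given by the local inverses of the exponential map, the group operations are
  affine: two lifts differ by an element of the discrete kernel.
\<close>

lemma smooth_lift:
  assumes W: "openin (Euclidean_space N) W"
    and G: "\<And>z. z \<in> W \<Longrightarrow> H z \<in> l1_ball b y rad"
    and lin: "\<And>z j. z \<in> W \<Longrightarrow> j < b \<Longrightarrow> A z j = (\<Sum>i<N. a j i * z i)"
    and A: "\<And>z. z \<in> W \<Longrightarrow> A z \<in> l1_ball b x (2 * rad)"
    and E: "\<And>z. z \<in> W \<Longrightarrow> E (H z) = E (A z)"
  shows "smooth_real_map_on N b W H"
proof (cases "W = {}")
  case True
  then show ?thesis by (intro smooth_affine[OF W]) auto
next
  case False
  then obtain w where w: "w \<in> W" by blast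
  have "H z = A z + (H w - A w)" if z: "z \<in> W" for z
  proof -
    have "H z - A z \<in> ker" "H w - A w \<in> ker"
      using E_eq_iff[of "H z" "A z"] E_eq_iff[of "H w" "A w"] E z w G[OF z] G[OF w] A[OF z] A[OF w] vecs_b
      by (auto simp: l1_ball_def)
    then have k: "(H z - A z) - (H w - A w) \<in> ker" by (rule additive_subgroup_diff[OF additive_subgroup_ker])
    have "l1 b ((H z - A z) - (H w - A w)) = l1 b ((H z - H w) + (A w - A z))"
      by (rule arg_cong[of _ _ "l1 b"]) (simp add: fun_eq_iff)
    also have "\<dots> \<le> l1 b (H z - H w) + l1 b (A w - A z)" by (rule l1_triangle)
    also have "\<dots> < 8 * rad"
      using l1_triangle_diff[of b "H z" "H w" y] l1_triangle_diff[of b "A w" "A z" x] G[OF z] G[OF w] A[OF z] A[OF w] rad_pos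
      unfolding l1_ball_def l1_minus_commute[of b y] l1_minus_commute[of b x] by simp
    finally have "(H z - A z) - (H w - A w) = 0" by (rule ker_small[OF k])
    then show ?thesis by (simp add: algebra_simps)
  qed
  then show ?thesis
    using lin by (intro smooth_affine[OF W, where a = a and c = "H w - A w"]) simp
qed

theorem lie_group_torus:
  assumes haus: "Hausdorff_space X" and sc: "second_countable X"
  shows "lie_group (G\<lparr>carrier := torus\<rparr>) torus_topology b (torus_chart ` vecs b)"
proof -
  let ?G = "G\<lparr>carrier := torus\<rparr>" and ?Y = torus_topology
  note inv_eq = m_inv_consistent[OF subgroup_torus]
  have TG: "topological_group ?G ?Y"
  proof (intro topological_group.intro topological_group_axioms.intro)
    show "group ?G" by (rule subgroup_imp_group[OF subgroup_torus])
    show "topspace ?Y = carrier ?G" unfolding topspace_torus by simp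
    have "continuous_map (prod_topology ?Y ?Y) X (\<lambda>(x, y). x \<otimes> y)"
      unfolding subtopology_Times[symmetric] by (intro continuous_map_from_subtopology continuous_mult)
    then show "continuous_map (prod_topology ?Y ?Y) ?Y (\<lambda>(x, y). x \<otimes>\<^bsub>?G\<^esub> y)"
      using subgroup.m_closed[OF subgroup_torus] by (auto simp: continuous_map_in_subtopology)
    have "continuous_map ?Y X (\<lambda>x. inv\<^bsub>?G\<^esub> x)"
      by (rule continuous_map_eq[OF continuous_map_from_subtopology[OF continuous_inv, of torus]])
        (simp add: inv_eq)
    then show "continuous_map ?Y ?Y (\<lambda>x. inv\<^bsub>?G\<^esub> x)"
      using subgroup.m_inv_closed[OF subgroup_torus] by (auto simp: continuous_map_in_subtopology inv_eq)
  qed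
  have domain_open: "openin (Euclidean_space N) {z \<in> Q. E (f z) \<in> E ` l1_ball b y rad}"
    if Q: "openin (Euclidean_space N) Q" and f: "continuous_map (Euclidean_space N) (Euclidean_space b) f" for N Q f y
  proof -
    have "openin (Euclidean_space N) {z \<in> topspace (Euclidean_space N). (E \<circ> f) z \<in> E ` l1_ball b y rad}"
      by (intro openin_continuous_map_preimage[OF continuous_map_compose[OF f E_cont_torus]] E_open_torus openin_l1_ball)
    then have "openin (Euclidean_space N) (Q \<inter> {z \<in> topspace (Euclidean_space N). (E \<circ> f) z \<in> E ` l1_ball b y rad})"
      using Q by (rule openin_Int[rotated])
    moreover have "Q \<subseteq> vecs N" using openin_subset[OF Q] by simp
    then have "Q \<inter> {z \<in> topspace (Euclidean_space N). (E \<circ> f) z \<in> E ` l1_ball b y rad} = {z \<in> Q. E (f z) \<in> E ` l1_ball b y rad}"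
      by auto
    ultimately show ?thesis by simp
  qed
  \<comment> \<open>One statement covers the transition maps (\<open>f\<close> the identity,
    \<open>s = 1\<close>) and inversion (\<open>s = - 1\<close>).\<close>
  have compat: "smooth_real_map_on b b (\<phi> ` (U \<inter> (f -` V))) (\<psi> \<circ> f \<circ> inv_into U \<phi>)"
    if U: "(U, \<phi>) = torus_chart x" and V: "(V, \<psi>) = torus_chart y"
      and f: "\<And>z. z \<in> vecs b \<Longrightarrow> f (E z) = E (s *\<^sub>R z)" and s: "\<bar>s\<bar> = 1" for U \<phi> V \<psi> x y f s
  proof -
    have Ux: "U = E ` l1_ball b x rad" "V = E ` l1_ball b y rad" using U V by (auto simp: torus_chart_def)
    have bv: "l1_ball b z rad \<subseteq> vecs b" for z by (auto simp: l1_ball_def)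
    have Weq: "\<phi> ` (U \<inter> (f -` V)) = {z \<in> l1_ball b x rad. E (s *\<^sub>R z) \<in> E ` l1_ball b y rad}"
    proof safe
      fix u assume "u \<in> U" "f u \<in> V"
      then show "\<phi> u \<in> l1_ball b x rad" "E (s *\<^sub>R \<phi> u) \<in> E ` l1_ball b y rad"
        using torus_chart_E(1)[OF U] f bv unfolding Ux by (auto simp: subset_iff)
    next
      fix z w assume z: "z \<in> l1_ball b x rad" "w \<in> l1_ball b y rad" "E (s *\<^sub>R z) = E w"
      then show "z \<in> \<phi> ` (U \<inter> (f -` V))"
        using torus_chart_E(1)[OF U z(1)] f[of z] bv unfolding Ux
        by (intro image_eqI[of _ _ "E z"]) (auto simp: subset_iff)
    qed
    have "continuous_map (subtopology (Euclidean_space b) (vecs b)) (Euclidean_space b) (\<lambda>z. s *\<^sub>R z)"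
      by (rule continuous_map_Euclidean_Lipschitz[where K = "\<bar>s\<bar>"]) (auto simp flip: scaleR_diff_right)
    then have cont: "continuous_map (Euclidean_space b) (Euclidean_space b) (\<lambda>z. s *\<^sub>R z)"
      by (metis subtopology_topspace topspace_Euclidean)
    show ?thesis unfolding Weq
    proof (rule smooth_lift[where A = "\<lambda>z. s *\<^sub>R z" and a = "\<lambda>j i. if i = j then s else 0" and y = y and x = "s *\<^sub>R x"])
      show "openin (Euclidean_space b) {z \<in> l1_ball b x rad. E (s *\<^sub>R z) \<in> E ` l1_ball b y rad}"
        by (rule domain_open[OF openin_l1_ball cont])
      fix z assume "z \<in> {z \<in> l1_ball b x rad. E (s *\<^sub>R z) \<in> E ` l1_ball b y rad}"
      then obtain w where z: "z \<in> l1_ball b x rad" and w: "w \<in> l1_ball b y rad" "E (s *\<^sub>R z) = E w" by blast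
      have Hz: "(\<psi> \<circ> f \<circ> inv_into U \<phi>) z = w"
        using torus_chart_E(2)[OF U z] torus_chart_E(1)[OF V w(1)] f[of z] w(2) subsetD[OF bv z] by simp
      show "(\<psi> \<circ> f \<circ> inv_into U \<phi>) z \<in> l1_ball b y rad" using Hz w by simp
      show "E ((\<psi> \<circ> f \<circ> inv_into U \<phi>) z) = E (s *\<^sub>R z)" using Hz w by simp
      show "s *\<^sub>R z \<in> l1_ball b (s *\<^sub>R x) (2 * rad)"
        using z s rad_pos by (auto simp: l1_ball_def simp flip: scaleR_diff_right)
      show "(s *\<^sub>R z) j = (\<Sum>i<b. (if i = j then s else 0) * z i)" if "j < b" for j
        using that by (simp add: if_distrib[of "\<lambda>t. t * _"] cong: if_cong)
    qed
  qed
  have mult: "smooth_real_map_on (b + b) b (\<Phi> ` (U \<inter> ((\<lambda>(x, y). x \<otimes> y) -` V))) (\<psi> \<circ> (\<lambda>(x, y). x \<otimes> y) \<circ> inv_into U \<Phi>)"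
    if U: "(U, \<Phi>) \<in> prod_atlas b (torus_chart ` vecs b) (torus_chart ` vecs b)" and V: "(V, \<psi>) = torus_chart y" for U \<Phi> V \<psi> y
  proof -
    obtain U1 \<phi>1 U2 \<phi>2 x1 x2 where U1: "(U1, \<phi>1) = torus_chart x1" and U2: "(U2, \<phi>2) = torus_chart x2"
      and xs: "x1 \<in> vecs b" "x2 \<in> vecs b"
      and UP: "U = U1 \<times> U2" "\<Phi> = (\<lambda>(x, y). coord_append b (\<phi>1 x) (\<phi>2 y))"
      using U by (auto simp: prod_atlas_def)
    have Ux: "U1 = E ` l1_ball b x1 rad" "U2 = E ` l1_ball b x2 rad" "V = E ` l1_ball b y rad"
      using U1 U2 V by (auto simp: torus_chart_def)
    have bv: "l1_ball b z rad \<subseteq> vecs b" for z by (auto simp: l1_ball_def)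
    define l where "l z = (\<lambda>i. if i < b then z i else 0)" for z :: "nat \<Rightarrow> real"
    define r where "r z = (\<lambda>i. if i < b then z (b + i) else 0)" for z :: "nat \<Rightarrow> real"
    have lr: "l (coord_append b u v) = u" "r (coord_append b u v) = v" if "u \<in> vecs b" "v \<in> vecs b" for u v
      using that by (auto simp: l_def r_def coord_append_def vecs_def fun_eq_iff)
    have lr': "coord_append b (l z) (r z) = z" if "z \<in> vecs (b + b)" for z
      using that by (auto simp: l_def r_def coord_append_def vecs_def fun_eq_iff)
    have lc: "continuous_map (Euclidean_space (b + b)) (Euclidean_space b) l"
      and rc: "continuous_map (Euclidean_space (b + b)) (Euclidean_space b) r"
      unfolding l_def[abs_def] r_def[abs_def]
      by (simp_all add: continuous_map_componentwise_Euclidean_space continuous_map_Euclidean_coord)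
    have sc: "continuous_map (Euclidean_space (b + b)) (Euclidean_space b) (\<lambda>z. l z + r z)"
      unfolding plus_fun_def by (intro continuous_map_Euclidean_space_add lc rc)
    define Q where "Q = {z \<in> vecs (b + b). l z \<in> l1_ball b x1 rad} \<inter> {z \<in> vecs (b + b). r z \<in> l1_ball b x2 rad}"
    have Qo: "openin (Euclidean_space (b + b)) Q"
      using openin_continuous_map_preimage[OF lc openin_l1_ball] openin_continuous_map_preimage[OF rc openin_l1_ball]
      unfolding Q_def by (intro openin_Int) auto
    have \<Phi>E: "\<Phi> (E u, E v) = coord_append b u v" if "u \<in> l1_ball b x1 rad" "v \<in> l1_ball b x2 rad" for u v
      using torus_chart_E(1)[OF U1 that(1)] torus_chart_E(1)[OF U2 that(2)] by (simp add: UP)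
    have \<Phi>inj: "inj_on \<Phi> U"
    proof (rule inj_onI)
      fix p q assume pq: "p \<in> U" "q \<in> U" "\<Phi> p = \<Phi> q"
      then obtain u v u' v' where "p = (E u, E v)" "q = (E u', E v')" "u \<in> l1_ball b x1 rad" "v \<in> l1_ball b x2 rad"
        "u' \<in> l1_ball b x1 rad" "v' \<in> l1_ball b x2 rad" unfolding UP Ux by blast
      then show "p = q" using pq(3) \<Phi>E coord_append_inj[of u b u' v v'] bv by (auto simp: subset_iff)
    qed
    have Weq: "\<Phi> ` (U \<inter> ((\<lambda>(x, y). x \<otimes> y) -` V)) = {z \<in> Q. E (l z + r z) \<in> E ` l1_ball b y rad}"
    proof safe
      fix p q assume "(p, q) \<in> U" "p \<otimes> q \<in> V"
      then obtain u v where uv: "p = E u" "q = E v" "u \<in> l1_ball b x1 rad" "v \<in> l1_ball b x2 rad" unfolding UP Ux by blast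
      have uvb: "u \<in> vecs b" "v \<in> vecs b" using uv bv by auto
      have "E (u + v) \<in> E ` l1_ball b y rad"
        using E_add[of u v] uvb vecs_b \<open>p \<otimes> q \<in> V\<close> uv unfolding Ux by simp
      then show "\<Phi> (p, q) \<in> Q" "E (l (\<Phi> (p, q)) + r (\<Phi> (p, q))) \<in> E ` l1_ball b y rad"
        using \<Phi>E[OF uv(3,4)] lr[OF uvb] uv coord_append_vecs[OF uvb] by (auto simp: Q_def)
    next
      fix z w assume z: "z \<in> Q" "E (l z + r z) = E w" "w \<in> l1_ball b y rad"
      then have lz: "l z \<in> l1_ball b x1 rad" "r z \<in> l1_ball b x2 rad" "z \<in> vecs (b + b)" by (auto simp: Q_def)
      then have "E (l z) \<otimes> E (r z) = E w" using E_add[of "l z" "r z"] z(2) bv vecs_b by (auto simp: subset_iff)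
      then show "z \<in> \<Phi> ` (U \<inter> ((\<lambda>(x, y). x \<otimes> y) -` V))"
        using \<Phi>E[OF lz(1,2)] lr'[OF lz(3)] lz z(3) unfolding UP(1) Ux
        by (intro image_eqI[of _ _ "(E (l z), E (r z))"]) auto
    qed
    \<comment> \<open>Multiplication lifts to adding the two halves of \<open>z\<close>: entry
      \<open>j\<close> of the sum collects the entries \<open>j\<close> and \<open>b + j\<close>.
      The sum stays within \<open>2 * rad\<close> of \<open>x1 + x2\<close>, which is the radius
      that \<open>smooth_lift\<close> allows.\<close>
    show ?thesis unfolding Weq
    proof (rule smooth_lift[where A = "\<lambda>z. l z + r z" and a = "\<lambda>j i. if i = j \<or> i = b + j then 1 else 0" and y = y and x = "x1 + x2"])
      show "openin (Euclidean_space (b + b)) {z \<in> Q. E (l z + r z) \<in> E ` l1_ball b y rad}"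
        by (rule domain_open[OF Qo sc])
      fix z assume "z \<in> {z \<in> Q. E (l z + r z) \<in> E ` l1_ball b y rad}"
      then obtain w where z: "z \<in> Q" and w: "w \<in> l1_ball b y rad" "E (l z + r z) = E w" by blast
      have lz: "l z \<in> l1_ball b x1 rad" "r z \<in> l1_ball b x2 rad" "z \<in> vecs (b + b)" using z by (auto simp: Q_def)
      have "E (l z) \<otimes> E (r z) = E w" using E_add[of "l z" "r z"] w(2) lz bv vecs_b by (auto simp: subset_iff)
      moreover have "inv_into U \<Phi> z = (E (l z), E (r z))"
        using inv_into_f_f[OF \<Phi>inj, of "(E (l z), E (r z))"] \<Phi>E[OF lz(1,2)] lr'[OF lz(3)] lz(1,2)
        unfolding UP(1) Ux by simp
      ultimately have Hz: "(\<psi> \<circ> (\<lambda>(x, y). x \<otimes> y) \<circ> inv_into U \<Phi>) z = w"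
        using torus_chart_E(1)[OF V w(1)] by simp
      show "(\<psi> \<circ> (\<lambda>(x, y). x \<otimes> y) \<circ> inv_into U \<Phi>) z \<in> l1_ball b y rad" using Hz w by simp
      show "E ((\<psi> \<circ> (\<lambda>(x, y). x \<otimes> y) \<circ> inv_into U \<Phi>) z) = E (l z + r z)" using Hz w by simp
      have "l1 b (l z + r z - (x1 + x2)) \<le> l1 b (l z - x1) + l1 b (r z - x2)"
        using l1_triangle[of b "l z - x1" "r z - x2"] by (simp add: algebra_simps)
      then show "l z + r z \<in> l1_ball b (x1 + x2) (2 * rad)"
        using lz by (auto simp: l1_ball_def)
      show "(l z + r z) j = (\<Sum>i<b + b. (if i = j \<or> i = b + j then 1 else 0) * z i)" if j: "j < b" for j
      proof -
        have "(\<Sum>i<b + b. (if i = j \<or> i = b + j then 1 else 0) * z i) = (\<Sum>i\<in>{j, b + j}. z i)"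
          using j by (intro sum.mono_neutral_cong_right) auto
        also have "\<dots> = z j + z (b + j)" using j by simp
        finally show ?thesis using j by (simp add: l_def r_def)
      qed
    qed
  qed
  interpret T: topological_group ?G ?Y by (rule TG)
  show ?thesis
  proof (intro lie_group.intro lie_group_axioms.intro smooth_manifold.intro TG)
    show "Hausdorff_space ?Y" by (rule Hausdorff_space_subtopology[OF haus])
    show "second_countable ?Y" by (rule second_countable_subtopology[OF sc])
    show "is_chart ?Y b c" if "c \<in> torus_chart ` vecs b" for c using that is_chart_torus by blast
    show "topspace ?Y = (\<Union>(U, \<phi>)\<in>torus_chart ` vecs b. U)"
    proof -
      have "x \<in> l1_ball b x rad" if "x \<in> vecs b" for x using that rad_pos by (simp add: l1_ball_def)
      then have "vecs b = (\<Union>x\<in>vecs b. l1_ball b x rad)" by (auto simp: l1_ball_def)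
      then have "torus = (\<Union>x\<in>vecs b. E ` l1_ball b x rad)" unfolding torus_def by (metis image_UN)
      then show ?thesis unfolding topspace_torus torus_chart_def by simp
    qed
    show "smooth_compatible b c d" if mem: "c \<in> torus_chart ` vecs b" "d \<in> torus_chart ` vecs b" for c d
    proof -
      obtain U \<phi> V \<psi> where cd: "c = (U, \<phi>)" "d = (V, \<psi>)" by fastforce
      obtain x y where xy: "(U, \<phi>) = torus_chart x" "(V, \<psi>) = torus_chart y" using mem cd by auto
      show ?thesis unfolding smooth_compatible_def cd
        using compat[OF xy, of "\<lambda>z. z" 1] by (simp add: o_def)
    qed
    show "smooth_map (prod_topology ?Y ?Y) (b + b) (prod_atlas b (torus_chart ` vecs b) (torus_chart ` vecs b)) ?Y b
        (torus_chart ` vecs b) (\<lambda>(x, y). x \<otimes>\<^bsub>?G\<^esub> y)"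
      unfolding smooth_map_def
    proof (intro conjI ballI, rule T.continuous_mult, clarify)
      fix U \<Phi> V \<psi> y assume "(U, \<Phi>) \<in> prod_atlas b (torus_chart ` vecs b) (torus_chart ` vecs b)"
        "(V, \<psi>) = torus_chart y"
      from mult[OF this] show "smooth_real_map_on (b + b) b (\<Phi> ` (U \<inter> ((\<lambda>(x, y). x \<otimes>\<^bsub>?G\<^esub> y) -` V)))
          (\<psi> \<circ> (\<lambda>(x, y). x \<otimes>\<^bsub>?G\<^esub> y) \<circ> inv_into U \<Phi>)" by simp
    qed
    show "smooth_map ?Y b (torus_chart ` vecs b) ?Y b (torus_chart ` vecs b) (\<lambda>x. inv\<^bsub>?G\<^esub> x)"
      unfolding smooth_map_def
    proof (intro conjI ballI, rule T.continuous_inv, clarify)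
      fix U \<phi> V \<psi> x y assume "(U, \<phi>) = torus_chart x" "(V, \<psi>) = torus_chart y"
      moreover have "inv\<^bsub>?G\<^esub> (E z) = E ((- 1) *\<^sub>R z)" if "z \<in> vecs b" for z
        using that E_minus[of z] vecs_b inv_eq[of "E z"] by (simp add: torus_def)
      ultimately show "smooth_real_map_on b b (\<phi> ` (U \<inter> ((\<lambda>x. inv\<^bsub>?G\<^esub> x) -` V))) (\<psi> \<circ> (\<lambda>x. inv\<^bsub>?G\<^esub> x) \<circ> inv_into U \<phi>)"
        by (rule compat[where s = "- 1"]) auto
    qed
  qed
qed

theorem lie_dim_torus:
  assumes "Hausdorff_space X" "second_countable X"
  shows "lie_dim (G\<lparr>carrier := torus\<rparr>) torus_topology = b"
  unfolding lie_dim_def using lie_group_torus[OF assms] lie_group_dimension_unique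
  by (intro the_equality) blast+

end


section \<open>Redundancy rank\<close>

definition dot :: "nat \<Rightarrow> (nat \<Rightarrow> real) \<Rightarrow> (nat \<Rightarrow> real) \<Rightarrow> real" where
  "dot n c x = (\<Sum>i<n. c i * x i)"

lemma dot_add: "dot n c (x + y) = dot n c x + dot n c y"
  and dot_diff: "dot n c (x - y) = dot n c x - dot n c y"
  and dot_minus: "dot n c (- x) = - dot n c x"
  and dot_scaleR: "dot n c (a *\<^sub>R x) = a * dot n c x"
  and dot_0: "dot n c 0 = 0"
  by (simp_all add: dot_def distrib_left right_diff_distrib sum.distrib sum_subtractf sum_negf sum_distrib_left mult_ac)

lemma dot_scaleR_left: "dot n (a *\<^sub>R c) x = a * dot n c x"
  by (simp add: dot_def sum_distrib_left mult_ac)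

lemma dot_single: "i < n \<Longrightarrow> dot n (a *\<^sub>R unit_vec i) x = a * x i"
  by (simp add: dot_def unit_vec_def if_distrib[of "\<lambda>t. t * _"] if_distrib[of "\<lambda>t. _ * t"] cong: if_cong)

lemma dot_unit_vec: "i < n \<Longrightarrow> dot n c (unit_vec i) = c i"
  by (simp add: dot_def unit_vec_def if_distrib[of "\<lambda>t. _ * t"] cong: if_cong)

text \<open>More vectors with rational entries than coordinates are dependent over the rationals.
  This is Gaussian elimination, carried out with rational numbers inside the reals so that the
  coefficients can multiply real values of functionals.\<close>

lemma rational_linear_relation:
  fixes g :: "'s \<Rightarrow> 'e \<Rightarrow> real"
  assumes "finite B" "finite T" "card B < card T" "\<And>t e. t \<in> T \<Longrightarrow> e \<in> B \<Longrightarrow> g t e \<in> \<rat>"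
  shows "\<exists>q. (\<forall>t\<in>T. q t \<in> \<rat>) \<and> (\<exists>t\<in>T. q t \<noteq> 0) \<and> (\<forall>e\<in>B. (\<Sum>t\<in>T. q t * g t e) = 0)"
  using assms
proof (induction B arbitrary: T g rule: finite_induct)
  case empty
  then have "T \<noteq> {}" by auto
  then show ?case by (intro exI[of _ "\<lambda>_. 1"]) auto
next
  case (insert e B)
  show ?case
  proof (cases "\<forall>t\<in>T. g t e = 0")
    case True
    have "card B < card T" using insert.prems(2) insert.hyps by simp
    with insert.IH[of T g] insert.prems obtain q where
      "\<forall>t\<in>T. q t \<in> \<rat>" "\<exists>t\<in>T. q t \<noteq> 0" "\<forall>e\<in>B. (\<Sum>t\<in>T. q t * g t e) = 0" by auto
    then show ?thesis using True by (intro exI[of _ q]) auto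
  next
    case False
    then obtain s where s: "s \<in> T" "g s e \<noteq> 0" by blast
    \<comment> \<open>Elimination of the coordinate \<open>e\<close> with pivot
      \<open>g s e\<close>; all quotients stay rational.\<close>
    define g' where "g' t f = g t f - g t e / g s e * g s f" for t f
    have "card B < card (T - {s})" using insert.prems insert.hyps s by (simp add: card_Diff_singleton)
    moreover have "g' t f \<in> \<rat>" if "t \<in> T - {s}" "f \<in> B" for t f
      unfolding g'_def using that s insert.prems(3) by (intro Rats_diff Rats_mult Rats_divide) auto
    ultimately obtain q where q: "\<forall>t\<in>T - {s}. q t \<in> \<rat>" "\<exists>t\<in>T - {s}. q t \<noteq> 0"
      "\<forall>f\<in>B. (\<Sum>t\<in>T - {s}. q t * g' t f) = 0"
      using insert.IH[of "T - {s}" g'] insert.prems(1) by auto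
    define r where "r = q(s := - (\<Sum>t\<in>T - {s}. q t * (g t e / g s e)))"
    have split: "(\<Sum>t\<in>T. r t * g t f) = (\<Sum>t\<in>T - {s}. q t * g' t f)" for f
    proof -
      have "(\<Sum>t\<in>T. r t * g t f) = r s * g s f + (\<Sum>t\<in>T - {s}. r t * g t f)"
        using s insert.prems(1) by (simp add: sum.remove)
      also have "(\<Sum>t\<in>T - {s}. r t * g t f) = (\<Sum>t\<in>T - {s}. q t * g t f)"
        by (intro sum.cong) (auto simp: r_def)
      also have "r s * g s f = - (\<Sum>t\<in>T - {s}. q t * (g t e / g s e * g s f))"
        by (simp add: r_def sum_distrib_left mult_ac)
      finally show ?thesis by (simp add: g'_def right_diff_distrib sum_subtractf)
    qed
    have "r t \<in> \<rat>" if "t \<in> T" for t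
      unfolding r_def using that q(1) s insert.prems(3)
      by (auto intro!: Rats_sum Rats_mult Rats_divide)
    moreover have "\<exists>t\<in>T. r t \<noteq> 0" using q(2) by (auto simp: r_def)
    moreover have "(\<Sum>t\<in>T. r t * g t f) = 0" if "f \<in> insert e B" for f
    proof (cases "f = e")
      case True
      then show ?thesis unfolding split using s(2) by (simp add: g'_def)
    next
      case False
      then show ?thesis unfolding split using q(3) that by blast
    qed
    ultimately show ?thesis by blast
  qed
qed

section \<open>Functionals that detect topological generation\<close>

context exponential_cover
begin

lemma E_lift: "y \<in> carrier G \<Longrightarrow> \<exists>x. x \<in> vecs n \<and> E x = y"
  unfolding E_surj[symmetric] by auto

text \<open>Such functionals are lifts of the characters of the group that are trivial on
  \<open>S\<close>: the character takes \<open>E x\<close> to the class of \<open>dot n c x\<close>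
  modulo the integers. Inserting \<open>\<one>\<close> makes \<open>c\<close> integral on the
  kernel, so that this class depends on \<open>E x\<close> alone.\<close>

definition integral_on :: "'a set \<Rightarrow> (nat \<Rightarrow> real) \<Rightarrow> bool" where
  "integral_on S c \<longleftrightarrow> (\<forall>x\<in>vecs n. E x \<in> insert \<one> S \<longrightarrow> dot n c x \<in> \<int>)"

lemma integral_on_generate:
  assumes c: "integral_on S c" and S: "S \<subseteq> carrier G" and y: "y \<in> generate G S"
  shows "x \<in> vecs n \<Longrightarrow> E x = y \<Longrightarrow> dot n c x \<in> \<int>"
  using y
proof (induction arbitrary: x rule: generate.induct)
  case one
  then show ?case using c by (auto simp: integral_on_def)
next
  case (incl h)
  then show ?case using c by (auto simp: integral_on_def)
next
  case (inv h)
  then have "E (- x) = h" using E_minus S by (auto simp: subset_iff)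
  then have "dot n c (- x) \<in> \<int>" using c inv by (auto simp: integral_on_def)
  then show ?case by (simp add: dot_minus)
next
  case (eng h1 h2)
  have h: "h1 \<in> carrier G" "h2 \<in> carrier G"
    using eng.hyps generate_in_carrier[OF S] by auto
  \<comment> \<open>Subtracting a lift of \<open>h1\<close> from \<open>x\<close> leaves a lift of
    \<open>h2\<close>, to which the second induction hypothesis applies.\<close>
  obtain x1 where x1: "x1 \<in> vecs n" "E x1 = h1" using E_lift[OF h(1)] by blast
  have "E (x - x1) = h1 \<otimes> h2 \<otimes> inv h1" using E_diff[of x x1] x1 eng.prems by simp
  also have "\<dots> = h2 \<otimes> h1 \<otimes> inv h1" by (simp only: comm[OF h])
  also have "\<dots> = h2" using h by (simp add: m_assoc)
  finally have "E (x - x1) = h2" .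
  with eng.IH(2)[OF vecs_diff[OF eng.prems(1) x1(1)]] have "dot n c (x - x1) \<in> \<int>" .
  moreover have "dot n c x1 \<in> \<int>" using eng.IH(1) x1 by blast
  ultimately have "dot n c (x - x1) + dot n c x1 \<in> \<int>" by (rule Ints_add)
  then show ?case by (simp add: dot_diff)
qed

text \<open>For a nonzero integral functional, the points with a lift of value strictly between 0
  and 1 form a nonempty open set that misses the generated subgroup. Conversely, if that subgroup is
  not dense, neither is its preimage, and Kronecker's theorem supplies a functional.\<close>

lemma top_generates_iff:
  assumes S: "S \<subseteq> carrier G"
  shows "top_generates G X S \<longleftrightarrow> (\<forall>c. integral_on S c \<longrightarrow> (\<forall>i<n. c i = 0))"
proof
  assume gen: "top_generates G X S"
  show "\<forall>c. integral_on S c \<longrightarrow> (\<forall>i<n. c i = 0)"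
  proof (intro allI impI, rule ccontr)
    fix c j assume c: "integral_on S c" and j: "j < n" "c j \<noteq> 0"
    define Q where "Q = {x \<in> vecs n. dot n c x \<in> {0<..<1}}"
    have "continuous_map (Euclidean_space n) euclideanreal (dot n c)"
      unfolding dot_def[abs_def] by (intro continuous_intros continuous_map_Euclidean_coord) auto
    from openin_continuous_map_preimage[OF this, of "{0<..<1}"]
    have "openin X (E ` Q)" unfolding Q_def by (intro E_open) simp
    \<comment> \<open>A point where the functional has the value \<open>1 / 2\<close>.\<close>
    moreover have "(1 / (2 * c j)) *\<^sub>R unit_vec j \<in> Q"
      using j unit_vec_vecs[OF j(1)] by (simp add: Q_def dot_scaleR dot_unit_vec)
    moreover have "E ` Q \<subseteq> topspace X" using E_carrier by (auto simp: Q_def topspace_eq)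
    moreover from calculation have "E ` Q \<noteq> {}" by blast
    ultimately have "generate G S \<inter> E ` Q \<noteq> {}"
      using gen unfolding top_generates_def dense_intersects_open by blast
    then obtain x where x: "x \<in> Q" "E x \<in> generate G S" by blast
    then have "dot n c x \<in> \<int>" using integral_on_generate[OF c S] by (auto simp: Q_def)
    then obtain m where m: "dot n c x = of_int m" by (elim Ints_cases)
    then have "0 < m" "m < 1" using x(1) by (auto simp: Q_def)
    then show False by simp
  qed
next
  assume none: "\<forall>c. integral_on S c \<longrightarrow> (\<forall>i<n. c i = 0)"
  define H where "H = {x \<in> vecs n. E x \<in> generate G S}"
  have sub: "subgroup (generate G S) G" by (rule generate_is_subgroup[OF S])
  have H: "additive_subgroup H"
    using sub by (auto simp: additive_subgroup_def H_def E_0 E_diff subgroup.one_closed subgroup.m_closed subgroup.m_inv_closed)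
  have "dense_on_coords {..<n} H"
  proof (rule ccontr)
    assume "\<not> dense_on_coords {..<n} H"
    then obtain c where c: "\<exists>i\<in>{..<n}. c i \<noteq> 0" "\<forall>h\<in>H. (\<Sum>i<n. c i * h i) \<in> \<int>"
      using kronecker_duality[OF _ H] by blast
    have "integral_on S c"
      unfolding integral_on_def dot_def
    proof (intro ballI impI)
      fix x assume "x \<in> vecs n" "E x \<in> insert \<one> S"
      then have "x \<in> H" by (auto simp: H_def generate.one generate.incl)
      then show "(\<Sum>i<n. c i * x i) \<in> \<int>" using c(2) by blast
    qed
    then show False using none c(1) by blast
  qed
  then have dense: "\<exists>h\<in>H. \<forall>i<n. \<bar>h i - x i\<bar> < e" if "e > 0" for x e
    using that unfolding dense_on_coords_def by blast
  have "generate G S \<inter> W \<noteq> {}" if W: "openin X W" "W \<noteq> {}" for W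
  proof -
    obtain y where y: "y \<in> W" using W by blast
    then have "y \<in> carrier G" using openin_subset[OF W(1)] by (auto simp: topspace_eq)
    then obtain x where x: "x \<in> vecs n" "y = E x" using E_lift by blast
    have "openin (Euclidean_space n) {x \<in> vecs n. E x \<in> W}"
      using openin_continuous_map_preimage[OF E_cont W(1)] by simp
    then obtain e where e: "e > 0" "l1_ball n x e \<subseteq> {x \<in> vecs n. E x \<in> W}"
      using x y openin_Euclidean_iff by blast
    obtain d where d: "d > 0" "coord_box n x d \<subseteq> l1_ball n x e" using coord_box_subset_l1_ball[OF e(1)] by blast
    obtain h where h: "h \<in> H" "\<forall>i<n. \<bar>h i - x i\<bar> < d" using dense[OF d(1)] by blast
    then have "h \<in> coord_box n x d" by (simp add: coord_box_def H_def)
    then have "E h \<in> W" using d(2) e(2) by blast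
    then show ?thesis using h(1) by (auto simp: H_def)
  qed
  then show "top_generates G X S"
    unfolding top_generates_def using S by (simp add: dense_intersects_open)
qed

lemma ker_integral: "integral_on S c \<Longrightarrow> x \<in> ker \<Longrightarrow> dot n c x \<in> \<int>"
  by (auto simp: integral_on_def ker_def)

end

section \<open>Upper and lower bound for the size of irredundant sets\<close>

context normalized_cover
begin

text \<open>
  If \<open>S\<close> is irredundant, each omitted generator \<open>s\<close> yields a functional \<open>f s\<close> that is integral on all
  other generators and irrational on \<open>s\<close>. Completing the first \<open>b\<close> unit vectors to a maximal
  independent set \<open>B\<close> by lifts of generators, the functionals of the unused generators are
  independent over the rationals, and they are determined by their integral values on \<open>B\<close>.
\<close>

theorem card_irredundant_le:
  assumes fin: "finite S" and irr: "irredundant_generating G X S"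
  shows "card S \<le> 2 * n - b"
proof -
  have gen: "top_generates G X S" and SG: "S \<subseteq> carrier G"
    using irr by (auto simp: irredundant_generating_def top_generates_def)
  have "\<forall>s\<in>S. \<exists>x. x \<in> vecs n \<and> E x = s" using SG E_lift by (simp add: subset_iff)
  then obtain l where l: "\<And>s. s \<in> S \<Longrightarrow> l s \<in> vecs n" "\<And>s. s \<in> S \<Longrightarrow> E (l s) = s" by metis
  define U where "U = unit_vec ` {..<b}"
  have Uv: "U \<subseteq> ker" using unit_vec_ker by (auto simp: U_def)
  have Uind: "independent U"
    by (rule independent_mono[OF independent_unit_vecs[of n]]) (use b_le in \<open>auto simp: U_def\<close>)
  have Ucard: "card U = b" unfolding U_def using inj_unit_vec by (simp add: card_image inj_on_subset)
  obtain B where B: "U \<subseteq> B" "B \<subseteq> U \<union> l ` S" "independent B" "U \<union> l ` S \<subseteq> span B"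
    using maximal_independent_subset_extend[OF Un_upper1 Uind] by blast
  have Bv: "B \<subseteq> vecs n" using B(2) Uv ker_vecs l(1) by blast
  note Bfin = independent_vecs_card[OF B(3) Bv]
  \<comment> \<open>The generators whose lifts complete \<open>U\<close> to \<open>B\<close>; they
    are counted separately, by the dimension left over by the torus.\<close>
  define C where "C = {s \<in> S. l s \<in> B - U}"
  have "inj_on l S" by (rule inj_on_inverseI[of S E]) (rule l(2))
  then have "inj_on l C" by (rule inj_on_subset) (simp add: C_def)
  then have "card C = card (l ` C)" by (rule card_image[symmetric])
  also have "l ` C = B - U" using B(2) by (auto simp: C_def)
  also have "card (B - U) = card B - b"
    using B(1) Bfin(1) Ucard by (simp add: card_Diff_subset finite_subset)
  finally have Ccard: "card C = card B - b" .
  have "\<exists>c. integral_on (S - {s}) c \<and> (\<exists>i<n. c i \<noteq> 0)" if "s \<in> S" for s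
    using irr that SG top_generates_iff[of "S - {s}"] unfolding irredundant_generating_def by blast
  then obtain f where f: "\<And>s. s \<in> S \<Longrightarrow> integral_on (S - {s}) (f s)" "\<And>s. s \<in> S \<Longrightarrow> \<exists>i<n. f s i \<noteq> 0"
    by metis
  have f_other: "dot n (f s) (l t) \<in> \<int>" if "s \<in> S" "t \<in> S" "t \<noteq> s" for s t
    using f(1)[OF that(1)] l that by (auto simp: integral_on_def)
  \<comment> \<open>A rational value with denominator \<open>q\<close> would make \<open>q\<close>
    times the functional integral on all of \<open>S\<close>, against generation.\<close>
  have f_self: "dot n (f s) (l s) \<notin> \<rat>" if s: "s \<in> S" for s
  proof
    assume "dot n (f s) (l s) \<in> \<rat>"
    then obtain p q :: int where q: "q > 0" "dot n (f s) (l s) = of_int p / of_int q" using Rats_cases' by metis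
    have "integral_on S (of_int q *\<^sub>R f s)"
      unfolding integral_on_def
    proof (intro ballI impI)
      fix x assume x: "x \<in> vecs n" "E x \<in> insert \<one> S"
      show "dot n (of_int q *\<^sub>R f s) x \<in> \<int>"
      proof (cases "E x = s")
        case True
        then have "x - l s \<in> ker" using E_eq_iff[OF x(1) l(1)[OF s]] l(2)[OF s] by simp
        then have "dot n (f s) (x - l s) \<in> \<int>" by (rule ker_integral[OF f(1)[OF s]])
        then have "of_int q * dot n (f s) (x - l s) + of_int p \<in> \<int>" by simp
        moreover have "of_int q * dot n (f s) (x - l s) + of_int p = dot n (of_int q *\<^sub>R f s) x"
          using q by (simp add: dot_diff dot_scaleR_left right_diff_distrib)
        ultimately show ?thesis by simp
      next
        case False
        then have "dot n (f s) x \<in> \<int>" using f(1)[OF s] x by (auto simp: integral_on_def)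
        then show ?thesis by (simp add: dot_scaleR_left)
      qed
    qed
    then have "\<forall>i<n. (of_int q *\<^sub>R f s) i = 0" using gen top_generates_iff[OF SG] by blast
    then show False using f(2)[OF s] q(1) by auto
  qed
  have "card (S - C) \<le> card B"
  proof (rule ccontr)
    assume "\<not> card (S - C) \<le> card B"
    moreover have "dot n (f s) e \<in> \<rat>" if s: "s \<in> S - C" and e: "e \<in> B" for s e
    proof (cases "e \<in> U")
      case True
      then have "e \<in> ker" using Uv by blast
      then have "dot n (f s) e \<in> \<int>" using ker_integral f(1) s by blast
      then show ?thesis using Ints_subset_Rats by blast
    next
      case False
      then obtain t where t: "t \<in> S" "e = l t" using B(2) e by blast
      then have "t \<noteq> s" using False e s by (auto simp: C_def)
      then have "dot n (f s) e \<in> \<int>" using f_other t s by blast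
      then show ?thesis using Ints_subset_Rats by blast
    qed
    ultimately obtain q where q: "\<forall>s\<in>S - C. q s \<in> \<rat>" "\<exists>s\<in>S - C. q s \<noteq> 0"
      "\<forall>e\<in>B. (\<Sum>s\<in>S - C. q s * dot n (f s) e) = 0"
      using rational_linear_relation[OF Bfin(1), of "S - C" "\<lambda>s. dot n (f s)"] fin by auto
    \<comment> \<open>The combination of functionals is linear and vanishes on \<open>B\<close>,
      hence at the lifts of all generators.\<close>
    have "subspace {x. (\<Sum>s\<in>S - C. q s * dot n (f s) x) = 0}"
    proof (rule subspaceI)
      show "c *\<^sub>R x \<in> {x. (\<Sum>s\<in>S - C. q s * dot n (f s) x) = 0}"
        if "x \<in> {x. (\<Sum>s\<in>S - C. q s * dot n (f s) x) = 0}" for c x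
      proof -
        have "(\<Sum>s\<in>S - C. q s * dot n (f s) (c *\<^sub>R x)) = c * (\<Sum>s\<in>S - C. q s * dot n (f s) x)"
          by (simp add: dot_scaleR sum_distrib_left mult_ac)
        then show ?thesis using that by simp
      qed
    qed (simp_all add: dot_0 dot_add distrib_left sum.distrib)
    then have "span B \<subseteq> {x. (\<Sum>s\<in>S - C. q s * dot n (f s) x) = 0}"
      using q(3) by (intro span_minimal) auto
    then have zero: "(\<Sum>s\<in>S - C. q s * dot n (f s) (l t)) = 0" if "t \<in> S" for t
      using B(4) that by auto
    obtain t where t: "t \<in> S - C" "q t \<noteq> 0" using q(2) by blast
    \<comment> \<open>At the lift of \<open>t\<close> all other terms are rational, so the vanishing
      of the sum would make the value of \<open>f t\<close> there rational too.\<close>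
    have "(\<Sum>s\<in>S - C. q s * dot n (f s) (l t)) = q t * dot n (f t) (l t) + (\<Sum>s\<in>S - C - {t}. q s * dot n (f s) (l t))"
      using t fin by (simp add: sum.remove)
    then have "q t * dot n (f t) (l t) = - (\<Sum>s\<in>S - C - {t}. q s * dot n (f s) (l t))"
      using zero[of t] t(1) by simp
    moreover have "(\<Sum>s\<in>S - C - {t}. q s * dot n (f s) (l t)) \<in> \<rat>"
    proof (rule Rats_sum)
      fix s assume s: "s \<in> S - C - {t}"
      then have "dot n (f s) (l t) \<in> \<int>" using f_other t by blast
      then show "q s * dot n (f s) (l t) \<in> \<rat>" using q(1) s Ints_subset_Rats by (intro Rats_mult) auto
    qed
    ultimately have "q t * dot n (f t) (l t) \<in> \<rat>" by simp
    then have "q t * dot n (f t) (l t) / q t \<in> \<rat>" using q(1) t(1) by (intro Rats_divide) auto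
    then show False using f_self[of t] t by simp
  qed
  \<comment> \<open>The two parts have at most \<open>card B - b\<close> and \<open>card B\<close>
    elements, and \<open>card B \<le> n\<close>.\<close>
  moreover have "card S = card C + card (S - C)"
    using fin by (subst card_Diff_subset) (auto simp: C_def card_mono)
  moreover have "b \<le> card B" using card_mono[OF Bfin(1) B(1)] Ucard by simp
  ultimately show ?thesis using Ccard Bfin(2) by linarith
qed

text \<open>A coordinate of a discrete group need not take discrete values. Here it does, because
  the other coordinates can be reduced modulo unit vectors, which lie in the kernel: values tending
  to 0 would come from a bounded sequence of kernel elements, and such a sequence has an eventually
  constant subsequence.\<close>

lemma ker_coord_discrete:
  assumes i: "i < b"
  shows "\<exists>e>0. \<forall>h\<in>ker. \<bar>h i\<bar> < e \<longrightarrow> h i = 0"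
proof (rule ccontr)
  assume neg: "\<not> ?thesis"
  have "\<exists>h\<in>ker. \<bar>h i\<bar> < inverse (real (Suc k)) \<and> h i \<noteq> 0" for k
    using neg by (metis inverse_positive_iff_positive of_nat_0_less_iff zero_less_Suc)
  then obtain h where h: "\<And>k. h k \<in> ker" "\<And>k. \<bar>h k i\<bar> < inverse (real (Suc k))" "\<And>k. h k i \<noteq> 0" by metis
  define g where "g k = h k - (\<Sum>j\<in>{..<b} - {i}. of_int \<lfloor>h k j\<rfloor> *\<^sub>R unit_vec j)" for k
  have gker: "g k \<in> ker" for k
    unfolding g_def by (intro additive_subgroup_diff[OF additive_subgroup_ker] h(1) int_comb_in_ker) auto
  have gj: "g k j = (if j = i then h k i else frac (h k j))" if "j < b" for k j
    using that by (simp add: g_def sum_fun_apply unit_vec_def frac_def if_distrib[of "\<lambda>t. _ * t"] cong: if_cong)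
  have bounded: "\<bar>g k j\<bar> \<le> 1" if "j \<in> {..<b}" for k j
  proof (cases "j = i")
    case True
    have "inverse (real (Suc k)) \<le> 1" by (simp add: field_simps)
    then show ?thesis using h(2)[of k] gj[of j k] that True by simp
  next
    case False
    then show ?thesis using gj[of j k] that frac_lt_1[of "h k j"] by simp
  qed
  obtain r l where r: "strict_mono (r::nat \<Rightarrow> nat)" and l: "\<And>j. j \<in> {..<b} \<Longrightarrow> (\<lambda>k. g (r k) j) \<longlonglongrightarrow> l j"
    using coordinatewise_convergent_subsequence[of "{..<b}" g "\<lambda>_. 1", OF finite_lessThan bounded] by blast
  have "(\<lambda>k. l1 b (g (r k) - l)) \<longlonglongrightarrow> (\<Sum>j<b. \<bar>l j - l j\<bar>)"
    unfolding l1_def fun_diff_def by (intro tendsto_intros l)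
  then have "(\<lambda>k. l1 b (g (r k) - l)) \<longlonglongrightarrow> 0" by simp
  from tendstoD[OF this, of "4 * rad"] rad_pos
  obtain K where K: "\<And>k. k \<ge> K \<Longrightarrow> l1 b (g (r k) - l) < 4 * rad"
    by (auto simp: eventually_sequentially dist_real_def)
  have eq: "g (r k) = g (r K)" if "k \<ge> K" for k
  proof -
    have "l1 b (g (r k) - g (r K)) < 8 * rad"
      using l1_triangle_diff[of b "g (r k)" "g (r K)" l] K[OF that] K[OF order_refl]
      by (simp add: l1_minus_commute[of b l])
    then have "g (r k) - g (r K) = 0"
      by (intro ker_small additive_subgroup_diff[OF additive_subgroup_ker] gker)
    then show ?thesis by simp
  qed
  define a where "a = h (r K) i"
  have a: "h (r k) i = a" if "k \<ge> K" for k
    using eq[OF that] gj[OF i] unfolding a_def by metis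
  have "\<bar>a\<bar> > 0" using h(3) by (simp add: a_def)
  then obtain m where m: "inverse (real (Suc m)) < \<bar>a\<bar>" using reals_Archimedean by blast
  define k where "k = max K m"
  have "r k \<ge> m" using seq_suble[OF r, of k] by (simp add: k_def)
  then have "inverse (real (Suc (r k))) \<le> inverse (real (Suc m))" by simp
  moreover have "\<bar>a\<bar> < inverse (real (Suc (r k)))" using h(2)[of "r k"] a[of k] by (simp add: k_def)
  ultimately show False using m by linarith
qed

text \<open>Each \<open>p\<close> in \<open>P\<close> has its own multiple of a coordinate
  functional, non-integral at \<open>p\<close> and integral on the rest of \<open>P\<close> and on
  the kernel. The factor is \<open>1 / \<theta>\<close> if \<open>p\<close> is a unit vector, 1 if
  \<open>p\<close> is \<open>\<theta>\<close> times a unit vector beyond \<open>b\<close>, and a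
  suitable nonzero integer in the torus directions, where the kernel may contain fractional
  coordinates.\<close>

theorem exists_irredundant:
  "\<exists>S. finite S \<and> irredundant_generating G X S \<and> card S = 2 * n - b"
proof -
  obtain \<theta> :: real where \<theta>: "\<theta> \<notin> \<rat>"
    using uncountable_UNIV_real countable_rat by (metis UNIV_eq_I)
  have \<theta>0: "\<theta> \<noteq> 0" "\<theta> \<noteq> 1" using \<theta> by auto
  \<comment> \<open>Generation reduces to this fact in each coordinate separately: a coefficient
    that is integral on both 1 and \<open>\<theta>\<close> vanishes.\<close>
  have \<theta>int: "a = 0" if "a \<in> \<int>" "a * \<theta> \<in> \<int>" for a
  proof (rule ccontr)
    assume "a \<noteq> 0"
    moreover have "a * \<theta> / a \<in> \<rat>" using that Ints_subset_Rats by (intro Rats_divide) auto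
    ultimately show False using \<theta> by simp
  qed
  have "1 / \<theta> \<notin> \<int>"
    using \<theta>int[of "1 / \<theta>"] \<theta>0 by auto
  have \<theta>Z: "\<theta> \<notin> \<int>" using \<theta> Ints_subset_Rats by blast
  define P where "P = unit_vec ` {b..<n} \<union> (\<lambda>i. \<theta> *\<^sub>R unit_vec i) ` {..<n}"
  have Pv: "P \<subseteq> vecs n" using unit_vec_vecs by (auto simp: P_def)
  have uv: "unit_vec i j = (if j = i then 1 else 0)" for i j by (simp add: unit_vec_def)
  have separate: "\<exists>f. dot n f p \<notin> \<int> \<and> (\<forall>x\<in>P - {p}. dot n f x \<in> \<int>) \<and> (\<forall>x\<in>ker. dot n f x \<in> \<int>)" if p: "p \<in> P" for p
  proof -
    consider i where "b \<le> i" "i < n" "p = unit_vec i" | i where "b \<le> i" "i < n" "p = \<theta> *\<^sub>R unit_vec i"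
      | i where "i < b" "p = \<theta> *\<^sub>R unit_vec i"
    proof -
      from p consider i where "i \<in> {b..<n}" "p = unit_vec i" | i where "i < n" "p = \<theta> *\<^sub>R unit_vec i"
        unfolding P_def by blast
      then show ?thesis
      proof cases
        case (1 i)
        then show ?thesis using that(1)[of i] by simp
      next
        case (2 i)
        then show ?thesis using that(2,3)[of i] by (cases "b \<le> i") auto
      qed
    qed
    then show ?thesis
    proof cases
      case (1 i)
      have "dot n ((1 / \<theta>) *\<^sub>R unit_vec i) x \<in> \<int>" if "x \<in> P - {p}" for x
        using that 1 \<theta>0 unfolding dot_single[OF 1(2)] P_def by (auto simp: uv)
      moreover have "dot n ((1 / \<theta>) *\<^sub>R unit_vec i) x \<in> \<int>" if "x \<in> ker" for x
        using ker_coords[OF that 1(1)] by (simp add: dot_single[OF 1(2)])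
      moreover have "dot n ((1 / \<theta>) *\<^sub>R unit_vec i) p \<notin> \<int>"
        using \<open>1 / \<theta> \<notin> \<int>\<close> by (simp add: dot_single[OF 1(2)] 1(3) uv)
      ultimately show ?thesis by blast
    next
      case (2 i)
      have "dot n (1 *\<^sub>R unit_vec i) x \<in> \<int>" if "x \<in> P - {p}" for x
        using that 2 unfolding dot_single[OF 2(2)] P_def by (auto simp: uv)
      moreover have "dot n (1 *\<^sub>R unit_vec i) x \<in> \<int>" if "x \<in> ker" for x
        using ker_coords[OF that 2(1)] by (simp only: dot_single[OF 2(2)]) simp
      moreover have "dot n (1 *\<^sub>R unit_vec i) p \<notin> \<int>"
        unfolding dot_single[OF 2(2)] using \<theta>Z by (simp add: 2(3) uv)
      ultimately show ?thesis by blast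
    next
      case (3 i)
      have i: "i < n" using 3(1) b_le by simp
      obtain e where "e > 0" "\<And>h. h \<in> ker \<Longrightarrow> \<bar>h i\<bar> < e \<Longrightarrow> h i = 0" using ker_coord_discrete[OF 3(1)] by blast
      then obtain c where c: "c \<noteq> 0" "\<forall>h\<in>ker. c * h i \<in> \<int>"
        using discrete_real_subgroup_functional[OF additive_subgroup_ker] by blast
      \<comment> \<open>The kernel contains \<open>unit_vec i\<close>, so the factor is itself an
        integer; being nonzero, it cannot have an integral product with
        \<open>\<theta>\<close>.\<close>
      have cZ: "c \<in> \<int>" using c(2) unit_vec_ker[OF 3(1)] by (auto simp: uv dest: bspec[of _ _ "unit_vec i"])
      have "dot n (c *\<^sub>R unit_vec i) x \<in> \<int>" if "x \<in> P - {p}" for x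
        using that 3 unfolding dot_single[OF i] P_def by (auto simp: uv)
      moreover have "dot n (c *\<^sub>R unit_vec i) x \<in> \<int>" if "x \<in> ker" for x
        using c(2) that by (simp add: dot_single[OF i])
      moreover have "dot n (c *\<^sub>R unit_vec i) p \<notin> \<int>"
        using \<theta>int[OF cZ] c(1) by (auto simp: dot_single[OF i] 3(2) uv)
      ultimately show ?thesis by blast
    qed
  qed
  \<comment> \<open>The image has as many elements as \<open>P\<close>: two elements with the same
    image would differ by a kernel element, on which a separating functional is integral.\<close>
  have E_inj: "inj_on E P"
  proof (rule inj_onI, rule ccontr)
    fix p p' assume p: "p \<in> P" "p' \<in> P" "E p = E p'" "p \<noteq> p'"
    obtain f where f: "dot n f p \<notin> \<int>" "\<forall>x\<in>P - {p}. dot n f x \<in> \<int>" "\<forall>x\<in>ker. dot n f x \<in> \<int>"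
      using separate[OF p(1)] by blast
    have "p - p' \<in> ker" using E_eq_iff[of p p'] p Pv by auto
    then have "dot n f (p - p') + dot n f p' \<in> \<int>" using f p by (intro Ints_add) auto
    then show False using f(1) by (simp add: dot_diff)
  qed
  have gen: "top_generates G X (E ` P)"
  proof -
    have "c i = 0" if c: "integral_on (E ` P) c" and i: "i < n" for c i
    proof (rule \<theta>int)
      have Pint: "dot n c x \<in> \<int>" if "x \<in> P" for x using c that Pv by (auto simp: integral_on_def)
      show "c i \<in> \<int>"
      proof (cases "i < b")
        case True
        then show ?thesis using ker_integral[OF c unit_vec_ker[OF True]] unfolding dot_unit_vec[OF i] by blast
      next
        case False
        then have "unit_vec i \<in> P" using i by (auto simp: P_def)
        then show ?thesis using Pint dot_unit_vec[OF i] by metis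
      qed
      have "\<theta> *\<^sub>R unit_vec i \<in> P" using i by (auto simp: P_def)
      from Pint[OF this] show "c i * \<theta> \<in> \<int>" by (simp add: dot_scaleR dot_unit_vec[OF i] mult.commute)
    qed
    moreover have "E ` P \<subseteq> carrier G" using Pv E_carrier by blast
    ultimately show ?thesis using top_generates_iff by blast
  qed
  have irr: "\<not> top_generates G X (E ` P - {E p})" if p: "p \<in> P" for p
  proof
    assume g: "top_generates G X (E ` P - {E p})"
    obtain f where f: "dot n f p \<notin> \<int>" "\<forall>x\<in>P - {p}. dot n f x \<in> \<int>" "\<forall>x\<in>ker. dot n f x \<in> \<int>"
      using separate[OF p] by blast
    have "integral_on (E ` P - {E p}) f"
      unfolding integral_on_def
    proof (intro ballI impI)
      fix x assume x: "x \<in> vecs n" "E x \<in> insert \<one> (E ` P - {E p})"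
      show "dot n f x \<in> \<int>"
      proof (cases "E x = \<one>")
        case True
        then show ?thesis using f(3) x(1) by (simp add: ker_def)
      next
        case False
        then obtain p' where p': "p' \<in> P" "p' \<noteq> p" "E x = E p'" using x(2) by auto
        then have "x - p' \<in> ker" using E_eq_iff[of x p'] x(1) Pv by auto
        then have "dot n f (x - p') + dot n f p' \<in> \<int>" using f p' by (intro Ints_add) auto
        then show ?thesis by (simp add: dot_diff)
      qed
    qed
    moreover have "E ` P - {E p} \<subseteq> carrier G" using Pv E_carrier by blast
    ultimately have "\<forall>i<n. f i = 0" using g top_generates_iff by blast
    then have "dot n f p = 0" by (simp add: dot_def)
    then show False using f(1) by simp
  qed
  have "card P = 2 * n - b"
  proof -
    have "unit_vec ` {b..<n} \<inter> (\<lambda>i. \<theta> *\<^sub>R unit_vec i) ` {..<n} = {}"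
    proof (rule ccontr)
      assume "\<not> ?thesis"
      then obtain i j where "unit_vec i = \<theta> *\<^sub>R unit_vec j" by auto
      from fun_cong[OF this, of i] show False using \<theta>0 by (auto simp: uv split: if_splits)
    qed
    then have "card P = card (unit_vec ` {b..<n}) + card ((\<lambda>i. \<theta> *\<^sub>R unit_vec i) ` {..<n})"
      unfolding P_def by (intro card_Un_disjoint) auto
    also have "card (unit_vec ` {b..<n}) = n - b"
      using inj_unit_vec by (simp add: card_image inj_on_subset)
    also have "card ((\<lambda>i. \<theta> *\<^sub>R unit_vec i) ` {..<n}) = n"
    proof -
      have "inj (\<lambda>i. \<theta> *\<^sub>R unit_vec i)" using inj_unit_vec \<theta>0 by (auto simp: inj_def)
      then show ?thesis by (simp add: card_image inj_on_subset)
    qed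
    finally show ?thesis using b_le by simp
  qed
  then have "card (E ` P) = 2 * n - b" using E_inj by (simp add: card_image)
  moreover have "finite (E ` P)" by (simp add: P_def)
  ultimately show ?thesis using gen irr unfolding irredundant_generating_def by blast
qed

theorem redundancy_rank_eq: "redundancy_rank G X = enat (2 * n - b)"
  unfolding redundancy_rank_def
proof (rule antisym)
  show "(SUP S\<in>{S. finite S \<and> irredundant_generating G X S}. enat (card S)) \<le> enat (2 * n - b)"
    using card_irredundant_le by (intro SUP_least) auto
  obtain S where "finite S" "irredundant_generating G X S" "card S = 2 * n - b"
    using exists_irredundant by blast
  then show "enat (2 * n - b) \<le> (SUP S\<in>{S. finite S \<and> irredundant_generating G X S}. enat (card S))"
    by (intro SUP_upper2[of S]) auto
qed

end

theorem theorem1p9: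
  fixes A :: "('a, 'b) monoid_scheme" and X :: "'a topology" and n :: nat
    and atlas :: "'a chart set" and T :: "'a set"
  assumes "lie_group A X n atlas"
    and "comm_group A"
    and "connected_space X"
    and "T = maximal_torus A X"
  shows "ereal_of_enat (redundancy_rank A X)
           = ereal (2 * real n - real (lie_dim (A\<lparr>carrier := T\<rparr>) (subtopology X T)))"
proof -
  interpret A: lie_group A X n atlas by fact
  obtain E where "exponential_cover A X n E"
    using A.exists_exponential_cover assms(2,3) by blast
  then obtain F b where "normalized_cover A X n F b"
    using exponential_cover.exists_normalized_cover by blast
  then interpret N: normalized_cover A X n F b .
  have "T = N.torus" using assms(4) N.maximal_torus_eq by simp
  then have "lie_dim (A\<lparr>carrier := T\<rparr>) (subtopology X T) = b"
    using N.lie_dim_torus[OF A.Hausdorff A.second_countable] by simp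
  \<comment> \<open>With \<open>b \<le> n\<close> the truncated difference of natural numbers agrees
    with the difference of reals.\<close>
  then show ?thesis
    using N.redundancy_rank_eq N.b_le by simp
qed

end
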